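(* Let $n\ge 4$, $2\le r\le n-2$, $e\ge 1$, and let $\{c_l\}_{1\le l\le r(n-r)}$ be a splitting type for the restricted tangent bundle. The locus of morphisms $\varphi$ in $\mathrm{Mor}_e(\mathbb{P}^1,G(r,n))$ with the restricted tangent bundle $\varphi^*T_{G(r,n)}$ having the splitting type $\{c_l\}_{1\le l\le r(n-r)}$ is stratified by (i.e. is the disjoint union of) the loci $M(b_\bullet)\cap M'(a_\bullet)$, where $\{a_\bullet\}$ and $\{b_\bullet\}$ are the non-negative increasing splitting types for $\varphi^*\mathcal{S}^*$ and $\varphi^*\mathcal{Q}$ arising from the distinct fillings for $\{c_l\}_{1\le l\le r(n-r)}$.
   Context: $\mathbb{K}$ is an algebraically closed field of characteristic zero and $\mathbb{P}^1=\mathbb{P}^1_{\mathbb{K}}$. $G(r,n)$ is the Grassmannian of $r$-dimensional subspaces of an $n$-dimensional $\mathbb{K}$-vector space, with universal sub-bundle $\mathcal{S}$ and universal quotient bundle $\mathcal{Q}$; $T_{G(r,n)}\cong\mathcal{S}^*\otimes\mathcal{Q}$. $\mathrm{Mor}_e(\mathbb{P}^1,G(r,n))$ parametrizes degree $e$ morphisms. The splitting type of a vector bundle $\bigoplus_i\mathcal{O}(\alpha_i)$ on $\mathbb{P}^1$ is the collection of integers $\alpha_i$. $M(b_\bullet)$ is the locus of $f$ with $f^*\mathcal{Q}\cong\bigoplus_j\mathcal{O}(b_j)$, and $M'(a_\bullet)$ the locus of $f$ with $f^*\mathcal{S}^*\cong\bigoplus_i\mathcal{O}(a_i)$. A collection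 of integers $\alpha_1,\dots,\alpha_\nu$ is non-negative if all $\alpha_i\ge 0$, and increasing if $\alpha_1\le\cdots\le\alpha_\nu$. A filling for $\{c_l\}_{1\le l\le r(n-r)}$ is an $r\times(n-r)$ matrix $(a_{i,j})$ whose entries are the $c_l$ (each used exactly once, with multiplicity), such that entries are weakly increasing along each row and down each column ($a_{i,j}\le a_{i,j+1}$, $a_{i,j}\le a_{i+1,j}$), the difference $a_{i+1,j}-a_{i,j}$ is independent of $j$ for each $i$, and the difference $a_{i,j+1}-a_{i,j}$ is independent of $i$ for each $j$. The splitting types arising from a filling are the non-negative increasing $a_1\le\cdots\le a_r$ and $b_1\le\cdots\le b_{n-r}$ with $\sum a_i=\sum b_j=e$ and $a_i+b_j=a_{i,j}$; they are determined by $e=\frac1n\sum_{i,j}a_{i,j}$, $a_i=\frac1{n-r}\left(\sum_j a_{i,j}-e\right)$, $b_j=\frac1r\left(\sum_i a_{i,j}-e\right)$. *)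

theory Defs
  imports
    "HOL-Computational_Algebra.Computational_Algebra"
    "HOL-Library.Disjoint_Sets"
    "Jordan_Normal_Form.Determinant"
    "Jordan_Normal_Form.Matrix_Kernel"
    "Jordan_Normal_Form.DL_Submatrix"
    "Jordan_Normal_Form.VS_Connect"
begin

section \<open>The projective line as a classical variety\<close>

text \<open>The point \<open>Affine c\<close> is \<open>[c : 1]\<close>, and \<open>Infinity\<close> is \<open>[1 : 0]\<close>.\<close>

datatype 'k P1 = Affine 'k | Infinity

fun hcoord :: "nat \<Rightarrow> 'k::field P1 \<Rightarrow> 'k" where
  "hcoord i (Affine c) = (if i = 0 then c else 1)"
| "hcoord i Infinity = (if i = 0 then 1 else 0)"

text \<open>The value at (the chosen representative of) a point of the binary form of degree \<open>d\<close>
  whose coefficient at \<open>X^i * Y^(d - i)\<close> is \<open>coeff p i\<close>; coefficients of \<open>p\<close> beyond \<open>d\<close> are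
  ignored, so every binary form of degree \<open>d\<close> is obtained. Both the vanishing of a form and the
  quotient of two forms of equal degree are independent of the representative.\<close>

definition form :: "nat \<Rightarrow> 'k::field poly \<Rightarrow> 'k P1 \<Rightarrow> 'k" where
  "form d p x = (\<Sum>i\<le>d. coeff p i * hcoord 0 x ^ i * hcoord 1 x ^ (d - i))"

definition zariski_open :: "'k::field P1 set \<Rightarrow> bool" where
  "zariski_open U \<longleftrightarrow>
     (\<forall>x\<in>U. \<exists>d q. form d q x \<noteq> 0 \<and> {y. form d q y \<noteq> 0} \<subseteq> U)"

definition regular_on :: "'k::field P1 set \<Rightarrow> ('k P1 \<Rightarrow> 'k) \<Rightarrow> bool" where
  "regular_on U f \<longleftrightarrow>
     (\<forall>x\<in>U. \<exists>d p q. form d q x \<noteq> 0 \<and>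
        (\<forall>y\<in>U. form d q y \<noteq> 0 \<longrightarrow> f y = form d p y / form d q y))"


section \<open>Vector bundles given by local trivialisations\<close>

text \<open>A vector bundle on a space of points \<open>'x\<close> is recorded by a trivialising cover
  \<open>(chart i)\<close>, \<open>i \<in> chart_index\<close>, and its transition matrices: the fibre coordinates
  \<open>s\<^sub>i\<close> and \<open>s\<^sub>j\<close> of the same vector over a point \<open>x\<close> of both charts satisfy
  \<open>s\<^sub>i = transition i j x *\<^sub>v s\<^sub>j\<close>. Values of \<open>transition i j\<close> off the overlap are irrelevant.
  The record does not enforce covering, the cocycle condition or regularity; the universal
  bundles, the tangent bundle and their pullbacks along morphisms satisfy them.\<close>

record ('x, 'i, 'k) vbundle =
  bundle_rank :: nat
  chart_index :: "'i set"
  chart :: "'i \<Rightarrow> 'x set"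
  transition :: "'i \<Rightarrow> 'i \<Rightarrow> 'x \<Rightarrow> 'k mat"

definition pullback :: "('y \<Rightarrow> 'x) \<Rightarrow> ('x, 'i, 'k) vbundle \<Rightarrow> ('y, 'i, 'k) vbundle" where
  "pullback f E = \<lparr>bundle_rank = bundle_rank E, chart_index = chart_index E,
     chart = (\<lambda>i. f -` chart E i), transition = (\<lambda>i j y. transition E i j (f y))\<rparr>"

text \<open>The dual cocycle is the inverse transpose, and the inverse of \<open>transition i j\<close> is
  \<open>transition j i\<close>.\<close>

definition dual :: "('x, 'i, 'k) vbundle \<Rightarrow> ('x, 'i, 'k) vbundle" where
  "dual E = \<lparr>bundle_rank = bundle_rank E, chart_index = chart_index E, chart = chart E,
     transition = (\<lambda>i j x. transpose_mat (transition E j i x))\<rparr>"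

definition det_bundle :: "('x, 'i, 'k::comm_ring_1) vbundle \<Rightarrow> ('x, 'i, 'k) vbundle" where
  "det_bundle E = \<lparr>bundle_rank = 1, chart_index = chart_index E, chart = chart E,
     transition = (\<lambda>i j x. mat 1 1 (\<lambda>_. det (transition E i j x)))\<rparr>"

text \<open>An isomorphism of bundles on the projective line, in local coordinates:
  \<open>L k i\<close> takes the \<open>i\<close>-coordinates on \<open>E\<close> to the \<open>k\<close>-coordinates on \<open>F\<close>.\<close>

definition bundle_iso ::
  "('k::field P1, 'i, 'k) vbundle \<Rightarrow> ('k P1, 'j, 'k) vbundle \<Rightarrow> bool" where
  "bundle_iso E F \<longleftrightarrow> bundle_rank E = bundle_rank F \<and>
     (\<exists>L :: 'j \<Rightarrow> 'i \<Rightarrow> 'k P1 \<Rightarrow> 'k mat.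
        (\<forall>i\<in>chart_index E. \<forall>k\<in>chart_index F.
           (\<forall>x\<in>chart E i \<inter> chart F k.
              L k i x \<in> carrier_mat (bundle_rank E) (bundle_rank E) \<and> invertible_mat (L k i x)) \<and>
           (\<forall>s<bundle_rank E. \<forall>t<bundle_rank E.
              regular_on (chart E i \<inter> chart F k) (\<lambda>x. L k i x $$ (s, t)))) \<and>
        (\<forall>i\<in>chart_index E. \<forall>j\<in>chart_index E. \<forall>k\<in>chart_index F. \<forall>l\<in>chart_index F.
           \<forall>x\<in>chart E i \<inter> chart E j \<inter> chart F k \<inter> chart F l.
              L k i x * transition E i j x = transition F k l x * L l j x))"

text \<open>The direct sum of the line bundles \<open>O(d)\<close>, \<open>d\<close> in \<open>ds\<close>. The cover consists of the loci
  where a homogeneous coordinate is nonzero, and the fibre coordinate \<open>s\<^sub>i\<close> of a section of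
  \<open>O(d)\<close> is that section divided by the \<open>d\<close>-th power of the \<open>i\<close>-th homogeneous coordinate.\<close>

definition sum_O :: "int list \<Rightarrow> ('k::field P1, nat, 'k) vbundle" where
  "sum_O ds = \<lparr>bundle_rank = length ds, chart_index = {0, 1}, chart = (\<lambda>i. {x. hcoord i x \<noteq> 0}),
     transition = (\<lambda>i j x. mat_diag (length ds) (\<lambda>k. (hcoord j x / hcoord i x) powi (ds ! k)))\<rparr>"

definition has_splitting_type :: "('k::field P1, 'i, 'k) vbundle \<Rightarrow> int multiset \<Rightarrow> bool" where
  "has_splitting_type E C \<longleftrightarrow> (\<exists>ds. mset ds = C \<and> bundle_iso E (sum_O ds))"


section \<open>The Grassmannian\<close>

definition grassmannian :: "nat \<Rightarrow> nat \<Rightarrow> 'k::field vec set set" where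
  "grassmannian r n = {V. VectorSpace.subspace class_ring V (module_vec TYPE('k) n) \<and>
     vectorspace.dim class_ring (module_vec TYPE('k) n \<lparr>carrier := V\<rparr>) = r}"

text \<open>The standard affine charts are indexed by the \<open>r\<close>-subsets \<open>I\<close> of \<open>{0..<n}\<close>. The chart of
  \<open>I\<close> consists of the subspaces having a (necessarily unique) basis, written as the columns of an
  \<open>n \<times> r\<close> matrix, whose rows in \<open>I\<close> form the identity matrix. Its remaining rows are the affine
  coordinates of the subspace.\<close>

definition gr_index :: "nat \<Rightarrow> nat \<Rightarrow> nat set set" where
  "gr_index r n = {I. I \<subseteq> {0..<n} \<and> card I = r}"

definition is_frame :: "nat \<Rightarrow> nat \<Rightarrow> nat set \<Rightarrow> 'k::field vec set \<Rightarrow> 'k mat \<Rightarrow> bool" where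
  "is_frame r n I V A \<longleftrightarrow> A \<in> carrier_mat n r \<and> submatrix A I UNIV = 1\<^sub>m r \<and>
     V = (\<lambda>v. A *\<^sub>v v) ` carrier_vec r"

definition gr_chart :: "nat \<Rightarrow> nat \<Rightarrow> nat set \<Rightarrow> 'k::field vec set set" where
  "gr_chart r n I = {V \<in> grassmannian r n. \<exists>A. is_frame r n I V A}"

definition frame :: "nat \<Rightarrow> nat \<Rightarrow> nat set \<Rightarrow> 'k::field vec set \<Rightarrow> 'k mat" where
  "frame r n I V = (THE A. is_frame r n I V A)"

definition gr_coords :: "nat \<Rightarrow> nat \<Rightarrow> nat set \<Rightarrow> 'k::field vec set \<Rightarrow> 'k mat" where
  "gr_coords r n I V = submatrix (frame r n I V) (- I) UNIV"

text \<open>On the chart of \<open>I\<close>, the unit vectors outside \<open>I\<close> give a basis of \<open>K^n / V\<close>. The coordinates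
  with respect to it define a surjection from \<open>K^n\<close> with kernel \<open>V\<close>; this is its matrix.\<close>

definition coframe :: "nat \<Rightarrow> nat \<Rightarrow> nat set \<Rightarrow> 'k::field vec set \<Rightarrow> 'k mat" where
  "coframe r n I V = (THE B. B \<in> carrier_mat (n - r) n \<and>
     submatrix B UNIV (- I) = 1\<^sub>m (n - r) \<and> mat_kernel B = V)"

definition universal_sub :: "nat \<Rightarrow> nat \<Rightarrow> ('k::field vec set, nat set, 'k) vbundle" where
  "universal_sub r n = \<lparr>bundle_rank = r, chart_index = gr_index r n, chart = gr_chart r n,
     transition = (\<lambda>I J V. THE g. g \<in> carrier_mat r r \<and> frame r n J V = frame r n I V * g)\<rparr>"

definition universal_quot :: "nat \<Rightarrow> nat \<Rightarrow> ('k::field vec set, nat set, 'k) vbundle" where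
  "universal_quot r n = \<lparr>bundle_rank = n - r, chart_index = gr_index r n, chart = gr_chart r n,
     transition = (\<lambda>I J V. THE h. h \<in> carrier_mat (n - r) (n - r) \<and>
        coframe r n I V = h * coframe r n J V)\<rparr>"

text \<open>The formal derivative at \<open>0\<close> of a rational function \<open>f = p / q\<close> of one variable that is
  regular at \<open>0\<close>, by the quotient rule. It is well defined over an infinite field.\<close>

definition deriv_at_0 :: "('k::field \<Rightarrow> 'k) \<Rightarrow> 'k" where
  "deriv_at_0 f = (THE D. \<exists>p q. poly q 0 \<noteq> 0 \<and>
     (\<forall>s. poly q s \<noteq> 0 \<longrightarrow> f s = poly p s / poly q s) \<and>
     D = (poly (pderiv p) 0 * poly q 0 - poly p 0 * poly (pderiv q) 0) / (poly q 0)\<^sup>2)"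

text \<open>The transition matrix of the tangent bundle from the chart of \<open>J\<close> to that of \<open>I\<close> is the
  Jacobian matrix of the change of affine coordinates. The \<open>r * (n - r)\<close> affine coordinates, the
  entries of an \<open>(n - r) \<times> r\<close> matrix, are numbered row by row.\<close>

definition matrix_unit :: "nat \<Rightarrow> nat \<Rightarrow> nat \<Rightarrow> 'k::field mat" where
  "matrix_unit r n l = mat (n - r) r (\<lambda>(i, j). if (i, j) = (l div r, l mod r) then 1 else 0)"

definition change_coords :: "nat \<Rightarrow> nat \<Rightarrow> nat set \<Rightarrow> nat set \<Rightarrow> 'k::field mat \<Rightarrow> 'k mat" where
  "change_coords r n I J Z =
     gr_coords r n I (the_inv_into (gr_chart r n J) (gr_coords r n J) Z)"

definition tangent_bundle :: "nat \<Rightarrow> nat \<Rightarrow> ('k::field vec set, nat set, 'k) vbundle" where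
  "tangent_bundle r n = \<lparr>bundle_rank = r * (n - r), chart_index = gr_index r n,
     chart = gr_chart r n,
     transition = (\<lambda>I J V. mat (r * (n - r)) (r * (n - r)) (\<lambda>(k, l).
        deriv_at_0 (\<lambda>s.
          change_coords r n I J (gr_coords r n J V + s \<cdot>\<^sub>m matrix_unit r n l)
            $$ (k div r, k mod r))))\<rparr>"


section \<open>Morphisms from the projective line to the Grassmannian\<close>

definition is_morphism :: "nat \<Rightarrow> nat \<Rightarrow> ('k::field P1 \<Rightarrow> 'k vec set) \<Rightarrow> bool" where
  "is_morphism r n f \<longleftrightarrow> range f \<subseteq> grassmannian r n \<and>
     (\<forall>I\<in>gr_index r n. zariski_open (f -` gr_chart r n I) \<and>
        (\<forall>i<n - r. \<forall>j<r. regular_on (f -` gr_chart r n I) (\<lambda>x. gr_coords r n I (f x) $$ (i, j))))"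

text \<open>The degree of \<open>f\<close> is that of the pullback of the Pluecker line bundle, i.e. of the
  determinant of the dual of the universal sub-bundle.\<close>

definition Mor :: "nat \<Rightarrow> nat \<Rightarrow> nat \<Rightarrow> ('k::field P1 \<Rightarrow> 'k vec set) set" where
  "Mor e r n = {f. is_morphism r n f \<and>
     bundle_iso (pullback f (det_bundle (dual (universal_sub r n)))) (sum_O [int e])}"

definition tangent_locus ::
  "nat \<Rightarrow> nat \<Rightarrow> nat \<Rightarrow> int multiset \<Rightarrow> ('k::field P1 \<Rightarrow> 'k vec set) set" where
  "tangent_locus e r n C =
     {f \<in> Mor e r n. has_splitting_type (pullback f (tangent_bundle r n)) C}"

definition M_quot :: "nat \<Rightarrow> nat \<Rightarrow> nat \<Rightarrow> int list \<Rightarrow> ('k::field P1 \<Rightarrow> 'k vec set) set" where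
  "M_quot e r n b = {f \<in> Mor e r n. bundle_iso (pullback f (universal_quot r n)) (sum_O b)}"

definition M_sub :: "nat \<Rightarrow> nat \<Rightarrow> nat \<Rightarrow> int list \<Rightarrow> ('k::field P1 \<Rightarrow> 'k vec set) set" where
  "M_sub e r n a = {f \<in> Mor e r n. bundle_iso (pullback f (dual (universal_sub r n))) (sum_O a)}"


section \<open>Fillings\<close>

definition is_filling :: "nat \<Rightarrow> nat \<Rightarrow> int multiset \<Rightarrow> int mat \<Rightarrow> bool" where
  "is_filling r n C A \<longleftrightarrow> A \<in> carrier_mat r (n - r) \<and>
     image_mset (\<lambda>ij. A $$ ij) (mset_set ({..<r} \<times> {..<n - r})) = C \<and>
     (\<forall>i j. i < r \<and> Suc j < n - r \<longrightarrow> A $$ (i, j) \<le> A $$ (i, Suc j)) \<and>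
     (\<forall>i j. Suc i < r \<and> j < n - r \<longrightarrow> A $$ (i, j) \<le> A $$ (Suc i, j)) \<and>
     (\<forall>i j j'. Suc i < r \<and> j < n - r \<and> j' < n - r \<longrightarrow>
        A $$ (Suc i, j) - A $$ (i, j) = A $$ (Suc i, j') - A $$ (i, j')) \<and>
     (\<forall>i i' j. i < r \<and> i' < r \<and> Suc j < n - r \<longrightarrow>
        A $$ (i, Suc j) - A $$ (i, j) = A $$ (i', Suc j) - A $$ (i', j))"

text \<open>The integers \<open>a\<close> and \<open>b\<close> are determined by \<open>A\<close> (and \<open>e\<close>). They need not exist for every
  filling: the solutions over the rationals may be non-integral or negative.\<close>

definition arises_from ::
  "nat \<Rightarrow> nat \<Rightarrow> nat \<Rightarrow> int mat \<Rightarrow> int list \<Rightarrow> int list \<Rightarrow> bool" where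
  "arises_from e r n A a b \<longleftrightarrow> length a = r \<and> length b = n - r \<and>
     sorted a \<and> sorted b \<and> (\<forall>x\<in>set a. 0 \<le> x) \<and> (\<forall>x\<in>set b. 0 \<le> x) \<and>
     sum_list a = int e \<and> sum_list b = int e \<and>
     (\<forall>i<r. \<forall>j<n - r. a ! i + b ! j = A $$ (i, j))"

definition filling_types ::
  "nat \<Rightarrow> nat \<Rightarrow> nat \<Rightarrow> int multiset \<Rightarrow> (int mat \<times> int list \<times> int list) set" where
  "filling_types e r n C = {(A, a, b). is_filling r n C A \<and> arises_from e r n A a b}"

end

theory Submission
  imports Defs "Jordan_Normal_Form.DL_Rank"
begin

text \<open>
  A morphism from the projective line to the Grassmannian is an algebraic family of subspaces of
  \<open>K\<^sup>n\<close>, and so is the family of their annihilators. Among all ways of choosing vectors of forms with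
  values in such a family that are independent at some point, one of minimal total degree is
  independent at every point (\<open>subbundle_basis\<close>): a linear relation at a point would allow one of
  the vectors to be replaced by one of smaller degree. Hence the family is a direct sum of line
  bundles \<open>O(-d)\<close> with \<open>d \<ge> 0\<close>. Applied to the subspaces and to their annihilators this shows that
  the dual of the universal sub-bundle and the universal quotient bundle pull back to sums of line
  bundles \<open>O(a\<^sub>i)\<close> and \<open>O(b\<^sub>j)\<close> of non-negative degree. The transition determinants of these two
  bundles agree up to constants, so \<open>\<Sum>a\<^sub>i = \<Sum>b\<^sub>j = e\<close> (\<open>splitting_degrees\<close>).

  The Jacobian matrix of a change of affine coordinates on the Grassmannian is the linear map
  \<open>Z \<mapsto> h Z g\<^sup>-\<^sup>1\<close>, where \<open>h\<close> and \<open>g\<close> are the transition matrices of the universal quotient and of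
  the universal sub-bundle (\<open>transition_tangent_bundle\<close>). So the tangent bundle is the tensor product
  of the universal quotient with the dual of the universal sub-bundle, and its pullback is the sum of
  the line bundles \<open>O(a\<^sub>i + b\<^sub>j)\<close>.

  Splitting types are unique (\<open>splitting_type_unique\<close>), because an isomorphism of sums of line
  bundles has no component from a larger to a smaller degree. Therefore the restricted tangent bundle
  has type \<open>C\<close> exactly if the sums \<open>a\<^sub>i + b\<^sub>j\<close> are the elements of \<open>C\<close>. With \<open>a\<close> and \<open>b\<close> increasing,
  these sums form a filling of \<open>C\<close>, and every filling from which \<open>a\<close> and \<open>b\<close> arise is of this shape.
  The strata are disjoint because a morphism determines \<open>a\<close> and \<open>b\<close>, and these determine the filling.
\<close>

(* The symbol is used for the entries of vectors. *)
no_notation fps_nth (infixl \<open>$\<close> 75)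

section \<open>Binary forms as functions on the projective line\<close>

text \<open>A form is treated as a function of the chosen representatives, so that vanishing, products and
  quotients of forms can be handled pointwise.\<close>

definition binary_form :: "nat \<Rightarrow> ('k::field P1 \<Rightarrow> 'k) \<Rightarrow> bool" where
  "binary_form d F \<longleftrightarrow> (\<exists>p. F = form d p)"

lemma form_Affine: "degree p \<le> d \<Longrightarrow> form d p (Affine c) = poly p c"
  unfolding form_def poly_altdef
  by (simp, rule sum.mono_neutral_right) (auto simp: coeff_eq_0)

lemma form_Infinity: "form d p Infinity = coeff p d"
proof -
  have "form d p Infinity = (\<Sum>i\<le>d. if i = d then coeff p i else 0)"
    unfolding form_def by (intro sum.cong) (auto simp: power_0_left)
  then show ?thesis by simp
qed

lemma binary_formE:
  assumes "binary_form d F"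
  obtains p where "degree p \<le> d" "F = form d p"
proof -
  obtain q where q: "F = form d q" using assms unfolding binary_form_def by blast
  have "degree (poly_cutoff (Suc d) q) \<le> d"
    by (rule degree_le) (simp add: coeff_poly_cutoff)
  moreover have "F = form d (poly_cutoff (Suc d) q)"
    unfolding q form_def by (intro ext sum.cong) (auto simp: coeff_poly_cutoff)
  ultimately show ?thesis using that by blast
qed

lemma P1_ext: "(\<And>c. F (Affine c) = G (Affine c)) \<Longrightarrow> F Infinity = G Infinity \<Longrightarrow> F = G"
  by (rule ext, metis P1.exhaust)

text \<open>The multiplicativity of the value of a form at \<open>[1 : 0]\<close>.\<close>

lemma coeff_mult_at_bound:
  assumes "degree p \<le> d" "degree q \<le> d'"
  shows "coeff (p * q) (d + d') = coeff p d * coeff q d'"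
proof -
  have "coeff (p * q) (d + d') = (\<Sum>i\<le>d + d'. if i = d then coeff p d * coeff q d' else 0)"
    unfolding coeff_mult
  proof (intro sum.cong refl)
    fix i assume "i \<in> {..d + d'}"
    then show "coeff p i * coeff q (d + d' - i) = (if i = d then coeff p d * coeff q d' else 0)"
      using assms by (cases i d rule: linorder_cases) (auto simp: coeff_eq_0)
  qed
  then show ?thesis by simp
qed

lemma binary_form_mult:
  assumes "binary_form d F" "binary_form d' G"
  shows "binary_form (d + d') (\<lambda>x. F x * G x)"
proof -
  obtain p where p: "degree p \<le> d" "F = form d p" using assms(1) by (rule binary_formE)
  obtain q where q: "degree q \<le> d'" "G = form d' q" using assms(2) by (rule binary_formE)
  have "degree (p * q) \<le> d + d'" using degree_mult_le[of p q] p q by linarith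
  then have "(\<lambda>x. F x * G x) = form (d + d') (p * q)"
    using p q by (intro P1_ext)
      (simp_all add: form_Affine form_Infinity coeff_mult_at_bound)
  then show ?thesis unfolding binary_form_def by blast
qed

lemma binary_form_add:
  assumes "binary_form d F" "binary_form d G"
  shows "binary_form d (\<lambda>x. F x + G x)"
proof -
  obtain p q where "F = form d p" "G = form d q" using assms unfolding binary_form_def by blast
  then have "(\<lambda>x. F x + G x) = form d (p + q)"
    by (simp add: fun_eq_iff form_def algebra_simps sum.distrib)
  then show ?thesis unfolding binary_form_def by blast
qed

lemma binary_form_const: "binary_form 0 (\<lambda>x. c)"
proof -
  have "(\<lambda>x. c) = form 0 [:c:]" by (simp add: fun_eq_iff form_def)
  then show ?thesis unfolding binary_form_def by blast
qed

lemma binary_form_zero: "binary_form d (\<lambda>x. 0)"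
proof -
  have "(\<lambda>x. 0) = form d 0" by (simp add: fun_eq_iff form_def)
  then show ?thesis unfolding binary_form_def by blast
qed

lemma binary_form_smult: "binary_form d F \<Longrightarrow> binary_form d (\<lambda>x. c * F x)"
  using binary_form_mult[OF binary_form_const] by simp

lemma binary_form_diff:
  "binary_form d F \<Longrightarrow> binary_form d G \<Longrightarrow> binary_form d (\<lambda>x. F x - G x)"
  using binary_form_add[of d F "\<lambda>x. - 1 * G x"] binary_form_smult[of d G "-1"] by simp

lemma binary_form_sum:
  "(\<And>i. i \<in> I \<Longrightarrow> binary_form d (F i)) \<Longrightarrow> binary_form d (\<lambda>x. \<Sum>i\<in>I. F i x)"
  by (induction I rule: infinite_finite_induct)
     (auto intro: binary_form_zero binary_form_add)

lemma binary_form_prod: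
  "(\<And>i. i \<in> I \<Longrightarrow> binary_form (d i) (F i)) \<Longrightarrow>
     binary_form (\<Sum>i\<in>I. d i) (\<lambda>x. \<Prod>i\<in>I. F i x)"
  by (induction I rule: infinite_finite_induct)
     (auto intro: binary_form_const binary_form_mult)

lemma binary_form_power: "binary_form d F \<Longrightarrow> binary_form (k * d) (\<lambda>x. F x ^ k)"
  by (induction k) (auto intro: binary_form_const binary_form_mult)

lemma binary_form_hcoord: "binary_form 1 (hcoord k)"
proof (cases "k = 0")
  case True
  have "hcoord k = form 1 [:0, 1:]"
    by (rule P1_ext) (simp_all add: form_Affine form_Infinity True)
  then show ?thesis unfolding binary_form_def by blast
next
  case False
  have "hcoord k = form 1 [:1:]"
    by (rule P1_ext) (use False in \<open>simp_all add: form_Affine form_Infinity\<close>)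
  then show ?thesis unfolding binary_form_def by blast
qed

lemma binary_form_0_constant: "binary_form 0 F \<Longrightarrow> F x = F y"
  unfolding binary_form_def form_def by auto

text \<open>The linear form whose only zero is \<open>x\<close>.\<close>

definition form_through :: "'k::field P1 \<Rightarrow> 'k P1 \<Rightarrow> 'k" where
  "form_through x y = hcoord 0 y * hcoord 1 x - hcoord 1 y * hcoord 0 x"

lemma form_through_eq_0_iff: "form_through x y = 0 \<longleftrightarrow> y = x"
  by (cases x; cases y) (auto simp: form_through_def)

lemma binary_form_factor:
  assumes "binary_form (Suc d) F" "F x = 0"
  obtains G where "binary_form d G" "\<And>y. F y = form_through x y * G y"
proof -
  obtain p where p: "degree p \<le> Suc d" "F = form (Suc d) p" using assms(1) by (rule binary_formE)
  show ?thesis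
  proof (cases x)
    case (Affine c)
    then have "poly p c = 0" using assms(2) p by (simp add: form_Affine)
    then obtain q where q: "p = [:-c, 1:] * q" by (auto simp: poly_eq_0_iff_dvd dvd_def)
    have dq: "degree q \<le> d"
    proof (cases "q = 0")
      case False
      then have "degree p = Suc (degree q)" unfolding q by (subst degree_mult_eq) auto
      then show ?thesis using p by simp
    qed simp
    have "F y = form_through x y * form d q y" for y
    proof (cases y)
      case (Affine c')
      then show ?thesis using p dq \<open>x = Affine c\<close>
        by (simp add: form_Affine form_through_def q algebra_simps)
    next
      case Infinity
      have "coeff p (Suc d) = coeff q d"
        unfolding q using dq by (simp add: coeff_eq_0)
      then show ?thesis using p Infinity \<open>x = Affine c\<close>
        by (simp add: form_Infinity form_through_def)
    qed
    then show ?thesis using that unfolding binary_form_def by blast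
  next
    case Infinity
    then have c0: "coeff p (Suc d) = 0" using assms(2) p by (simp add: form_Infinity)
    have dp: "degree p \<le> d"
      by (rule degree_le) (metis Suc_lessI c0 coeff_eq_0 le_less_trans p(1))
    have "F y = form_through x y * form d (- p) y" for y
      using p dp c0 Infinity
      by (cases y) (simp_all add: form_Affine form_Infinity form_through_def)
    then show ?thesis using that unfolding binary_form_def by blast
  qed
qed

lemma binary_form_has_zero:
  fixes F :: "'k::alg_closed_field P1 \<Rightarrow> 'k"
  assumes "binary_form (Suc d) F"
  shows "\<exists>x. F x = 0"
proof -
  obtain p where p: "degree p \<le> Suc d" "F = form (Suc d) p" using assms by (rule binary_formE)
  show ?thesis
  proof (cases "coeff p (Suc d) = 0")
    case True
    then show ?thesis using p by (auto simp: form_Infinity intro!: exI[of _ Infinity])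
  next
    case False
    then have "degree p > 0" using le_degree by fastforce
    then obtain c where "poly p c = 0" using alg_closed_imp_poly_has_root by blast
    then show ?thesis using p by (auto simp: form_Affine intro!: exI[of _ "Affine c"])
  qed
qed

lemma finite_zeros_binary_form:
  assumes "binary_form d F" "F x \<noteq> 0"
  shows "finite {y. F y = 0}"
proof -
  obtain p where p: "degree p \<le> d" "F = form d p" using assms(1) by (rule binary_formE)
  have "p \<noteq> 0" using assms(2) p by (auto simp: form_def)
  then have "finite {c. poly p c = 0}" by (rule poly_roots_finite)
  moreover have "{y. F y = 0} \<subseteq> insert Infinity (Affine ` {c. poly p c = 0})"
  proof
    fix y assume "y \<in> {y. F y = 0}"
    then show "y \<in> insert Infinity (Affine ` {c. poly p c = 0})"
      using p by (cases y) (auto simp: form_Affine)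
  qed
  ultimately show ?thesis by (metis finite_subset finite_imageI finite_insert)
qed

lemma infinite_P1: "infinite (UNIV :: 'k::field_char_0 P1 set)"
proof
  assume "finite (UNIV :: 'k P1 set)"
  then have "finite (range (Affine :: 'k \<Rightarrow> _))" by (rule finite_subset[OF subset_UNIV])
  then have "finite (UNIV :: 'k set)" by (rule finite_imageD) (simp add: inj_on_def)
  then show False by (simp add: infinite_UNIV_char_0)
qed

text \<open>The line is infinite, while a form with a value other than zero has only finitely many zeros.\<close>

lemma binary_form_eq_0:
  fixes F :: "'k::field_char_0 P1 \<Rightarrow> 'k"
  assumes "binary_form d F" "finite S" "\<And>y. y \<notin> S \<Longrightarrow> F y = 0"
  shows "F x = 0"
proof (rule ccontr)
  assume "F x \<noteq> 0"
  then have "finite ({y. F y = 0} \<union> S)" using assms finite_zeros_binary_form by blast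
  moreover have "{y. F y = 0} \<union> S = UNIV" using assms(3) by auto
  ultimately show False using infinite_P1 by metis
qed


section \<open>Regularity at a point\<close>

text \<open>The non-vanishing loci of forms are a basis of the topology, so a neighbourhood of \<open>x\<close> on which
  the presentation is valid can be absorbed into the denominator. Regular functions then glue
  without any further argument.\<close>

definition regular_at :: "('k::field P1 \<Rightarrow> 'k) \<Rightarrow> 'k P1 \<Rightarrow> bool" where
  "regular_at g x \<longleftrightarrow> (\<exists>d P Q. binary_form d P \<and> binary_form d Q \<and> Q x \<noteq> 0 \<and>
     (\<forall>y. Q y \<noteq> 0 \<longrightarrow> g y = P y / Q y))"

lemma regular_atI:
  "binary_form d P \<Longrightarrow> binary_form d Q \<Longrightarrow> Q x \<noteq> 0 \<Longrightarrow> (\<And>y. Q y \<noteq> 0 \<Longrightarrow> g y = P y / Q y) \<Longrightarrow>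
     regular_at g x"
  unfolding regular_at_def by blast

lemma regular_atE:
  assumes "regular_at g x"
  obtains d P Q where "binary_form d P" "binary_form d Q" "Q x \<noteq> 0"
    "\<And>y. Q y \<noteq> 0 \<Longrightarrow> g y = P y / Q y"
  using assms unfolding regular_at_def by blast

lemma zariski_openE:
  assumes "zariski_open U" "x \<in> U"
  obtains d H where "binary_form d H" "H x \<noteq> 0" "\<And>y. H y \<noteq> 0 \<Longrightarrow> y \<in> U"
proof -
  obtain d q where q: "form d q x \<noteq> 0" "{y. form d q y \<noteq> 0} \<subseteq> U"
    using assms unfolding zariski_open_def by blast
  have "binary_form d (form d q)" unfolding binary_form_def by blast
  then show ?thesis using q that by blast
qed

lemma zariski_openI:
  assumes "\<And>x. x \<in> U \<Longrightarrow> \<exists>d H. binary_form d H \<and> H x \<noteq> 0 \<and> (\<forall>y. H y \<noteq> 0 \<longrightarrow> y \<in> U)"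
  shows "zariski_open U"
  using assms unfolding zariski_open_def binary_form_def by blast

lemma zariski_open_Int:
  assumes "zariski_open U" "zariski_open V"
  shows "zariski_open (U \<inter> V)"
proof (rule zariski_openI)
  fix x assume "x \<in> U \<inter> V"
  then have x: "x \<in> U" "x \<in> V" by auto
  obtain d H where "binary_form d H" "H x \<noteq> 0" "\<And>y. H y \<noteq> 0 \<Longrightarrow> y \<in> U"
    using assms(1) x(1) by (rule zariski_openE) blast
  moreover obtain d' H' where "binary_form d' H'" "H' x \<noteq> 0" "\<And>y. H' y \<noteq> 0 \<Longrightarrow> y \<in> V"
    using assms(2) x(2) by (rule zariski_openE) blast
  ultimately show "\<exists>d H. binary_form d H \<and> H x \<noteq> 0 \<and> (\<forall>y. H y \<noteq> 0 \<longrightarrow> y \<in> U \<inter> V)"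
    by (intro exI[of _ "d + d'"] exI[of _ "\<lambda>x. H x * H' x"]) (auto intro: binary_form_mult)
qed

lemma zariski_open_hcoord: "zariski_open {x. hcoord k x \<noteq> 0}"
  using binary_form_hcoord by (intro zariski_openI) blast

lemma regular_at_cong:
  assumes "regular_at g x" "zariski_open U" "x \<in> U" "\<And>y. y \<in> U \<Longrightarrow> g y = g' y"
  shows "regular_at g' x"
proof -
  obtain d P Q where g: "binary_form d P" "binary_form d Q" "Q x \<noteq> 0"
    "\<And>y. Q y \<noteq> 0 \<Longrightarrow> g y = P y / Q y" using assms(1) by (rule regular_atE) blast
  obtain e H where H: "binary_form e H" "H x \<noteq> 0" "\<And>y. H y \<noteq> 0 \<Longrightarrow> y \<in> U"
    using assms(2,3) by (rule zariski_openE) blast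
  have "g' y = P y * H y / (Q y * H y)" if "Q y * H y \<noteq> 0" for y
    using g(4)[of y] assms(4)[OF H(3), of y] that by simp
  then show ?thesis
    using g H
    by (intro regular_atI[of "d + e" "\<lambda>y. P y * H y" "\<lambda>y. Q y * H y"] binary_form_mult) auto
qed

text \<open>A form that vanishes outside \<open>U\<close> is multiplied into numerator and denominator of a local
  presentation; the new presentation is valid wherever its denominator does not vanish.\<close>

lemma regular_on_iff:
  assumes "zariski_open U"
  shows "regular_on U g \<longleftrightarrow> (\<forall>x\<in>U. regular_at g x)"
proof
  assume reg: "regular_on U g"
  show "\<forall>x\<in>U. regular_at g x"
  proof
    fix x assume x: "x \<in> U"
    obtain d p q where g: "form d q x \<noteq> 0"
      "\<And>y. y \<in> U \<Longrightarrow> form d q y \<noteq> 0 \<Longrightarrow> g y = form d p y / form d q y"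
      using reg x unfolding regular_on_def by blast
    obtain e H where H: "binary_form e H" "H x \<noteq> 0" "\<And>y. H y \<noteq> 0 \<Longrightarrow> y \<in> U"
      using assms x by (rule zariski_openE) blast
    have "binary_form d (form d p)" "binary_form d (form d q)" unfolding binary_form_def by blast+
    then show "regular_at g x"
      using g H
      by (intro regular_atI[of "d + e" "\<lambda>y. form d p y * H y" "\<lambda>y. form d q y * H y"]
          binary_form_mult) auto
  qed
next
  assume "\<forall>x\<in>U. regular_at g x"
  then show "regular_on U g" unfolding regular_on_def regular_at_def binary_form_def by blast
qed

lemma regular_at_add:
  assumes "regular_at f x" "regular_at g x" shows "regular_at (\<lambda>y. f y + g y) x"
proof -
  obtain d P Q where f: "binary_form d P" "binary_form d Q" "Q x \<noteq> 0"
    "\<And>y. Q y \<noteq> 0 \<Longrightarrow> f y = P y / Q y" using assms(1) by (rule regular_atE) blast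
  obtain e R S where g: "binary_form e R" "binary_form e S" "S x \<noteq> 0"
    "\<And>y. S y \<noteq> 0 \<Longrightarrow> g y = R y / S y" using assms(2) by (rule regular_atE) blast
  have "binary_form (d + e) (\<lambda>y. Q y * R y)" using binary_form_mult f(2) g(1) by blast
  then show ?thesis
    using f g
    by (intro regular_atI[of "d + e" "\<lambda>y. P y * S y + Q y * R y" "\<lambda>y. Q y * S y"]
        binary_form_mult binary_form_add) (auto simp: field_simps)
qed

lemma regular_at_mult:
  assumes "regular_at f x" "regular_at g x" shows "regular_at (\<lambda>y. f y * g y) x"
proof -
  obtain d P Q where f: "binary_form d P" "binary_form d Q" "Q x \<noteq> 0"
    "\<And>y. Q y \<noteq> 0 \<Longrightarrow> f y = P y / Q y" using assms(1) by (rule regular_atE) blast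
  obtain e R S where g: "binary_form e R" "binary_form e S" "S x \<noteq> 0"
    "\<And>y. S y \<noteq> 0 \<Longrightarrow> g y = R y / S y" using assms(2) by (rule regular_atE) blast
  show ?thesis
    using f g
    by (intro regular_atI[of "d + e" "\<lambda>y. P y * R y" "\<lambda>y. Q y * S y"] binary_form_mult) auto
qed

lemma regular_at_const: "regular_at (\<lambda>y. c) x"
  by (rule regular_atI[of 0 "\<lambda>y. c" "\<lambda>y. 1"]) (auto intro: binary_form_const)

lemma regular_at_uminus: "regular_at f x \<Longrightarrow> regular_at (\<lambda>y. - f y) x"
  using regular_at_mult[OF regular_at_const[of "-1"]] by simp

lemma regular_at_sum:
  "(\<And>i. i \<in> I \<Longrightarrow> regular_at (f i) x) \<Longrightarrow> regular_at (\<lambda>y. \<Sum>i\<in>I. f i y) x"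
  by (induction I rule: infinite_finite_induct) (auto intro: regular_at_const regular_at_add)

lemma regular_at_prod:
  "(\<And>i. i \<in> I \<Longrightarrow> regular_at (f i) x) \<Longrightarrow> regular_at (\<lambda>y. \<Prod>i\<in>I. f i y) x"
  by (induction I rule: infinite_finite_induct) (auto intro: regular_at_const regular_at_mult)

lemma regular_at_inverse:
  assumes "regular_at f x" "f x \<noteq> 0" shows "regular_at (\<lambda>y. 1 / f y) x"
proof -
  obtain d P Q where f: "binary_form d P" "binary_form d Q" "Q x \<noteq> 0"
    "\<And>y. Q y \<noteq> 0 \<Longrightarrow> f y = P y / Q y" using assms(1) by (rule regular_atE) blast
  have "P x \<noteq> 0" using f assms(2) by fastforce
  moreover have "1 / f y = Q y * Q y / (P y * Q y)" if "P y * Q y \<noteq> 0" for y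
    using f(4)[of y] that by simp
  ultimately show ?thesis
    using f
    by (intro regular_atI[of "d + d" "\<lambda>y. Q y * Q y" "\<lambda>y. P y * Q y"] binary_form_mult) auto
qed

lemma regular_at_form_quotient:
  "binary_form d F \<Longrightarrow> hcoord k x \<noteq> 0 \<Longrightarrow> regular_at (\<lambda>y. F y / hcoord k y ^ d) x"
  using binary_form_power[OF binary_form_hcoord[of k], of d]
  by (intro regular_atI[of d F "\<lambda>y. hcoord k y ^ d"]) auto

text \<open>The numerator of such a function has infinitely many zeros, so it is the zero form.\<close>

lemma regular_at_eq_0:
  fixes g :: "'k::field_char_0 P1 \<Rightarrow> 'k"
  assumes "regular_at g x" "zariski_open U" "x \<in> U" "finite S"
    and "\<And>y. y \<in> U \<Longrightarrow> y \<notin> S \<Longrightarrow> g y = 0"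
  shows "g x = 0"
proof -
  obtain d P Q where g: "binary_form d P" "binary_form d Q" "Q x \<noteq> 0"
    "\<And>y. Q y \<noteq> 0 \<Longrightarrow> g y = P y / Q y" using assms(1) by (rule regular_atE) blast
  obtain e H where H: "binary_form e H" "H x \<noteq> 0" "\<And>y. H y \<noteq> 0 \<Longrightarrow> y \<in> U"
    using assms(2,3) by (rule zariski_openE) blast
  have "finite ({y. Q y = 0} \<union> {y. H y = 0} \<union> S)"
    using finite_zeros_binary_form[OF g(2,3)] finite_zeros_binary_form[OF H(1,2)] assms(4) by simp
  then have "P x = 0"
  proof (rule binary_form_eq_0[OF g(1)])
    fix y assume "y \<notin> {y. Q y = 0} \<union> {y. H y = 0} \<union> S"
    then have "Q y \<noteq> 0" "g y = 0" using H(3)[of y] assms(5)[of y] by auto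
    then show "P y = 0" using g(4)[of y] by simp
  qed
  then show ?thesis using g by simp
qed

text \<open>Take a presentation as a quotient of forms of minimal degree. At a zero of the denominator,
  comparison with a local presentation shows that the numerator vanishes too, and the common
  linear factor cancels; so the denominator has no zero and both forms are constant.\<close>

lemma regular_everywhere_imp_constant:
  fixes g :: "'k::{alg_closed_field, field_char_0} P1 \<Rightarrow> 'k"
  assumes reg: "\<And>x. regular_at g x"
  shows "g x = g y"
proof -
  define presents where "presents k P Q \<longleftrightarrow> binary_form k P \<and> binary_form k Q \<and>
     (\<exists>x. Q x \<noteq> 0) \<and> (\<forall>y. Q y \<noteq> 0 \<longrightarrow> g y = P y / Q y)" for k P Q
  define rep where "rep k \<longleftrightarrow> (\<exists>P Q. presents k P Q)" for k
  define d where "d = (LEAST d. rep d)"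
  obtain k P0 Q0 where "binary_form k P0" "binary_form k Q0" "Q0 x \<noteq> 0"
    "\<And>y. Q0 y \<noteq> 0 \<Longrightarrow> g y = P0 y / Q0 y" using reg[of x] unfolding regular_at_def by blast
  then have "presents k P0 Q0" unfolding presents_def by (intro conjI exI[of _ x]) simp_all
  then have "\<exists>k. rep k" unfolding rep_def by iprover
  then have "rep d" unfolding d_def by (rule LeastI_ex)
  have minimal: "\<not> rep d'" if "d' < d" for d'
    using that unfolding d_def by (rule not_less_Least)
  obtain P Q where "presents d P Q" using \<open>rep d\<close> unfolding rep_def by iprover
  then obtain x0 where PQ: "binary_form d P" "binary_form d Q" "Q x0 \<noteq> 0"
    "\<And>y. Q y \<noteq> 0 \<Longrightarrow> g y = P y / Q y" unfolding presents_def by auto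
  have "d = 0"
  proof (cases d)
    case (Suc d')
    obtain z where z: "Q z = 0" using PQ Suc binary_form_has_zero by blast
    obtain e R S where RS: "binary_form e R" "binary_form e S" "S z \<noteq> 0"
      "\<And>y. S y \<noteq> 0 \<Longrightarrow> g y = R y / S y" using reg[of z] unfolding regular_at_def by blast
    have fin: "finite ({y. Q y = 0} \<union> {y. S y = 0})"
      using finite_zeros_binary_form[OF PQ(2,3)] finite_zeros_binary_form[OF RS(2,3)] by simp
    have bf: "binary_form (d + e) (\<lambda>y. P y * S y - Q y * R y)"
      using PQ RS by (intro binary_form_diff binary_form_mult)
    have "P z * S z - Q z * R z = 0"
    proof (rule binary_form_eq_0[OF bf fin])
      fix y assume "y \<notin> {y. Q y = 0} \<union> {y. S y = 0}"
      then have "Q y \<noteq> 0" "S y \<noteq> 0" "P y / Q y = R y / S y"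
        using PQ(4)[of y] RS(4)[of y] by auto
      then show "P y * S y - Q y * R y = 0" by (simp add: field_simps)
    qed
    then have "P z = 0" using z RS by simp
    obtain P' where P': "binary_form d' P'" "\<And>y. P y = form_through z y * P' y"
      using binary_form_factor[OF PQ(1)[unfolded Suc] \<open>P z = 0\<close>] by blast
    obtain Q' where Q': "binary_form d' Q'" "\<And>y. Q y = form_through z y * Q' y"
      using binary_form_factor[OF PQ(2)[unfolded Suc] z] by blast
    have Q'0: "Q' x0 \<noteq> 0" using PQ(3) Q' by auto
    have "presents d' P' Q'"
      unfolding presents_def
    proof (intro exI conjI allI impI)
      let ?l = "form_through z"
      show "binary_form d' P'" "binary_form d' Q'" "Q' x0 \<noteq> 0" by fact+
      fix y assume y: "Q' y \<noteq> 0"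
      (* The cancelled presentation is also valid at z, where the local presentation R / S decides. *)
      show "g y = P' y / Q' y"
      proof (cases "y = z")
        case False
        then show ?thesis using PQ(4)[of y] P'(2) Q'(2) y
          by (simp add: form_through_eq_0_iff)
      next
        case True
        have "binary_form (d' + e) (\<lambda>y. P' y * S y - Q' y * R y)"
          using P' Q' RS by (intro binary_form_diff binary_form_mult)
        then have "P' z * S z - Q' z * R z = 0"
        proof (rule binary_form_eq_0[OF _ fin])
          fix y assume "y \<notin> {y. Q y = 0} \<union> {y. S y = 0}"
          then have "Q' y \<noteq> 0" "S y \<noteq> 0" "?l y \<noteq> 0" "P y / Q y = R y / S y"
            using PQ(4)[of y] RS(4)[of y] Q'(2)[of y] by auto
          then show "P' y * S y - Q' y * R y = 0" unfolding P'(2) Q'(2) by (simp add: field_simps)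
        qed
        moreover have "R z = S z * g z" using RS(3) RS(4)[of z] by simp
        ultimately have "S z * P' z = S z * (Q' z * g z)" by (simp add: algebra_simps)
        then show ?thesis using True y RS(3) by simp
      qed
    qed
    then show ?thesis using minimal[of d'] Suc unfolding rep_def by auto
  qed simp
  then have const: "P a = P b" "Q a = Q b" for a b
    using PQ(1,2) binary_form_0_constant by blast+
  have "Q a \<noteq> 0" for a using const(2)[of a x0] PQ(3) by simp
  then show ?thesis using PQ(4) const by metis
qed

text \<open>A section of a line bundle of negative degree \<open>d\<close>, restricted to the affine line, extends to a
  regular function on the whole projective line which vanishes at infinity: near infinity it is
  the product of the other coordinate of the section with a positive power of a local parameter.\<close>

lemma negative_degree_section_eq_0:
  fixes g0 g1 :: "'k::{alg_closed_field, field_char_0} P1 \<Rightarrow> 'k"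
  assumes "\<And>x. hcoord 0 x \<noteq> 0 \<Longrightarrow> regular_at g0 x"
    and reg1: "\<And>x. hcoord 1 x \<noteq> 0 \<Longrightarrow> regular_at g1 x"
    and glue: "\<And>x. hcoord 0 x \<noteq> 0 \<Longrightarrow> hcoord 1 x \<noteq> 0 \<Longrightarrow>
      g0 x = (hcoord 1 x / hcoord 0 x) powi d * g1 x"
    and "d < 0"
  shows "g1 (Affine c) = 0"
proof -
  define G where "G x = (if x = Infinity then 0 else g1 x)" for x
  obtain m where m: "d = - int m" "m > 0" using neg_int_cases[OF \<open>d < 0\<close>] by blast
  have "regular_at G x" for x
  proof (cases x)
    case (Affine c)
    show ?thesis
    proof (rule regular_at_cong[where U = "{x. hcoord 1 x \<noteq> 0}"])
      show "regular_at g1 x" using reg1[of x] Affine by simp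
      show "zariski_open {x. hcoord 1 x \<noteq> (0::'k)}" by (rule zariski_open_hcoord)
      show "x \<in> {x. hcoord 1 x \<noteq> 0}" using Affine by simp
      show "g1 y = G y" if "y \<in> {x. hcoord 1 x \<noteq> 0}" for y
        using that by (cases y) (auto simp: G_def)
    qed
  next
    case Infinity
    have "regular_at (\<lambda>y. (hcoord 1 y / hcoord 0 y ^ 1) ^ m * g0 y) x"
    proof (rule regular_at_mult)
      show "regular_at g0 x" using assms(1) Infinity by simp
      have "regular_at (\<lambda>y. \<Prod>i<m. hcoord 1 y / hcoord 0 y ^ 1) x"
        by (intro regular_at_prod regular_at_form_quotient binary_form_hcoord)
           (simp add: Infinity)
      then show "regular_at (\<lambda>y. (hcoord 1 y / hcoord 0 y ^ 1) ^ m) x" by simp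
    qed
    then show ?thesis
    proof (rule regular_at_cong[where U = "{x. hcoord 0 x \<noteq> 0}"])
      show "zariski_open {x. hcoord 0 x \<noteq> (0::'k)}" by (rule zariski_open_hcoord)
      show "x \<in> {x. hcoord 0 x \<noteq> 0}" using Infinity by simp
      fix y :: "'k P1" assume y: "y \<in> {x. hcoord 0 x \<noteq> 0}"
      show "(hcoord 1 y / hcoord 0 y ^ 1) ^ m * g0 y = G y"
      proof (cases y)
        case (Affine c)
        then show ?thesis using glue[of y] y m
          by (simp add: G_def power_int_minus field_simps)
      next
        case Infinity
        then show ?thesis using m by (simp add: G_def)
      qed
    qed
  qed
  then have "G (Affine c) = G Infinity" by (rule regular_everywhere_imp_constant)
  then show ?thesis by (simp add: G_def)
qed


section \<open>Splittings of bundles on the projective line\<close>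

text \<open>Written by cofactors, so that the entries of the inverse are visibly regular functions of those of
  the matrix.\<close>

definition inverse_mat :: "'k::field mat \<Rightarrow> 'k mat" where
  "inverse_mat A = (1 / det A) \<cdot>\<^sub>m adj_mat A"

lemma smult_one: "(1::'k::field) \<cdot>\<^sub>m A = A"
  by (rule eq_matI) auto

lemma smult_smult_mat: "c \<cdot>\<^sub>m (d \<cdot>\<^sub>m A) = (c * d :: 'k::field) \<cdot>\<^sub>m A"
  by (rule eq_matI) (auto simp: mult.assoc)

lemma inverse_mat:
  assumes A: "A \<in> carrier_mat n n" and d: "det A \<noteq> 0"
  shows "inverse_mat A \<in> carrier_mat n n" "A * inverse_mat A = 1\<^sub>m n" "inverse_mat A * A = 1\<^sub>m n"
  unfolding inverse_mat_def
  using adj_mat[OF A] A d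
  by (simp_all add: mult_smult_distrib[of A n n] mult_smult_assoc_mat[of _ n n A n]
      smult_smult_mat smult_one)

lemma invertible_mat_iff_det:
  fixes A :: "'k::field mat"
  assumes A: "A \<in> carrier_mat n n"
  shows "invertible_mat A \<longleftrightarrow> det A \<noteq> 0"
proof
  assume "invertible_mat A"
  then obtain B where AB: "A * B = 1\<^sub>m n" and BA: "B * A = 1\<^sub>m (dim_row B)"
    using A unfolding invertible_mat_def inverts_mat_def by auto
  have "dim_col B = n" "dim_row B = n"
    using arg_cong[OF AB, of dim_col] arg_cong[OF BA, of dim_col] A by auto
  then have "det A * det B = 1" using AB A det_mult[of A n B] by auto
  then show "det A \<noteq> 0" by auto
next
  assume d: "det A \<noteq> 0"
  show "invertible_mat A"
    using A inverse_mat[OF A d] unfolding invertible_mat_def inverts_mat_def by auto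
qed

text \<open>The conditions on charts and transition matrices under which isomorphisms can be compared; they
  hold for pullbacks along morphisms.\<close>

definition open_atlas :: "('k::field P1, 'i, 'k) vbundle \<Rightarrow> bool" where
  "open_atlas E \<longleftrightarrow>
     (\<forall>i\<in>chart_index E. zariski_open (chart E i)) \<and>
     (\<forall>x. \<exists>i\<in>chart_index E. x \<in> chart E i) \<and>
     (\<forall>i\<in>chart_index E. \<forall>j\<in>chart_index E. \<forall>x\<in>chart E i \<inter> chart E j.
        transition E i j x \<in> carrier_mat (bundle_rank E) (bundle_rank E))"

lemma open_atlas_zariski_open:
  "open_atlas E \<Longrightarrow> i \<in> chart_index E \<Longrightarrow> zariski_open (chart E i \<inter> {x. hcoord k x \<noteq> 0})"
  unfolding open_atlas_def by (intro zariski_open_Int zariski_open_hcoord) blast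

text \<open>The data of an isomorphism with \<open>sum_O ds\<close>, with regularity stated point by point.\<close>

definition splitting ::
  "('k::field P1, 'i, 'k) vbundle \<Rightarrow> int list \<Rightarrow> (nat \<Rightarrow> 'i \<Rightarrow> 'k P1 \<Rightarrow> 'k mat) \<Rightarrow> bool" where
  "splitting E ds L \<longleftrightarrow> bundle_rank E = length ds \<and>
     (\<forall>i\<in>chart_index E. \<forall>k\<in>{0, 1}. \<forall>x\<in>chart E i. hcoord k x \<noteq> 0 \<longrightarrow>
        L k i x \<in> carrier_mat (length ds) (length ds) \<and> det (L k i x) \<noteq> 0 \<and>
        (\<forall>s<length ds. \<forall>t<length ds. regular_at (\<lambda>y. L k i y $$ (s, t)) x)) \<and>
     (\<forall>i\<in>chart_index E. \<forall>j\<in>chart_index E. \<forall>k\<in>{0, 1}. \<forall>l\<in>{0, 1}.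
        \<forall>x\<in>chart E i \<inter> chart E j. hcoord k x \<noteq> 0 \<longrightarrow> hcoord l x \<noteq> 0 \<longrightarrow>
          L k i x * transition E i j x =
          mat_diag (length ds) (\<lambda>s. (hcoord l x / hcoord k x) powi (ds ! s)) * L l j x)"

lemma splittingD:
  assumes "splitting E ds L"
  shows "bundle_rank E = length ds"
    and "\<And>i k x. i \<in> chart_index E \<Longrightarrow> k \<in> {0, 1} \<Longrightarrow> x \<in> chart E i \<Longrightarrow> hcoord k x \<noteq> 0 \<Longrightarrow>
      L k i x \<in> carrier_mat (length ds) (length ds)"
    and "\<And>i k x. i \<in> chart_index E \<Longrightarrow> k \<in> {0, 1} \<Longrightarrow> x \<in> chart E i \<Longrightarrow> hcoord k x \<noteq> 0 \<Longrightarrow>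
      det (L k i x) \<noteq> 0"
    and "\<And>i k x s t. i \<in> chart_index E \<Longrightarrow> k \<in> {0, 1} \<Longrightarrow> x \<in> chart E i \<Longrightarrow> hcoord k x \<noteq> 0 \<Longrightarrow>
      s < length ds \<Longrightarrow> t < length ds \<Longrightarrow> regular_at (\<lambda>y. L k i y $$ (s, t)) x"
    and "\<And>i j k l x. i \<in> chart_index E \<Longrightarrow> j \<in> chart_index E \<Longrightarrow> k \<in> {0, 1} \<Longrightarrow> l \<in> {0, 1} \<Longrightarrow>
      x \<in> chart E i \<Longrightarrow> x \<in> chart E j \<Longrightarrow> hcoord k x \<noteq> 0 \<Longrightarrow> hcoord l x \<noteq> 0 \<Longrightarrow>
      L k i x * transition E i j x =
      mat_diag (length ds) (\<lambda>s. (hcoord l x / hcoord k x) powi (ds ! s)) * L l j x"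
  using assms unfolding splitting_def by blast+

lemma bundle_iso_sum_O_iff:
  fixes E :: "('k::field P1, 'i, 'k) vbundle"
  assumes "open_atlas E"
  shows "bundle_iso E (sum_O ds) \<longleftrightarrow> (\<exists>L. splitting E ds L)"
proof -
  have op: "zariski_open (chart E i \<inter> {x. hcoord k x \<noteq> 0})" if "i \<in> chart_index E" for i k
    using open_atlas_zariski_open[OF assms that] .
  have eq: "(bundle_rank E = length ds \<and>
     (\<forall>i\<in>chart_index E. \<forall>k\<in>{0, 1}.
           (\<forall>x\<in>chart E i \<inter> {x. hcoord k x \<noteq> 0}.
              L k i x \<in> carrier_mat (bundle_rank E) (bundle_rank E) \<and> invertible_mat (L k i x)) \<and>
           (\<forall>s<bundle_rank E. \<forall>t<bundle_rank E.
              regular_on (chart E i \<inter> {x. hcoord k x \<noteq> 0}) (\<lambda>x. L k i x $$ (s, t)))) \<and>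
        (\<forall>i\<in>chart_index E. \<forall>j\<in>chart_index E. \<forall>k\<in>{0, 1}. \<forall>l\<in>{0, 1}.
           \<forall>x\<in>chart E i \<inter> chart E j \<inter> {x. hcoord k x \<noteq> 0} \<inter> {x. hcoord l x \<noteq> 0}.
              L k i x * transition E i j x =
              mat_diag (length ds) (\<lambda>s. (hcoord l x / hcoord k x) powi (ds ! s)) * L l j x))
    \<longleftrightarrow> splitting E ds L" for L :: "nat \<Rightarrow> 'i \<Rightarrow> 'k P1 \<Rightarrow> 'k mat"
    unfolding splitting_def
    apply (intro conj_cong refl)
    subgoal
      by (intro ball_cong[OF refl])
         (auto simp: regular_on_iff op dest: iffD1[OF invertible_mat_iff_det]
           intro: iffD2[OF invertible_mat_iff_det])
    subgoal by (intro ball_cong[OF refl]; blast)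
    done
  show ?thesis
    unfolding bundle_iso_def sum_O_def vbundle.select_convs by (simp only: eq[symmetric] ex_simps)
qed

lemma regular_at_det:
  assumes dim: "\<And>y. y \<in> U \<Longrightarrow> A y \<in> carrier_mat n n"
    and U: "zariski_open U" "x \<in> U"
    and reg: "\<And>s t. s < n \<Longrightarrow> t < n \<Longrightarrow> regular_at (\<lambda>y. A y $$ (s, t)) x"
  shows "regular_at (\<lambda>y. det (A y)) x"
proof (rule regular_at_cong[OF _ U])
  show "regular_at (\<lambda>y. \<Sum>p\<in>{p. p permutes {0..<n}}. signof p * (\<Prod>i = 0..<n. A y $$ (i, p i))) x"
    by (intro regular_at_sum regular_at_mult regular_at_const regular_at_prod reg) auto
  show "(\<Sum>p\<in>{p. p permutes {0..<n}}. signof p * (\<Prod>i = 0..<n. A y $$ (i, p i))) = det (A y)"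
    if "y \<in> U" for y using det_def'[OF dim[OF that]] by simp
qed

lemma regular_at_inverse_mat:
  assumes dim: "\<And>y. y \<in> U \<Longrightarrow> A y \<in> carrier_mat n n"
    and U: "zariski_open U" "x \<in> U"
    and reg: "\<And>s t. s < n \<Longrightarrow> t < n \<Longrightarrow> regular_at (\<lambda>y. A y $$ (s, t)) x"
    and "det (A x) \<noteq> 0" and st: "s < n" "t < n"
  shows "regular_at (\<lambda>y. inverse_mat (A y) $$ (s, t)) x"
proof (rule regular_at_cong[OF _ U])
  have del: "mat_delete (A y) t s \<in> carrier_mat (n - 1) (n - 1)" if "y \<in> U" for y
    using dim[OF that] by (auto simp: mat_delete_def)
  have "regular_at (\<lambda>y. mat_delete (A y) t s $$ (i, j)) x" if "i < n - 1" "j < n - 1" for i j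
  proof (rule regular_at_cong[OF _ U])
    show "regular_at (\<lambda>y. A y $$ (if i < t then i else Suc i, if j < s then j else Suc j)) x"
      using that by (intro reg) auto
    show "A y $$ (if i < t then i else Suc i, if j < s then j else Suc j) =
        mat_delete (A y) t s $$ (i, j)" if "y \<in> U" for y
      using dim[OF that] \<open>i < n - 1\<close> \<open>j < n - 1\<close> by (auto simp: mat_delete_def)
  qed
  then have "regular_at (\<lambda>y. det (mat_delete (A y) t s)) x"
    by (intro regular_at_det[OF del U])
  then show "regular_at (\<lambda>y. 1 / det (A y) * ((- 1) ^ (t + s) * det (mat_delete (A y) t s))) x"
    using regular_at_det[OF dim U reg] assms(5)
    by (intro regular_at_mult regular_at_inverse regular_at_const)
  show "1 / det (A y) * ((- 1) ^ (t + s) * det (mat_delete (A y) t s)) =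
      inverse_mat (A y) $$ (s, t)" if "y \<in> U" for y
    using dim[OF that] st by (simp add: inverse_mat_def adj_mat_def cofactor_def)
qed

lemma regular_at_mat_mult:
  assumes "\<And>y. y \<in> U \<Longrightarrow> A y \<in> carrier_mat m n" "\<And>y. y \<in> U \<Longrightarrow> B y \<in> carrier_mat n l"
    and U: "zariski_open U" "x \<in> U"
    and "\<And>s t. s < m \<Longrightarrow> t < n \<Longrightarrow> regular_at (\<lambda>y. A y $$ (s, t)) x"
    and "\<And>s t. s < n \<Longrightarrow> t < l \<Longrightarrow> regular_at (\<lambda>y. B y $$ (s, t)) x"
    and st: "s < m" "t < l"
  shows "regular_at (\<lambda>y. (A y * B y) $$ (s, t)) x"
proof (rule regular_at_cong[OF _ U])
  show "regular_at (\<lambda>y. \<Sum>u = 0..<n. A y $$ (s, u) * B y $$ (u, t)) x"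
    using assms by (intro regular_at_sum regular_at_mult) auto
  show "(\<Sum>u = 0..<n. A y $$ (s, u) * B y $$ (u, t)) = (A y * B y) $$ (s, t)" if "y \<in> U" for y
    using assms(1,2)[OF that] st by (simp add: scalar_prod_def)
qed

lemma mat_diag_one: "(\<And>s. s < n \<Longrightarrow> f s = 1) \<Longrightarrow> mat_diag n f = 1\<^sub>m n"
  by (auto simp: mat_diag_def)

text \<open>Two splittings of \<open>E\<close> differ by an isomorphism between sums of line bundles. Its component
  from \<open>O(d)\<close> to \<open>O(d')\<close> is a section of \<open>O(d' - d)\<close>, hence zero unless \<open>d \<le> d'\<close>; as the
  determinant is not zero, some term of its Leibniz expansion consists of non-zero entries.\<close>

lemma splittings_dominate:
  fixes E :: "('k::{alg_closed_field, field_char_0} P1, 'i, 'k) vbundle"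
  assumes E: "open_atlas E" and L: "splitting E ds L" and L': "splitting E ds' L'"
  obtains p where "p permutes {..<length ds}" "\<And>s. s < length ds \<Longrightarrow> ds ! p s \<le> ds' ! s"
proof -
  define N where "N = length ds"
  have N: "length ds = N" "length ds' = N" "bundle_rank E = N"
    using splittingD(1)[OF L] splittingD(1)[OF L'] by (simp_all add: N_def)
  note L = splittingD[OF L, unfolded N] and L' = splittingD[OF L', unfolded N]
  have T: "transition E i j x \<in> carrier_mat N N"
    if "i \<in> chart_index E" "j \<in> chart_index E" "x \<in> chart E i" "x \<in> chart E j" for i j x
    using E that unfolding open_atlas_def N by blast
  obtain ch where ch: "ch x \<in> chart_index E" "x \<in> chart E (ch x)" for x
    using E unfolding open_atlas_def by metis
  (* The isomorphism from the first sum of line bundles to the second. *)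
  define \<Phi> where "\<Phi> k i x = L' k i x * inverse_mat (L k i x)" for k i x
  have \<Phi>: "\<Phi> k i x \<in> carrier_mat N N" "\<Phi> k i x * L k i x = L' k i x" "det (\<Phi> k i x) \<noteq> 0"
    if "i \<in> chart_index E" "k \<in> {0, 1}" "x \<in> chart E i" "hcoord k x \<noteq> 0" for i k x
  proof -
    note inv = inverse_mat[OF L(2,3)[OF that]]
    note L'2 = L'(2)[OF that]
    show "\<Phi> k i x \<in> carrier_mat N N" unfolding \<Phi>_def using inv L'2 by auto
    show eq: "\<Phi> k i x * L k i x = L' k i x" unfolding \<Phi>_def
      using inv L'2 L(2)[OF that] by (simp add: assoc_mult_mat[of _ N N _ N _ N])
    have "det (\<Phi> k i x) * det (L k i x) = det (L' k i x)"
      using eq det_mult[OF \<open>\<Phi> k i x \<in> carrier_mat N N\<close> L(2)[OF that]] by simp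
    then show "det (\<Phi> k i x) \<noteq> 0" using L'(3)[OF that] by auto
  qed
  have cancel: "A = B" if "A * M = B * M" "A \<in> carrier_mat N N" "B \<in> carrier_mat N N"
    "M \<in> carrier_mat N N" "det M \<noteq> 0" for A B M :: "'k mat"
  proof -
    note inv = inverse_mat[OF that(4,5)]
    have "A = A * M * inverse_mat M"
      using inv that(2) by (simp add: assoc_mult_mat[OF that(2,4) inv(1)])
    also have "\<dots> = B"
      unfolding that(1) using inv that(3) by (simp add: assoc_mult_mat[OF that(3,4) inv(1)])
    finally show ?thesis .
  qed
  have \<Phi>_chart: "\<Phi> k i x = \<Phi> k j x"
    if "i \<in> chart_index E" "j \<in> chart_index E" "k \<in> {0, 1}" "x \<in> chart E i" "x \<in> chart E j"
      "hcoord k x \<noteq> 0" for i j k x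
  proof -
    have one: "mat_diag N (\<lambda>s. (hcoord k x / hcoord k x) powi f s) = 1\<^sub>m N" for f
      using that by (intro mat_diag_one) auto
    have t: "L k i x * transition E i j x = L k j x" "L' k i x * transition E i j x = L' k j x"
      using L(5)[of i j k k x] L'(5)[of i j k k x] L(2)[of j k x] L'(2)[of j k x] that
      unfolding one by auto
    have "\<Phi> k i x * L k j x = \<Phi> k i x * L k i x * transition E i j x"
      using t(1) \<Phi>(1)[of i k x] L(2)[of i k x] T[of i j x] that
      by (simp add: assoc_mult_mat[of _ N N _ N _ N])
    also have "\<dots> = \<Phi> k j x * L k j x" using \<Phi>(2) that t(2) by simp
    finally show ?thesis by (rule cancel) (intro \<Phi>(1) L(2,3) that)+
  qed
  have \<Phi>_glue: "\<Phi> 0 (ch x) x $$ (s, t) =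
      (hcoord 1 x / hcoord 0 x) powi (ds' ! s - ds ! t) * \<Phi> 1 (ch x) x $$ (s, t)"
    if x: "hcoord 0 x \<noteq> 0" "hcoord 1 x \<noteq> 0" and st: "s < N" "t < N" for x s t
  proof -
    let ?i = "ch x"
    define D where "D f = mat_diag N (\<lambda>s. (hcoord 1 x / hcoord 0 x) powi (f ! s :: int))" for f
    have D: "D f \<in> carrier_mat N N" for f by (simp add: D_def)
    have one: "mat_diag N (\<lambda>s. (hcoord 0 x / hcoord 0 x) powi (f s)) = 1\<^sub>m N" for f
      using that by (intro mat_diag_one) auto
    have k: "(0::nat) \<in> {0, 1}" "(1::nat) \<in> {0, 1}" by auto
    have "L 0 ?i x = L 0 ?i x * transition E ?i ?i x"
      using L(5)[OF ch(1) ch(1) k(1) k(1) ch(2) ch(2) x(1) x(1)] L(2)[OF ch(1) k(1) ch(2) x(1)]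
      unfolding one by simp
    also have "\<dots> = D ds * L 1 ?i x"
      unfolding D_def by (rule L(5)[OF ch(1) ch(1) k ch(2) ch(2) x])
    finally have l: "L 0 ?i x = D ds * L 1 ?i x" .
    have "L' 0 ?i x = L' 0 ?i x * transition E ?i ?i x"
      using L'(5)[OF ch(1) ch(1) k(1) k(1) ch(2) ch(2) x(1) x(1)] L'(2)[OF ch(1) k(1) ch(2) x(1)]
      unfolding one by simp
    also have "\<dots> = D ds' * L' 1 ?i x"
      unfolding D_def by (rule L'(5)[OF ch(1) ch(1) k ch(2) ch(2) x])
    finally have l': "L' 0 ?i x = D ds' * L' 1 ?i x" .
    have "\<Phi> 0 ?i x * D ds * L 1 ?i x = \<Phi> 0 ?i x * L 0 ?i x"
      unfolding l using \<Phi>(1)[of ?i 0 x] L(2)[of ?i 1 x] D x ch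
      by (simp add: assoc_mult_mat[of _ N N _ N _ N])
    also have "\<dots> = D ds' * (\<Phi> 1 ?i x * L 1 ?i x)"
      using \<Phi>(2)[of ?i 0 x] \<Phi>(2)[of ?i 1 x] ch x l' by simp
    also have "\<dots> = D ds' * \<Phi> 1 ?i x * L 1 ?i x"
      using \<Phi>(1)[of ?i 1 x] L(2)[of ?i 1 x] D x ch by (simp add: assoc_mult_mat[of _ N N _ N _ N])
    finally have "\<Phi> 0 ?i x * D ds = D ds' * \<Phi> 1 ?i x"
      using \<Phi>(1)[of ?i 0 x] \<Phi>(1)[of ?i 1 x] L(2,3)[of ?i 1 x] D x ch
        mult_carrier_mat[OF D \<Phi>(1)[of ?i 1 x], of ds']
      by (elim cancel) simp_all
    then have "(\<Phi> 0 ?i x * D ds) $$ (s, t) = (D ds' * \<Phi> 1 ?i x) $$ (s, t)" by simp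
    then have "\<Phi> 0 ?i x $$ (s, t) * (hcoord 1 x / hcoord 0 x) powi (ds ! t) =
        (hcoord 1 x / hcoord 0 x) powi (ds' ! s) * \<Phi> 1 ?i x $$ (s, t)"
      using \<Phi>(1)[of ?i 0 x] \<Phi>(1)[of ?i 1 x] x ch st
      by (simp add: D_def mat_diag_mult_left[of _ N N] mat_diag_mult_right[of _ N N])
    then show ?thesis using x by (simp add: power_int_diff field_simps)
  qed
  have \<Phi>_regular: "regular_at (\<lambda>y. \<Phi> k (ch y) y $$ (s, t)) x"
    if k: "k \<in> {0, 1}" and x: "hcoord k x \<noteq> 0" and st: "s < N" "t < N" for k x s t
  proof -
    let ?i = "ch x" and ?U = "chart E (ch x) \<inter> {y. hcoord k y \<noteq> 0}"
    have U: "zariski_open ?U" "x \<in> ?U"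
      using open_atlas_zariski_open[OF E ch(1)] ch x by auto
    have "regular_at (\<lambda>y. \<Phi> k ?i y $$ (s, t)) x"
      unfolding \<Phi>_def
    proof (rule regular_at_mat_mult[of ?U _ N N])
      show "L' k ?i y \<in> carrier_mat N N" if "y \<in> ?U" for y
        using that ch k by (intro L'(2)) auto
      show "inverse_mat (L k ?i y) \<in> carrier_mat N N" if "y \<in> ?U" for y
        using that ch k by (intro inverse_mat L(2,3)) auto
      show "regular_at (\<lambda>y. L' k ?i y $$ (u, v)) x" if "u < N" "v < N" for u v
        using that ch k x by (intro L'(4)) auto
      show "regular_at (\<lambda>y. inverse_mat (L k ?i y) $$ (u, v)) x" if "u < N" "v < N" for u v
      proof (rule regular_at_inverse_mat[OF _ U])
        show "L k ?i y \<in> carrier_mat N N" if "y \<in> ?U" for y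
          using that ch k by (intro L(2)) auto
      qed (use L(3,4)[OF ch(1) k ch(2) x] that in auto)
    qed (use U st in auto)
    then show ?thesis
    proof (rule regular_at_cong[OF _ U])
      show "\<Phi> k ?i y $$ (s, t) = \<Phi> k (ch y) y $$ (s, t)" if "y \<in> ?U" for y
        using that ch k by (subst \<Phi>_chart[of ?i "ch y"]) auto
    qed
  qed
  let ?M = "\<Phi> 1 (ch (Affine 0)) (Affine 0)"
  have M: "?M \<in> carrier_mat N N" "det ?M \<noteq> 0" using \<Phi>(1,3) ch by auto
  have zero: "?M $$ (s, t) = 0" if "s < N" "t < N" "ds' ! s < ds ! t" for s t
    using negative_degree_section_eq_0[of "\<lambda>x. \<Phi> 0 (ch x) x $$ (s, t)"
        "\<lambda>x. \<Phi> 1 (ch x) x $$ (s, t)" "ds' ! s - ds ! t" 0] \<Phi>_regular \<Phi>_glue that by auto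
  have "(\<Sum>p\<in>{p. p permutes {0..<N}}. signof p * (\<Prod>i = 0..<N. ?M $$ (i, p i))) \<noteq> 0"
    using M(2) unfolding det_def'[OF M(1)] .
  then obtain p where "p \<in> {p. p permutes {0..<N}}"
    and prod: "signof p * (\<Prod>i = 0..<N. ?M $$ (i, p i)) \<noteq> 0"
    by (rule sum.not_neutral_contains_not_neutral)
  then have p: "p permutes {0..<N}" by simp
  have nz: "?M $$ (s, p s) \<noteq> 0" if "s < N" for s using that prod by auto
  show ?thesis
  proof
    show "p permutes {..<length ds}" using p N by (simp add: lessThan_atLeast0)
    fix s assume s: "s < length ds"
    then have "p s < N" using permutes_in_image[OF p, of s] N by simp
    then show "ds ! p s \<le> ds' ! s" using zero[of s "p s"] nz[of s] s N by fastforce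
  qed
qed

lemma sum_list_permute:
  fixes ds :: "int list"
  assumes "p permutes {..<length ds}"
  shows "sum_list ds = (\<Sum>s<length ds. ds ! p s)"
  using sum.permute[OF assms, of "(!) ds"]
  by (simp add: sum_list_sum_nth lessThan_atLeast0[symmetric] o_def)

text \<open>The degrees of each splitting dominate those of the other one after a permutation. Hence both have
  the same sum, and all the inequalities are equalities.\<close>

lemma splitting_type_unique:
  fixes E :: "('k::{alg_closed_field, field_char_0} P1, 'i, 'k) vbundle"
  assumes "open_atlas E" and L: "splitting E ds L" and L': "splitting E ds' L'"
  shows "mset ds = mset ds'"
proof -
  have len: "length ds = length ds'" using splittingD(1)[OF L] splittingD(1)[OF L'] by simp
  obtain p where p: "p permutes {..<length ds}" "\<And>s. s < length ds \<Longrightarrow> ds ! p s \<le> ds' ! s"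
    using splittings_dominate[OF assms] by blast
  obtain q where q: "q permutes {..<length ds'}" "\<And>s. s < length ds' \<Longrightarrow> ds' ! q s \<le> ds ! s"
    using splittings_dominate[OF assms(1) L' L] by blast
  have "sum_list ds' \<le> sum_list ds"
    unfolding sum_list_permute[OF q(1)] using q(2) len
    by (auto simp: sum_list_sum_nth lessThan_atLeast0[symmetric] intro: sum_mono)
  then have "(\<Sum>s<length ds. ds' ! s - ds ! p s) \<le> 0"
    unfolding sum_list_permute[OF p(1)] using len
    by (simp add: sum_list_sum_nth lessThan_atLeast0[symmetric] sum_subtractf)
  moreover have "0 \<le> (\<Sum>s<length ds. ds' ! s - ds ! p s)" using p(2) by (intro sum_nonneg) auto
  ultimately have "\<forall>s\<in>{..<length ds}. ds' ! s - ds ! p s = 0"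
    using p(2) by (subst sum_nonneg_eq_0_iff[symmetric]) auto
  then have "ds' = permute_list p ds"
    using len by (intro nth_equalityI) (auto simp: permute_list_def)
  then show ?thesis using mset_permute_list[OF p(1)] by simp
qed


section \<open>Operations on split bundles\<close>

lemma det_mat_diag: "det (mat_diag n f :: 'k::field mat) = (\<Prod>s<n. f s)"
proof -
  have "upper_triangular (mat_diag n f)" by (auto simp: mat_diag_def)
  then have "det (mat_diag n f) = prod_list (diag_mat (mat_diag n f))"
    by (rule det_upper_triangular) (rule mat_diag_dim)
  also have "diag_mat (mat_diag n f) = map f [0..<n]"
    by (auto simp: diag_mat_def mat_diag_def)
  also have "prod_list (map f [0..<n]) = (\<Prod>s<n. f s)"
    by (simp add: prod.list_conv_set_nth lessThan_atLeast0)
  finally show ?thesis .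
qed

lemma prod_powi_eq_powi_sum:
  "(c::'k::field) \<noteq> 0 \<Longrightarrow> (\<Prod>s<(n::nat). c powi f s) = c powi (\<Sum>s<n. f s)"
  by (induction n) (auto simp: power_int_add)

lemma splitting_det_bundle:
  fixes E :: "('k::field P1, 'i, 'k) vbundle"
  assumes E: "open_atlas E" and L: "splitting E ds L"
  shows "splitting (det_bundle E) [sum_list ds] (\<lambda>k i x. mat 1 1 (\<lambda>_. det (L k i x)))"
proof -
  define N where "N = length ds"
  have N: "length ds = N" "bundle_rank E = N" using splittingD(1)[OF L] by (simp_all add: N_def)
  note L = splittingD[OF L, unfolded N]
  have T: "transition E i j x \<in> carrier_mat N N"
    if "i \<in> chart_index E" "j \<in> chart_index E" "x \<in> chart E i" "x \<in> chart E j" for i j x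
    using E that unfolding open_atlas_def N by blast
  have reg: "regular_at (\<lambda>y. det (L k i y)) x"
    if "i \<in> chart_index E" "k \<in> {0, 1}" "x \<in> chart E i" "hcoord k x \<noteq> 0" for i k x
  proof (rule regular_at_det)
    show "zariski_open (chart E i \<inter> {y. hcoord k y \<noteq> 0})"
      by (rule open_atlas_zariski_open[OF E that(1)])
    show "L k i y \<in> carrier_mat N N" if "y \<in> chart E i \<inter> {y. hcoord k y \<noteq> 0}" for y
      using that \<open>i \<in> chart_index E\<close> \<open>k \<in> {0, 1}\<close> by (intro L(2)) auto
  qed (use that L(4)[OF that] in auto)
  have trans: "det (L k i x) * det (transition E i j x) =
      (hcoord l x / hcoord k x) powi sum_list ds * det (L l j x)"
    if "i \<in> chart_index E" "j \<in> chart_index E" "k \<in> {0, 1}" "l \<in> {0, 1}" "x \<in> chart E i"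
      "x \<in> chart E j" "hcoord k x \<noteq> 0" "hcoord l x \<noteq> 0" for i j k l x
  proof -
    have "det (L k i x) * det (transition E i j x) = det (L k i x * transition E i j x)"
      by (rule det_mult[OF L(2) T, symmetric]) (intro that)+
    also have "\<dots> = det (mat_diag N (\<lambda>s. (hcoord l x / hcoord k x) powi (ds ! s)) * L l j x)"
      by (simp only: L(5)[OF that])
    also have "\<dots> = det (mat_diag N (\<lambda>s. (hcoord l x / hcoord k x) powi (ds ! s))) * det (L l j x)"
      by (rule det_mult[OF mat_diag_dim L(2)]) (intro that)+
    also have "det (mat_diag N (\<lambda>s. (hcoord l x / hcoord k x) powi (ds ! s))) =
        (hcoord l x / hcoord k x) powi sum_list ds"
      using that by (simp add: det_mat_diag prod_powi_eq_powi_sum sum_list_sum_nth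
          lessThan_atLeast0[symmetric] N)
    finally show ?thesis .
  qed
  show ?thesis
    unfolding splitting_def det_bundle_def vbundle.select_convs
  proof (intro conjI ballI impI allI)
    fix i k x assume h: "i \<in> chart_index E" "k \<in> {0, 1}" "x \<in> chart E i" "hcoord k x \<noteq> 0"
    show "mat 1 1 (\<lambda>_. det (L k i x)) \<in> carrier_mat (length [sum_list ds]) (length [sum_list ds])"
      by simp
    show "det (mat 1 1 (\<lambda>_. det (L k i x))) \<noteq> 0"
      using L(3)[OF h] by (simp add: det_single)
    fix s t assume "s < length [sum_list ds]" "t < length [sum_list ds]"
    then show "regular_at (\<lambda>y. mat 1 1 (\<lambda>_. det (L k i y)) $$ (s, t)) x"
      using reg[OF h] by simp
  next
    fix i j k l x
    assume h: "i \<in> chart_index E" "j \<in> chart_index E" "k \<in> {0, 1}" "l \<in> {0, 1}"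
      "x \<in> chart E i \<inter> chart E j" "hcoord k x \<noteq> 0" "hcoord l x \<noteq> 0"
    have tr: "det (L k i x) * det (transition E i j x) =
      (hcoord l x / hcoord k x) powi sum_list ds * det (L l j x)"
      using h by (intro trans) auto
    show "mat 1 1 (\<lambda>_. det (L k i x)) * mat 1 1 (\<lambda>_. det (transition E i j x)) =
        mat_diag (length [sum_list ds])
          (\<lambda>s. (hcoord l x / hcoord k x) powi ([sum_list ds] ! s)) * mat 1 1 (\<lambda>_. det (L l j x))"
      by (rule eq_matI) (simp_all add: scalar_prod_def mat_diag_def tr)
  qed simp
qed

text \<open>The cocycle of \<open>F\<close> is that of \<open>E\<close> in coordinates rescaled by a constant on each chart. The
  determinants of the two universal bundles are related in this way.\<close>

lemma splitting_rescale:
  fixes E F :: "('k::field P1, 'i, 'k) vbundle"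
  assumes E: "open_atlas E" and L: "splitting E ds L"
    and F: "bundle_rank F = bundle_rank E" "chart_index F = chart_index E" "chart F = chart E"
    and c: "\<And>i. i \<in> chart_index E \<Longrightarrow> c i \<noteq> 0"
    and T: "\<And>i j x. i \<in> chart_index E \<Longrightarrow> j \<in> chart_index E \<Longrightarrow> x \<in> chart E i \<Longrightarrow> x \<in> chart E j \<Longrightarrow>
      transition F i j x = (c j / c i) \<cdot>\<^sub>m transition E i j x"
  shows "splitting F ds (\<lambda>k i x. c i \<cdot>\<^sub>m L k i x)"
proof -
  define N where "N = length ds"
  have N: "length ds = N" "bundle_rank E = N" using splittingD(1)[OF L] by (simp_all add: N_def)
  note L = splittingD[OF L, unfolded N]
  show ?thesis
    unfolding splitting_def F N
  proof (intro conjI ballI impI allI)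
    fix i k x assume h: "i \<in> chart_index E" "k \<in> {0, 1}" "x \<in> chart E i" "hcoord k x \<noteq> 0"
    show "c i \<cdot>\<^sub>m L k i x \<in> carrier_mat N N" using L(2)[OF h] by simp
    show "det (c i \<cdot>\<^sub>m L k i x) \<noteq> 0" using L(2,3)[OF h] c[OF h(1)] by simp
    fix s t assume st: "s < N" "t < N"
    show "regular_at (\<lambda>y. (c i \<cdot>\<^sub>m L k i y) $$ (s, t)) x"
    proof (rule regular_at_cong[OF _ open_atlas_zariski_open[OF E h(1), of k]])
      show "regular_at (\<lambda>y. c i * L k i y $$ (s, t)) x"
        by (intro regular_at_mult regular_at_const L(4) h st)
      show "x \<in> chart E i \<inter> {x. hcoord k x \<noteq> 0}" using h by simp
      show "c i * L k i y $$ (s, t) = (c i \<cdot>\<^sub>m L k i y) $$ (s, t)"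
        if "y \<in> chart E i \<inter> {x. hcoord k x \<noteq> 0}" for y
        using L(2)[of i k y] h that st by simp
    qed
  next
    fix i j k l x
    assume h: "i \<in> chart_index E" "j \<in> chart_index E" "k \<in> {0, 1}" "l \<in> {0, 1}"
      and "x \<in> chart E i \<inter> chart E j" and h': "hcoord k x \<noteq> 0" "hcoord l x \<noteq> 0"
    then have x: "x \<in> chart E i" "x \<in> chart E j" by auto
    have TE: "transition E i j x \<in> carrier_mat N N"
      using E h x unfolding open_atlas_def N by blast
    have LC: "L k i x \<in> carrier_mat N N" "L l j x \<in> carrier_mat N N"
      by (intro L(2) h x h')+
    have "c i \<cdot>\<^sub>m L k i x * transition F i j x = c j \<cdot>\<^sub>m (L k i x * transition E i j x)"
      unfolding T[OF h(1,2) x] using c[OF h(1)]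
      by (simp add: mult_smult_distrib[OF LC(1) TE] smult_smult_mat
        mult_smult_assoc_mat[OF LC(1) smult_carrier_mat[OF TE]])
    also have "L k i x * transition E i j x =
        mat_diag N (\<lambda>s. (hcoord l x / hcoord k x) powi (ds ! s)) * L l j x"
      by (rule L(5)[OF h x h'])
    finally show "c i \<cdot>\<^sub>m L k i x * transition F i j x =
         mat_diag N (\<lambda>s. (hcoord l x / hcoord k x) powi (ds ! s)) * (c j \<cdot>\<^sub>m L l j x)"
      by (simp add: mult_smult_distrib[OF mat_diag_dim LC(2)])
  qed simp
qed

text \<open>The pair \<open>(i, j)\<close> of rows has the number \<open>i * dim_row B + j\<close>, as for the affine coordinates of the
  Grassmannian.\<close>

definition kronecker :: "'k::semiring_0 mat \<Rightarrow> 'k mat \<Rightarrow> 'k mat" where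
  "kronecker A B = mat (dim_row A * dim_row B) (dim_col A * dim_col B)
     (\<lambda>(k, l). A $$ (k div dim_row B, l div dim_col B) * B $$ (k mod dim_row B, l mod dim_col B))"

lemma kronecker_carrier:
  "A \<in> carrier_mat m n \<Longrightarrow> B \<in> carrier_mat m' n' \<Longrightarrow>
     kronecker A B \<in> carrier_mat (m * m') (n * n')"
  by (auto simp: kronecker_def)

lemma kronecker_index:
  "A \<in> carrier_mat m n \<Longrightarrow> B \<in> carrier_mat m' n' \<Longrightarrow> k < m * m' \<Longrightarrow> l < n * n' \<Longrightarrow>
     kronecker A B $$ (k, l) = A $$ (k div m', l div n') * B $$ (k mod m', l mod n')"
  by (auto simp: kronecker_def)

lemma div_mod_less:
  fixes k m r :: nat
  assumes "k < m * r" shows "k div r < m" "k mod r < r"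
  using assms by (simp_all add: less_mult_imp_div_less) (metis gr0I mod_less_divisor mult_0_right not_less0)

lemma bij_betw_div_mod:
  "bij_betw (\<lambda>k. (k div r, k mod r)) {..<m * r} ({..<m} \<times> {..<r :: nat})"
proof (rule bij_betwI[where g = "\<lambda>(i, j). i * r + j"])
  show "(\<lambda>k. (k div r, k mod r)) \<in> {..<m * r} \<rightarrow> {..<m} \<times> {..<r}"
    using div_mod_less by auto
  show "(\<lambda>(i, j). i * r + j) \<in> {..<m} \<times> {..<r} \<rightarrow> {..<m * r}"
  proof
    fix ij assume "ij \<in> {..<m} \<times> {..<r}"
    then obtain i j where ij: "ij = (i, j)" "i < m" "j < r" by auto
    have "i * r + j < Suc i * r" using ij by simp
    also have "\<dots> \<le> m * r" using ij by (intro mult_right_mono) auto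
    finally show "(\<lambda>(i, j). i * r + j) ij \<in> {..<m * r}" using ij by simp
  qed
qed auto

lemma sum_div_mod:
  "(\<Sum>k<m * (r::nat). h (k div r) (k mod r)) = (\<Sum>i<m. \<Sum>j<r. h i j)"
  using sum.reindex_bij_betw[OF bij_betw_div_mod, of "\<lambda>(i, j). h i j" r m]
  by (simp add: sum.cartesian_product)

lemma kronecker_mult:
  fixes A B C D :: "'k::comm_semiring_0 mat"
  assumes A: "A \<in> carrier_mat m n" and B: "B \<in> carrier_mat m' n'"
    and C: "C \<in> carrier_mat n l" and D: "D \<in> carrier_mat n' l'"
  shows "kronecker A B * kronecker C D = kronecker (A * C) (B * D)"
proof (rule eq_matI)
  note AB = kronecker_carrier[OF A B] and CD = kronecker_carrier[OF C D]
  note R = kronecker_carrier[OF mult_carrier_mat[OF A C] mult_carrier_mat[OF B D]]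
  show "dim_row (kronecker A B * kronecker C D) = dim_row (kronecker (A * C) (B * D))"
    "dim_col (kronecker A B * kronecker C D) = dim_col (kronecker (A * C) (B * D))"
    using AB CD R by auto
  fix s t assume "s < dim_row (kronecker (A * C) (B * D))" "t < dim_col (kronecker (A * C) (B * D))"
  then have st: "s < m * m'" "t < l * l'" using R by auto
  note s = div_mod_less[OF st(1)] and t = div_mod_less[OF st(2)]
  have "(kronecker A B * kronecker C D) $$ (s, t) =
      (\<Sum>u<n * n'. kronecker A B $$ (s, u) * kronecker C D $$ (u, t))"
    using AB CD st by (simp add: scalar_prod_def lessThan_atLeast0)
  also have "\<dots> = (\<Sum>u<n * n'. (A $$ (s div m', u div n') * C $$ (u div n', t div l')) *
      (B $$ (s mod m', u mod n') * D $$ (u mod n', t mod l')))"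
    by (intro sum.cong refl)
       (simp add: kronecker_index[OF A B st(1)] kronecker_index[OF C D _ st(2)] ac_simps)
  also have "\<dots> = (\<Sum>i<n. A $$ (s div m', i) * C $$ (i, t div l')) *
      (\<Sum>j<n'. B $$ (s mod m', j) * D $$ (j, t mod l'))"
    by (subst sum_div_mod) (simp add: sum_product)
  also have "\<dots> = (A * C) $$ (s div m', t div l') * (B * D) $$ (s mod m', t mod l')"
    using A B C D s t by (simp add: scalar_prod_def lessThan_atLeast0)
  also have "\<dots> = kronecker (A * C) (B * D) $$ (s, t)"
    using kronecker_index[OF mult_carrier_mat[OF A C] mult_carrier_mat[OF B D] st] by simp
  finally show "(kronecker A B * kronecker C D) $$ (s, t) = kronecker (A * C) (B * D) $$ (s, t)" .
qed

lemma kronecker_mat_diag: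
  "kronecker (mat_diag m f) (mat_diag r g) =
     mat_diag (m * r) (\<lambda>k. f (k div r) * g (k mod r) :: 'k::semiring_0)"
proof (rule eq_matI)
  fix s t assume "s < dim_row (mat_diag (m * r) (\<lambda>k. f (k div r) * g (k mod r)))"
    "t < dim_col (mat_diag (m * r) (\<lambda>k. f (k div r) * g (k mod r)))"
  then have st: "s < m * r" "t < m * r" by (simp_all add: mat_diag_def)
  have "s = t \<longleftrightarrow> s div r = t div r \<and> s mod r = t mod r" by (metis div_mult_mod_eq)
  then show "kronecker (mat_diag m f) (mat_diag r g) $$ (s, t) =
      mat_diag (m * r) (\<lambda>k. f (k div r) * g (k mod r)) $$ (s, t)"
    unfolding kronecker_index[OF mat_diag_dim mat_diag_dim st]
    using st div_mod_less[OF st(1)] div_mod_less[OF st(2)] by (auto simp: mat_diag_def)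
qed (simp_all add: kronecker_def mat_diag_def)

text \<open>The Kronecker product of the inverses is an inverse.\<close>

lemma det_kronecker_nonzero:
  fixes A B :: "'k::field mat"
  assumes A: "A \<in> carrier_mat m m" "det A \<noteq> 0" and B: "B \<in> carrier_mat r r" "det B \<noteq> 0"
  shows "det (kronecker A B) \<noteq> 0"
proof -
  note iA = inverse_mat[OF A] and iB = inverse_mat[OF B]
  have "kronecker A B * kronecker (inverse_mat A) (inverse_mat B) =
      kronecker (mat_diag m (\<lambda>_. 1)) (mat_diag r (\<lambda>_. 1))"
    using iA iB by (simp add: kronecker_mult[OF A(1) B(1) iA(1) iB(1)] mat_diag_one)
  also have "\<dots> = 1\<^sub>m (m * r)" unfolding kronecker_mat_diag by (rule mat_diag_one) simp
  finally have "det (kronecker A B) * det (kronecker (inverse_mat A) (inverse_mat B)) = 1"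
    using det_mult[OF kronecker_carrier[OF A(1) B(1)] kronecker_carrier[OF iA(1) iB(1)]] by simp
  then show ?thesis by auto
qed

text \<open>The splitting type of a tensor product, ordered like the rows of a Kronecker product.\<close>

definition sum_types :: "int list \<Rightarrow> int list \<Rightarrow> int list" where
  "sum_types bs as = map (\<lambda>k. bs ! (k div length as) + as ! (k mod length as))
     [0..<length bs * length as]"

lemma mset_sum_types:
  "mset (sum_types bs as) =
     image_mset (\<lambda>(i, j). bs ! i + as ! j) (mset_set ({..<length bs} \<times> {..<length as}))"
proof -
  let ?d = "\<lambda>k. (k div length as, k mod length as)"
  have "mset_set ({..<length bs} \<times> {..<length as}) =
      image_mset ?d (mset_set {..<length bs * length as})"
    using bij_betw_div_mod[of "length as" "length bs"]
    by (simp add: image_mset_mset_set bij_betw_def)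
  then show ?thesis
    by (simp add: sum_types_def image_mset.compositionality o_def lessThan_atLeast0
        flip: mset_upt)
qed

lemma splitting_tensor:
  fixes E F G :: "('k::field P1, 'i, 'k) vbundle"
  assumes E: "open_atlas E" "splitting E bs L" and F: "open_atlas F" "splitting F as M"
    and index: "chart_index F = chart_index E" "chart F = chart E"
    and G: "bundle_rank G = bundle_rank E * bundle_rank F" "chart_index G = chart_index E"
      "chart G = chart E"
    and T: "\<And>i j x. i \<in> chart_index E \<Longrightarrow> j \<in> chart_index E \<Longrightarrow> x \<in> chart E i \<Longrightarrow> x \<in> chart E j \<Longrightarrow>
      transition G i j x = kronecker (transition E i j x) (transition F i j x)"
  shows "splitting G (sum_types bs as) (\<lambda>k i x. kronecker (L k i x) (M k i x))"
proof -
  define m r where "m = length bs" and "r = length as"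
  have N: "length bs = m" "length as = r" "bundle_rank E = m" "bundle_rank F = r"
    using splittingD(1)[OF E(2)] splittingD(1)[OF F(2)] by (simp_all add: m_def r_def)
  have N': "length (sum_types bs as) = m * r" by (simp add: sum_types_def N)
  note L = splittingD[OF E(2), unfolded N] and M = splittingD[OF F(2), unfolded N index]
  show ?thesis
    unfolding splitting_def G N' N
  proof (intro conjI ballI impI allI)
    fix i k x assume h: "i \<in> chart_index E" "k \<in> {0, 1}" "x \<in> chart E i" "hcoord k x \<noteq> 0"
    show "kronecker (L k i x) (M k i x) \<in> carrier_mat (m * r) (m * r)"
      by (intro kronecker_carrier L(2) M(2) h)
    show "det (kronecker (L k i x) (M k i x)) \<noteq> 0"
      by (rule det_kronecker_nonzero[OF L(2,3) M(2,3)]) (intro h)+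
    fix s t assume st: "s < m * r" "t < m * r"
    note s = div_mod_less[OF st(1)] and t = div_mod_less[OF st(2)]
    show "regular_at (\<lambda>y. kronecker (L k i y) (M k i y) $$ (s, t)) x"
    proof (rule regular_at_cong[OF _ open_atlas_zariski_open[OF E(1) h(1), of k]])
      show "regular_at (\<lambda>y. L k i y $$ (s div r, t div r) * M k i y $$ (s mod r, t mod r)) x"
        by (intro regular_at_mult L(4) M(4) h s t)
      show "x \<in> chart E i \<inter> {x. hcoord k x \<noteq> 0}" using h by simp
      fix y assume "y \<in> chart E i \<inter> {x. hcoord k x \<noteq> 0}"
      then have y: "y \<in> chart E i" "hcoord k y \<noteq> 0" by auto
      show "L k i y $$ (s div r, t div r) * M k i y $$ (s mod r, t mod r) =
          kronecker (L k i y) (M k i y) $$ (s, t)"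
        by (rule kronecker_index[OF L(2) M(2) st, symmetric]) (intro h y)+
    qed
  next
    fix i j k l x
    assume h: "i \<in> chart_index E" "j \<in> chart_index E" "k \<in> {0, 1}" "l \<in> {0, 1}"
      and "x \<in> chart E i \<inter> chart E j" and h': "hcoord k x \<noteq> 0" "hcoord l x \<noteq> 0"
    then have x: "x \<in> chart E i" "x \<in> chart E j" by auto
    have TC: "transition E i j x \<in> carrier_mat m m" "transition F i j x \<in> carrier_mat r r"
      using E(1) F(1) h x unfolding open_atlas_def N index by blast+
    let ?c = "hcoord l x / hcoord k x"
    have c: "?c \<noteq> 0" using h' by simp
    have "kronecker (L k i x) (M k i x) * transition G i j x =
        kronecker (L k i x * transition E i j x) (M k i x * transition F i j x)"
      unfolding T[OF h(1,2) x] by (rule kronecker_mult[OF L(2) M(2) TC]) (intro h x h')+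
    also have "\<dots> = kronecker (mat_diag m (\<lambda>s. ?c powi (bs ! s)) * L l j x)
        (mat_diag r (\<lambda>s. ?c powi (as ! s)) * M l j x)"
      by (simp only: L(5)[OF h x h'] M(5)[OF h x h'])
    also have "\<dots> = kronecker (mat_diag m (\<lambda>s. ?c powi (bs ! s)))
        (mat_diag r (\<lambda>s. ?c powi (as ! s))) * kronecker (L l j x) (M l j x)"
      by (rule kronecker_mult[OF mat_diag_dim mat_diag_dim L(2) M(2), symmetric]) (intro h x h')+
    also have "kronecker (mat_diag m (\<lambda>s. ?c powi (bs ! s))) (mat_diag r (\<lambda>s. ?c powi (as ! s))) =
        mat_diag (m * r) (\<lambda>s. ?c powi (sum_types bs as ! s))"
      unfolding kronecker_mat_diag
      using c by (auto simp: mat_diag_def sum_types_def N power_int_add intro!: eq_matI)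
    finally show "kronecker (L k i x) (M k i x) * transition G i j x =
         mat_diag (m * r) (\<lambda>s. ?c powi (sum_types bs as ! s)) * kronecker (L l j x) (M l j x)" .
  qed simp
qed


text \<open>Permuting the summands; this allows splitting types to be listed in increasing order.\<close>

lemma splitting_permute:
  fixes E :: "('k::field P1, 'i, 'k) vbundle"
  assumes E: "open_atlas E" and L: "splitting E ds L" and p: "p permutes {..<length ds}"
  shows "splitting E (permute_list p ds)
    (\<lambda>k i x. mat (length ds) (length ds) (\<lambda>(s, t). L k i x $$ (p s, t)))"
proof -
  define N where "N = length ds"
  have N: "length ds = N" "bundle_rank E = N" "length (permute_list p ds) = N"
    using splittingD(1)[OF L] by (simp_all add: N_def)
  note L = splittingD[OF L, unfolded N]
  have p': "p permutes {0..<N}" "p permutes {..<length ds}" using p N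
    by (simp_all add: lessThan_atLeast0)
  have pN: "p s < N" if "s < N" for s using permutes_in_image[OF p'(1), of s] that by simp
  show ?thesis
    unfolding splitting_def N
  proof (intro conjI ballI impI allI)
    fix i k x assume h: "i \<in> chart_index E" "k \<in> {0, 1}" "x \<in> chart E i" "hcoord k x \<noteq> 0"
    show "det (mat N N (\<lambda>(s, t). L k i x $$ (p s, t))) \<noteq> 0"
      using det_permute_rows[OF L(2)[OF h] p'(1)] L(3)[OF h] by (simp add: sign_def split: if_splits)
    fix s t assume "s < N" "t < N"
    then show "regular_at (\<lambda>y. mat N N (\<lambda>(s, t). L k i y $$ (p s, t)) $$ (s, t)) x"
      using L(4)[OF h pN] by simp
  next
    fix i j k l x
    assume h: "i \<in> chart_index E" "j \<in> chart_index E" "k \<in> {0, 1}" "l \<in> {0, 1}"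
      and "x \<in> chart E i \<inter> chart E j" and h': "hcoord k x \<noteq> 0" "hcoord l x \<noteq> 0"
    then have x: "x \<in> chart E i" "x \<in> chart E j" by auto
    have TC: "transition E i j x \<in> carrier_mat N N"
      using E h x unfolding open_atlas_def N by blast
    have LC: "L k i x \<in> carrier_mat N N" "L l j x \<in> carrier_mat N N" by (intro L(2) h x h')+
    let ?c = "hcoord l x / hcoord k x"
    have eq: "(L k i x * transition E i j x) $$ (p s, t) =
        (mat_diag N (\<lambda>s. ?c powi (ds ! s)) * L l j x) $$ (p s, t)" for s t
      by (simp only: L(5)[OF h x h'])
    show "mat N N (\<lambda>(s, t). L k i x $$ (p s, t)) * transition E i j x =
        mat_diag N (\<lambda>s. ?c powi (permute_list p ds ! s)) * mat N N (\<lambda>(s, t). L l j x $$ (p s, t))"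
      (is "?A * _ = mat_diag N ?d * ?B")
    proof (rule eq_matI)
      fix s t assume "s < dim_row (mat_diag N ?d * ?B)" "t < dim_col (mat_diag N ?d * ?B)"
      then have st: "s < N" "t < N" by (simp_all add: mat_diag_def)
      have "(?A * transition E i j x) $$ (s, t) = (L k i x * transition E i j x) $$ (p s, t)"
        using LC TC st pN by (simp add: scalar_prod_def)
      also have "\<dots> = (mat_diag N ?d * ?B) $$ (s, t)"
        unfolding eq using LC st pN N
        by (simp add: mat_diag_mult_left[of _ N N] permute_list_nth[OF p'(2)])
      finally show "(?A * transition E i j x) $$ (s, t) = (mat_diag N ?d * ?B) $$ (s, t)" .
    qed (use TC in \<open>simp_all add: mat_diag_def\<close>)
  qed (simp_all add: N)
qed

lemma splitting_sort:
  fixes E :: "('k::field P1, 'i, 'k) vbundle"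
  assumes "open_atlas E" "splitting E ds L"
  shows "\<exists>L. splitting E (sort ds) L"
proof -
  obtain p where "p permutes {..<length ds}" "permute_list p ds = sort ds"
    using mset_eq_permutation[of "sort ds" ds] by auto
  then show ?thesis using splitting_permute[OF assms] by metis
qed


section \<open>Bases of minimal degree\<close>

abbreviation mat_image :: "'k::field mat \<Rightarrow> nat \<Rightarrow> 'k vec set" where
  "mat_image A m \<equiv> (\<lambda>v. A *\<^sub>v v) ` carrier_vec m"

text \<open>A local frame with a constant left inverse, such as a coordinate projection.\<close>

definition local_frame ::
  "nat \<Rightarrow> nat \<Rightarrow> ('k::field P1 \<Rightarrow> 'k vec set) \<Rightarrow> 'k P1 \<Rightarrow> 'k P1 set \<Rightarrow> ('k P1 \<Rightarrow> 'k mat) \<Rightarrow> 'k mat \<Rightarrow> bool"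
  where "local_frame n m W x U F R \<longleftrightarrow> zariski_open U \<and> x \<in> U \<and> R \<in> carrier_mat m n \<and>
     (\<forall>y\<in>U. F y \<in> carrier_mat n m \<and> R * F y = 1\<^sub>m m \<and> W y = mat_image (F y) m) \<and>
     (\<forall>i<n. \<forall>j<m. regular_at (\<lambda>y. F y $$ (i, j)) x)"

definition subbundle :: "nat \<Rightarrow> nat \<Rightarrow> ('k::field P1 \<Rightarrow> 'k vec set) \<Rightarrow> bool" where
  "subbundle n m W \<longleftrightarrow> (\<forall>x. \<exists>U F R. local_frame n m W x U F R)"

lemma subbundleE:
  assumes "subbundle n m W"
  obtains U F R where "local_frame n m W x U F R"
  using assms unfolding subbundle_def by iprover

lemma local_frameD:
  assumes "local_frame n m W x U F R"
  shows "zariski_open U" "x \<in> U" "R \<in> carrier_mat m n"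
    "\<And>y. y \<in> U \<Longrightarrow> F y \<in> carrier_mat n m" "\<And>y. y \<in> U \<Longrightarrow> R * F y = 1\<^sub>m m"
    "\<And>y. y \<in> U \<Longrightarrow> W y = mat_image (F y) m"
    "\<And>i j. i < n \<Longrightarrow> j < m \<Longrightarrow> regular_at (\<lambda>y. F y $$ (i, j)) x"
  using assms unfolding local_frame_def by simp_all

lemma mat_image_mult_subset:
  fixes A B :: "'k::field mat"
  assumes A: "A \<in> carrier_mat n m" and B: "B \<in> carrier_mat m l"
  shows "mat_image (A * B) l \<subseteq> mat_image A m"
proof
  fix v assume "v \<in> mat_image (A * B) l"
  then obtain u where u: "u \<in> carrier_vec l" "v = A * B *\<^sub>v u" by blast
  have "v = A *\<^sub>v (B *\<^sub>v u)" unfolding u(2) by (rule assoc_mult_mat_vec[OF A B u(1)])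
  moreover have "B *\<^sub>v u \<in> carrier_vec m" using B u by simp
  ultimately show "v \<in> mat_image A m" by blast
qed

lemma mult_mat_zero_vec: "A \<in> carrier_mat m n \<Longrightarrow> A *\<^sub>v 0\<^sub>v n = (0\<^sub>v m :: 'k::field vec)"
  by (intro eq_vecI) auto

text \<open>The matrix \<open>F * R\<close> is a projection onto the column space of \<open>F\<close>, so membership in this space is
  an equation.\<close>

lemma mem_image_iff:
  fixes F R :: "'k::field mat"
  assumes F: "F \<in> carrier_mat n m" and R: "R \<in> carrier_mat m n" and RF: "R * F = 1\<^sub>m m"
    and v: "v \<in> carrier_vec n"
  shows "v \<in> mat_image F m \<longleftrightarrow> F *\<^sub>v (R *\<^sub>v v) = v"
proof
  assume "v \<in> mat_image F m"
  then obtain u where u: "u \<in> carrier_vec m" "v = F *\<^sub>v u" by auto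
  have "R *\<^sub>v v = u" unfolding u(2) using assoc_mult_mat_vec[OF R F u(1)] RF u(1) by simp
  then show "F *\<^sub>v (R *\<^sub>v v) = v" using u by simp
next
  assume "F *\<^sub>v (R *\<^sub>v v) = v"
  moreover have "R *\<^sub>v v \<in> carrier_vec m" using R v by simp
  ultimately show "v \<in> mat_image F m" by (metis image_eqI)
qed

lemma cols_in_image:
  fixes F R :: "'k::field mat"
  assumes F: "F \<in> carrier_mat n m" and R: "R \<in> carrier_mat m n" and RF: "R * F = 1\<^sub>m m"
    and M: "M \<in> carrier_mat n l" "\<And>j. j < l \<Longrightarrow> col M j \<in> mat_image F m"
  shows "F * (R * M) = M"
proof (rule mat_col_eqI)
  fix j assume "j < dim_col M"
  then have j: "j < l" using M by simp
  have cj: "col M j \<in> carrier_vec n" using M(1) j by auto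
  have "col (F * (R * M)) j = F *\<^sub>v (R *\<^sub>v col M j)"
    using col_mult2[OF F mult_carrier_mat[OF R M(1)] j] col_mult2[OF R M(1) j] by simp
  then show "col (F * (R * M)) j = col M j"
    using mem_image_iff[OF F R RF cj] M(2)[OF j] by simp
qed (use F R M in auto)

lemma mult_mat_vec_in_subbundle:
  assumes W: "subbundle n m W" and M: "M \<in> carrier_mat n l" "\<And>j. j < l \<Longrightarrow> col M j \<in> W y"
    and c: "c \<in> carrier_vec l"
  shows "M *\<^sub>v c \<in> W y"
proof -
  obtain U F R where fr: "local_frame n m W y U F R" using subbundleE[OF W] by blast
  note y = local_frameD(2)[OF fr] and R = local_frameD(3)[OF fr] and F = local_frameD(4-6)[OF fr]
  note Fy = F(1,2)[OF y]
  have "F y * (R * M) = M"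
    using cols_in_image[OF Fy(1) R Fy(2) M(1)] M(2) unfolding F(3)[OF y] by blast
  then have "mat_image M l \<subseteq> W y"
    using mat_image_mult_subset[OF Fy(1) mult_carrier_mat[OF R M(1)]] unfolding F(3)[OF y] by simp
  then show ?thesis using c by blast
qed

lemma hcoord_nonzero_exists: "\<exists>k\<in>{0, 1}. hcoord k x \<noteq> (0 :: 'k::field)"
  by (cases x) auto

text \<open>A sub-bundle is closed: in terms of a local frame and its left inverse, membership of a vector
  of forms is the vanishing of regular functions.\<close>

lemma subbundle_closed:
  fixes W :: "'k::field_char_0 P1 \<Rightarrow> 'k vec set" and v :: "'k P1 \<Rightarrow> 'k vec"
  assumes W: "subbundle n m W" and v: "\<And>y. v y \<in> carrier_vec n"
    and form: "\<And>i. i < n \<Longrightarrow> binary_form d (\<lambda>y. v y $ i)"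
    and S: "finite S" "\<And>y. y \<notin> S \<Longrightarrow> v y \<in> W y"
  shows "v x \<in> W x"
proof -
  obtain U F R where fr: "local_frame n m W x U F R" using subbundleE[OF W] by blast
  note U = local_frameD(1,2)[OF fr] and R = local_frameD(3)[OF fr] and F = local_frameD(4-6)[OF fr]
    and reg = local_frameD(7)[OF fr]
  obtain k where k: "hcoord k x \<noteq> 0" using hcoord_nonzero_exists by blast
  define g where "g i y = (\<Sum>a<m. F y $$ (i, a) * (\<Sum>b<n. R $$ (a, b) * (v y $ b / hcoord k y ^ d)))
      + - (v y $ i / hcoord k y ^ d)" for i y
  have g: "g i y = ((F y *\<^sub>v (R *\<^sub>v v y)) $ i - v y $ i) / hcoord k y ^ d" if "i < n" "y \<in> U" for i y
    using that F(1)[of y] R v[of y]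
    by (simp add: g_def scalar_prod_def lessThan_atLeast0 diff_divide_distrib
        flip: sum_divide_distrib)
  have "g i x = 0" if i: "i < n" for i
  proof (rule regular_at_eq_0[OF _ U S(1)])
    show "regular_at (g i) x"
      unfolding g_def
      by (intro regular_at_add regular_at_uminus regular_at_sum regular_at_mult regular_at_const
          regular_at_form_quotient form reg i k) auto
    show "g i y = 0" if "y \<in> U" "y \<notin> S" for y
      using S(2)[OF that(2)] F[OF that(1)] mem_image_iff[of "F y" n m R "v y"] R v g[OF i that(1)]
      by simp
  qed
  then have "(F x *\<^sub>v (R *\<^sub>v v x)) $ i = v x $ i" if "i < n" for i
    using g[OF that U(2)] that k by simp
  then have "F x *\<^sub>v (R *\<^sub>v v x) = v x"
    using F(1)[OF U(2)] v[of x] by (intro eq_vecI) auto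
  then show ?thesis using F[OF U(2)] mem_image_iff[of "F x" n m R "v x"] R v by simp
qed

definition form_sections ::
  "nat \<Rightarrow> nat \<Rightarrow> ('k::field P1 \<Rightarrow> 'k vec set) \<Rightarrow> (nat \<Rightarrow> nat) \<Rightarrow> ('k P1 \<Rightarrow> 'k mat) \<Rightarrow> bool" where
  "form_sections n m W d M \<longleftrightarrow> (\<forall>y. M y \<in> carrier_mat n m) \<and>
     (\<forall>i<n. \<forall>j<m. binary_form (d j) (\<lambda>y. M y $$ (i, j))) \<and> (\<forall>y. \<forall>j<m. col (M y) j \<in> W y)"

lemma form_sectionsD:
  assumes "form_sections n m W d M"
  shows "M y \<in> carrier_mat n m" "i < n \<Longrightarrow> j < m \<Longrightarrow> binary_form (d j) (\<lambda>y. M y $$ (i, j))"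
    "j < m \<Longrightarrow> col (M y) j \<in> W y"
  using assms unfolding form_sections_def by blast+

definition independent_cols :: "nat \<Rightarrow> nat \<Rightarrow> 'k::field mat \<Rightarrow> bool" where
  "independent_cols n m A \<longleftrightarrow> (\<forall>c\<in>carrier_vec m. A *\<^sub>v c = 0\<^sub>v n \<longrightarrow> c = 0\<^sub>v m)"

lemma cofinite_of_zariski_open:
  assumes "zariski_open U" "x \<in> U" shows "finite (- U)"
proof -
  obtain d H where H: "binary_form d H" "H x \<noteq> 0" "\<And>y. H y \<noteq> 0 \<Longrightarrow> y \<in> U"
    using assms by (rule zariski_openE) blast
  then have "- U \<subseteq> {y. H y = 0}" by auto
  then show ?thesis using finite_zeros_binary_form[OF H(1,2)] by (rule finite_subset)
qed

text \<open>Clearing the denominators of a local frame gives sections that are defined everywhere.\<close>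

lemma form_sections_exist:
  fixes W :: "'k::field_char_0 P1 \<Rightarrow> 'k vec set"
  assumes W: "subbundle n m W"
  obtains d M where "form_sections n m W d M" "independent_cols n m (M x)"
proof -
  obtain U F R where fr: "local_frame n m W x U F R" using subbundleE[OF W] by blast
  note U = local_frameD(1,2)[OF fr] and R = local_frameD(3)[OF fr] and F = local_frameD(4-6)[OF fr]
    and reg = local_frameD(7)[OF fr]
  define I where "I = {..<n} \<times> {..<m}"
  have "\<forall>ij\<in>I. \<exists>e P Q. binary_form e P \<and> binary_form e Q \<and> Q x \<noteq> 0 \<and>
     (\<forall>y. Q y \<noteq> 0 \<longrightarrow> F y $$ ij = P y / Q y)"
    using reg unfolding regular_at_def I_def by auto
  then obtain e P Q where PQ: "\<And>ij. ij \<in> I \<Longrightarrow> binary_form (e ij) (P ij)"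
    "\<And>ij. ij \<in> I \<Longrightarrow> binary_form (e ij) (Q ij)" "\<And>ij. ij \<in> I \<Longrightarrow> Q ij x \<noteq> 0"
    "\<And>ij y. ij \<in> I \<Longrightarrow> Q ij y \<noteq> 0 \<Longrightarrow> F y $$ ij = P ij y / Q ij y" by metis
  have finI: "finite I" by (simp add: I_def)
  define D where "D y = (\<Prod>ij\<in>I. Q ij y)" for y
  define d where "d = (\<Sum>ij\<in>I. e ij)"
  define G where "G ij y = P ij y * (\<Prod>ab\<in>I - {ij}. Q ab y)" for ij y
  define M where "M y = mat n m (\<lambda>ij. G ij y)" for y
  have D: "binary_form d D" unfolding D_def d_def by (intro binary_form_prod PQ)
  have Dx: "D x \<noteq> 0" unfolding D_def using PQ(3) finI by simp
  have G: "binary_form d (G ij)" if "ij \<in> I" for ij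
  proof -
    have "binary_form (e ij + (\<Sum>ab\<in>I - {ij}. e ab)) (G ij)"
      unfolding G_def using that by (intro binary_form_mult binary_form_prod PQ) auto
    then show ?thesis unfolding d_def using sum.remove[OF finI that, of e] by simp
  qed
  have GF: "G ij y = D y * F y $$ ij" if "ij \<in> I" "D y \<noteq> 0" for ij y
  proof -
    have "Q ij y \<noteq> 0" using that finI unfolding D_def by auto
    then show ?thesis using PQ(4)[OF that(1)] prod.remove[OF finI that(1), of "\<lambda>ab. Q ab y"]
      by (simp add: G_def D_def)
  qed
  have MF: "M y = D y \<cdot>\<^sub>m F y" if "y \<in> U" "D y \<noteq> 0" for y
    using F(1)[OF that(1)] GF[OF _ that(2)] by (intro eq_matI) (auto simp: M_def I_def)
  have "form_sections n m W (\<lambda>_. d) M"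
    unfolding form_sections_def
  proof (intro conjI allI impI)
    show "M y \<in> carrier_mat n m" for y by (simp add: M_def)
    show "binary_form d (\<lambda>y. M y $$ (i, j))" if "i < n" "j < m" for i j
      using G[of "(i, j)"] that by (simp add: M_def I_def)
    show "col (M y) j \<in> W y" if j: "j < m" for y j
    proof (rule subbundle_closed[OF W])
      show "col (M y) j \<in> carrier_vec n" for y by (simp add: M_def carrier_vecI)
      show "binary_form d (\<lambda>y. col (M y) j $ i)" if "i < n" for i
        using G[of "(i, j)"] that j by (simp add: M_def I_def)
      show "finite (- U \<union> {y. D y = 0})"
        using cofinite_of_zariski_open[OF U] finite_zeros_binary_form[OF D Dx] by simp
      fix z assume "z \<notin> - U \<union> {y. D y = 0}"
      then have z: "z \<in> U" "D z \<noteq> 0" by auto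
      have "col (M z) j = F z *\<^sub>v (D z \<cdot>\<^sub>v unit_vec m j)"
        unfolding MF[OF z] using F(1)[OF z(1)] j
        by (intro eq_vecI) (auto simp: mult_mat_vec)
      then show "col (M z) j \<in> W z" unfolding F(3)[OF z(1)] by simp
    qed
  qed
  moreover have "independent_cols n m (M x)"
    unfolding independent_cols_def
  proof (intro ballI impI)
    fix c :: "'k vec" assume c: "c \<in> carrier_vec m" "M x *\<^sub>v c = 0\<^sub>v n"
    note Fx = F(1,2)[OF U(2)]
    have Dc: "D x \<cdot>\<^sub>v c \<in> carrier_vec m" using c by simp
    have "M x *\<^sub>v c = F x *\<^sub>v (D x \<cdot>\<^sub>v c)"
      unfolding MF[OF U(2) Dx] using Fx c
      by (intro eq_vecI) (auto simp: scalar_prod_def ac_simps)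
    then have "F x *\<^sub>v (D x \<cdot>\<^sub>v c) = 0\<^sub>v n" using c(2) by metis
    then have "R *\<^sub>v (F x *\<^sub>v (D x \<cdot>\<^sub>v c)) = 0\<^sub>v m"
      by (simp add: mult_mat_zero_vec[OF R])
    then have "D x \<cdot>\<^sub>v c = 0\<^sub>v m" using assoc_mult_mat_vec[OF R Fx(1) Dc] Fx(2) Dc by simp
    then show "c = 0\<^sub>v m" using Dx c(1) by (auto simp: vec_eq_iff)
  qed
  ultimately show ?thesis using that by blast
qed


text \<open>If the columns satisfy a linear relation at the point \<open>z\<close>, homogenise the relation with powers
  of a coordinate and put it in place of a column of maximal degree among those involved. It
  vanishes at \<open>z\<close>, so it is divisible by the linear form through \<open>z\<close>, and the degree drops. The
  point \<open>x\<close>, where the columns are independent, guarantees that the maximal degree was not zero.\<close>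

lemma form_sections_reduce:
  fixes W :: "'k::field_char_0 P1 \<Rightarrow> 'k vec set"
  assumes W: "subbundle n m W" and M: "form_sections n m W d M" and ind: "independent_cols n m (M x)"
    and dep: "\<not> independent_cols n m (M z)"
  obtains d' M' where "form_sections n m W d' M'" "independent_cols n m (M' x)"
    "(\<Sum>j<m. d' j) < (\<Sum>j<m. d j)"
proof -
  note M = form_sectionsD[OF M]
  obtain c where c: "c \<in> carrier_vec m" "M z *\<^sub>v c = 0\<^sub>v n" "c \<noteq> 0\<^sub>v m"
    using dep unfolding independent_cols_def by blast
  define J where "J = {j. j < m \<and> c $ j \<noteq> 0}"
  have J: "finite J" "J \<noteq> {}" using c unfolding J_def by (auto simp: vec_eq_iff)
  obtain i where "i \<in> J" and max: "\<And>j. j \<in> J \<Longrightarrow> d j \<le> d i"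
  proof -
    have "Max (d ` J) \<in> d ` J" using J by simp
    then obtain i where i: "i \<in> J" "d i = Max (d ` J)" by (metis imageE)
    have "d j \<le> d i" if "j \<in> J" for j unfolding i(2) using J that by simp
    then show ?thesis using that i by blast
  qed
  then have i: "i < m" "c $ i \<noteq> 0" by (simp_all add: J_def)
  obtain k where k: "hcoord k z \<noteq> 0" using hcoord_nonzero_exists by blast
  (* The coefficients of the relation, homogenised to degree d i - d j and normalised at z. *)
  define \<gamma> where "\<gamma> y j = c $ j / hcoord k z ^ (d i - d j) * hcoord k y ^ (d i - d j)" for y j
  define w where "w y a = (\<Sum>j<m. \<gamma> y j * M y $$ (a, j))" for y a
  have mult: "(M y *\<^sub>v v) $ a = (\<Sum>j<m. v $ j * M y $$ (a, j))" if "a < n" "v \<in> carrier_vec m"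
    for y a v
    using that M(1)[of y] by (simp add: scalar_prod_def lessThan_atLeast0 mult.commute)
  have \<gamma>i: "\<gamma> y i = c $ i" for y by (simp add: \<gamma>_def)
  have "\<gamma> z j = c $ j" for j using k by (simp add: \<gamma>_def)
  then have wz: "w z a = 0" if "a < n" for a
    using mult[OF that c(1), of z] c(2) that by (simp add: w_def)
  have w_form: "binary_form (d i) (\<lambda>y. w y a)" if "a < n" for a
    unfolding w_def
  proof (rule binary_form_sum)
    fix j assume "j \<in> {..<m}"
    then have j: "j < m" by simp
    show "binary_form (d i) (\<lambda>y. \<gamma> y j * M y $$ (a, j))"
    proof (cases "j \<in> J")
      case True
      have "binary_form ((d i - d j) * 1 + d j) (\<lambda>y. \<gamma> y j * M y $$ (a, j))"
        unfolding \<gamma>_def using that j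
        by (intro binary_form_mult binary_form_smult binary_form_power binary_form_hcoord M)
      then show ?thesis using max[OF True] by simp
    next
      case False
      then show ?thesis using j binary_form_zero by (simp add: J_def \<gamma>_def)
    qed
  qed
  have "d i \<noteq> 0"
  proof
    assume d0: "d i = 0"
    have "\<gamma> x j = c $ j" for j using d0 by (simp add: \<gamma>_def)
    then have "(M x *\<^sub>v c) $ a = 0" if "a < n" for a
      using binary_form_0_constant[OF w_form[OF that, unfolded d0], of x z] wz[OF that]
        mult[OF that c(1), of x] by (simp add: w_def)
    then have "M x *\<^sub>v c = 0\<^sub>v n" using M(1)[of x] by (intro eq_vecI) auto
    then show False using ind c unfolding independent_cols_def by blast
  qed
  then obtain e where e: "d i = Suc e" using not0_implies_Suc by blast
  have "\<forall>a. \<exists>g. a < n \<longrightarrow> binary_form e g \<and> (\<forall>y. w y a = form_through z y * g y)"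
    using binary_form_factor[OF w_form[unfolded e]] wz by metis
  then obtain g where g: "\<And>a. a < n \<Longrightarrow> binary_form e (g a)"
    "\<And>a y. a < n \<Longrightarrow> w y a = form_through z y * g a y" by metis
  define M' where "M' y = mat n m (\<lambda>(a, j). if j = i then g a y else M y $$ (a, j))" for y
  have g_comb: "vec n (\<lambda>a. g a y) = M y *\<^sub>v vec m (\<lambda>j. \<gamma> y j / form_through z y)" if "y \<noteq> z" for y
  proof (rule eq_vecI)
    fix a assume "a < dim_vec (M y *\<^sub>v vec m (\<lambda>j. \<gamma> y j / form_through z y))"
    then have a: "a < n" using M(1)[of y] by simp
    have "form_through z y \<noteq> 0" using that by (simp add: form_through_eq_0_iff)
    then have "g a y = w y a / form_through z y" using g(2)[OF a] by simp
    then show "vec n (\<lambda>a. g a y) $ a = (M y *\<^sub>v vec m (\<lambda>j. \<gamma> y j / form_through z y)) $ a"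
      using a by (simp add: mult[OF a] w_def sum_divide_distrib)
  qed (use M(1)[of y] in simp)
  have "form_sections n m W (d(i := e)) M'"
    unfolding form_sections_def
  proof (intro conjI allI impI)
    show "M' y \<in> carrier_mat n m" for y by (simp add: M'_def)
    show "binary_form ((d(i := e)) j) (\<lambda>y. M' y $$ (a, j))" if "a < n" "j < m" for a j
      using that g(1) M(2) by (simp add: M'_def)
    show "col (M' y) j \<in> W y" if j: "j < m" for y j
    proof (cases "j = i")
      case False
      then have "col (M' y) j = col (M y) j"
        using j M(1)[of y] by (intro eq_vecI) (auto simp: M'_def)
      then show ?thesis using M(3)[OF j] by simp
    next
      case True
      have "vec n (\<lambda>a. g a y) \<in> W y"
      proof (rule subbundle_closed[OF W, where v = "\<lambda>y. vec n (\<lambda>a. g a y)" and d = e and S = "{z}"])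
        show "vec n (\<lambda>a. g a y) \<in> W y" if "y \<notin> {z}" for y
          using that M(1)[of y] M(3)[of _ y] by (subst g_comb) (auto intro!: mult_mat_vec_in_subbundle[OF W])
      qed (use g(1) in auto)
      moreover have "col (M' y) j = vec n (\<lambda>a. g a y)"
        using True i by (intro eq_vecI) (auto simp: M'_def)
      ultimately show ?thesis by simp
    qed
  qed
  moreover have "independent_cols n m (M' x)"
    unfolding independent_cols_def
  proof (intro ballI impI)
    fix b :: "'k vec" assume b: "b \<in> carrier_vec m" "M' x *\<^sub>v b = 0\<^sub>v n"
    have "x \<noteq> z" using ind dep by auto
    then have t0: "form_through z x \<noteq> 0" by (simp add: form_through_eq_0_iff)
    (* The relation b between the new columns, rewritten as a relation between the old ones. *)
    define b' where "b' = vec m (\<lambda>j. (if j = i then 0 else b $ j) + b $ i * \<gamma> x j / form_through z x)"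
    have "M x *\<^sub>v b' = 0\<^sub>v n"
    proof (rule eq_vecI)
      fix a assume "a < dim_vec (0\<^sub>v n :: 'k vec)"
      then have a: "a < n" by simp
      have "(M x *\<^sub>v b') $ a = (\<Sum>j<m. ((if j = i then 0 else b $ j) +
          b $ i * \<gamma> x j / form_through z x) * M x $$ (a, j))"
        using a by (simp add: mult b'_def)
      also have "\<dots> = (\<Sum>j<m. (if j = i then 0 else b $ j) * M x $$ (a, j)) +
          b $ i * (w x a / form_through z x)"
        by (simp add: distrib_right sum.distrib w_def sum_divide_distrib sum_distrib_left mult.assoc)
      also have "w x a / form_through z x = g a x" using g(2)[OF a] t0 by simp
      also have "(\<Sum>j<m. (if j = i then 0 else b $ j) * M x $$ (a, j)) + b $ i * g a x =
          (\<Sum>j<m. (if j = i then 0 else b $ j) * M x $$ (a, j) + (if j = i then b $ i * g a x else 0))"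
        using i by (simp add: sum.distrib)
      also have "\<dots> = (\<Sum>j<m. M' x $$ (a, j) * b $ j)"
        using a by (intro sum.cong) (auto simp: M'_def)
      also have "\<dots> = (M' x *\<^sub>v b) $ a"
        using a b(1) by (simp add: M'_def scalar_prod_def lessThan_atLeast0)
      finally show "(M x *\<^sub>v b') $ a = 0\<^sub>v n $ a" using b(2) a by simp
    qed (use M(1)[of x] in simp)
    moreover have "b' \<in> carrier_vec m" by (simp add: b'_def)
    ultimately have b'0: "b' = 0\<^sub>v m" using ind unfolding independent_cols_def by blast
    have "b' $ i = 0" unfolding b'0 using i by simp
    then have bi: "b $ i = 0" using i t0 \<gamma>i[of x] by (simp add: b'_def)
    have "b $ j = 0" if "j < m" for j
    proof (cases "j = i")
      case False
      have "b' $ j = 0" unfolding b'0 using that by simp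
      then show ?thesis using that False bi by (simp add: b'_def)
    qed (use bi in simp)
    then show "b = 0\<^sub>v m" using b(1) by (intro eq_vecI) auto
  qed
  moreover have "(\<Sum>j<m. (d(i := e)) j) < (\<Sum>j<m. d j)"
    using i e by (intro sum_strict_mono_ex1) auto
  ultimately show ?thesis using that by blast
qed

text \<open>By the preceding reduction, sections of minimal total degree cannot become dependent at any
  point. This is the splitting theorem of Grothendieck for sub-bundles of a trivial bundle.\<close>

lemma subbundle_basis:
  fixes W :: "'k::field_char_0 P1 \<Rightarrow> 'k vec set"
  assumes W: "subbundle n m W"
  obtains d M where "form_sections n m W d M" "\<And>x. independent_cols n m (M x)"
proof -
  define x :: "'k P1" where "x = Infinity"
  define P where "P s \<longleftrightarrow> (\<exists>d M. form_sections n m W d M \<and> independent_cols n m (M x) \<and>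
    s = (\<Sum>j<m. d j))" for s
  define s where "s = (LEAST s. P s)"
  obtain d0 M0 where "form_sections n m W d0 M0" "independent_cols n m (M0 x)"
    using form_sections_exist[OF W] by blast
  then have "P (\<Sum>j<m. d0 j)" unfolding P_def by blast
  then have "P s" unfolding s_def by (rule LeastI)
  then obtain d M where M: "form_sections n m W d M" "independent_cols n m (M x)"
    "s = (\<Sum>j<m. d j)" unfolding P_def by blast
  have "independent_cols n m (M z)" for z
  proof (rule ccontr)
    assume "\<not> independent_cols n m (M z)"
    then obtain d' M' where "form_sections n m W d' M'" "independent_cols n m (M' x)"
      and less: "(\<Sum>j<m. d' j) < (\<Sum>j<m. d j)"
      using form_sections_reduce[OF W M(1,2)] by blast
    then have "P (\<Sum>j<m. d' j)" unfolding P_def by blast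
    then have "s \<le> (\<Sum>j<m. d' j)" unfolding s_def by (rule Least_le)
    then show False using less M(3) by simp
  qed
  then show ?thesis using that M(1) by blast
qed

text \<open>The matrix \<open>R * M x\<close> contains the coordinates of the global basis in a local frame.\<close>

lemma subbundle_basis_frame:
  fixes F R :: "'k::field mat"
  assumes M: "form_sections n m W d M" "independent_cols n m (M x)"
    and F: "F \<in> carrier_mat n m" and R: "R \<in> carrier_mat m n" and RF: "R * F = 1\<^sub>m m"
    and Wx: "W x = mat_image F m"
  shows "F * (R * M x) = M x" "det (R * M x) \<noteq> 0"
proof -
  note M' = form_sectionsD(1,3)[OF M(1)]
  show eq: "F * (R * M x) = M x"
    using cols_in_image[OF F R RF M'(1)[of x]] M'(2)[of _ x] unfolding Wx by blast
  note RM = mult_carrier_mat[OF R M'(1)[of x]]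
  show "det (R * M x) \<noteq> 0"
  proof
    assume "det (R * M x) = 0"
    then obtain v where v: "v \<in> carrier_vec m" "v \<noteq> 0\<^sub>v m" "(R * M x) *\<^sub>v v = 0\<^sub>v m"
      using det_0_iff_vec_prod_zero_field[OF RM] by blast
    have "M x *\<^sub>v v = F *\<^sub>v ((R * M x) *\<^sub>v v)"
      using assoc_mult_mat_vec[OF F RM v(1)] eq by simp
    then have "M x *\<^sub>v v = 0\<^sub>v n" using v(3) by (simp add: mult_mat_zero_vec[OF F])
    then show False using M(2) v unfolding independent_cols_def by blast
  qed
qed


section \<open>Standard charts of the Grassmannian\<close>

text \<open>The projection to the coordinates in \<open>S\<close>. It turns the formation of submatrices into matrix
  multiplication, so that frames and coframes can be compared by matrix algebra.\<close>

definition select :: "nat \<Rightarrow> nat set \<Rightarrow> 'k::field mat" where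
  "select n S = mat (card {i. i < n \<and> i \<in> S}) n (\<lambda>(i, j). if j = pick S i then 1 else 0)"

lemma sum_delta_mult:
  fixes f :: "'b \<Rightarrow> 'k::field"
  assumes "finite S"
  shows "(\<Sum>k\<in>S. (if k = a then 1 else 0) * f k) = (if a \<in> S then f a else 0)"
proof -
  have "(\<Sum>k\<in>S. (if k = a then 1 else 0) * f k) = (\<Sum>k\<in>S. if k = a then f k else 0)"
    by (intro sum.cong) auto
  then show ?thesis using assms by simp
qed

lemma select_mult:
  fixes A :: "'k::field mat"
  assumes A: "A \<in> carrier_mat n m"
  shows "select n S * A = submatrix A S UNIV"
proof (rule eq_matI)
  fix i j assume "i < dim_row (submatrix A S UNIV)" "j < dim_col (submatrix A S UNIV)"
  then have ij: "i < card {i. i < n \<and> i \<in> S}" "j < m" using A by (auto simp: dim_submatrix)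
  have "pick S i < n" using pick_le[OF ij(1)] .
  moreover have "(select n S * A) $$ (i, j) =
      (\<Sum>k\<in>{0..<n}. (if k = pick S i then 1 else 0) * A $$ (k, j))"
    using A ij by (simp add: select_def scalar_prod_def)
  ultimately have "(select n S * A) $$ (i, j) = A $$ (pick S i, j)"
    by (simp add: sum_delta_mult)
  then show "(select n S * A) $$ (i, j) = submatrix A S UNIV $$ (i, j)"
    using A ij by (simp add: submatrix_index pick_UNIV)
qed (use A in \<open>auto simp: select_def dim_submatrix\<close>)

lemma mult_select_transpose:
  fixes B :: "'k::field mat"
  assumes B: "B \<in> carrier_mat m n"
  shows "B * (select n S)\<^sup>T = submatrix B UNIV S"
proof (rule eq_matI)
  fix i j assume "i < dim_row (submatrix B UNIV S)" "j < dim_col (submatrix B UNIV S)"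
  then have ij: "i < m" "j < card {j. j < n \<and> j \<in> S}" using B by (auto simp: dim_submatrix)
  have "pick S j < n" using pick_le[OF ij(2)] .
  moreover have "(B * (select n S)\<^sup>T) $$ (i, j) =
      (\<Sum>k\<in>{0..<n}. (if k = pick S j then 1 else 0) * B $$ (i, k))"
    using B ij by (simp add: select_def scalar_prod_def mult.commute)
  ultimately have "(B * (select n S)\<^sup>T) $$ (i, j) = B $$ (i, pick S j)"
    by (simp add: sum_delta_mult)
  then show "(B * (select n S)\<^sup>T) $$ (i, j) = submatrix B UNIV S $$ (i, j)"
    using B ij by (simp add: submatrix_index pick_UNIV)
qed (use B in \<open>auto simp: select_def dim_submatrix\<close>)

lemma select_mult_vec:
  fixes v :: "'k::field vec"
  assumes v: "v \<in> carrier_vec n" and i: "i < card {i. i < n \<and> i \<in> S}"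
  shows "(select n S *\<^sub>v v) $ i = v $ pick S i"
proof -
  have "(select n S *\<^sub>v v) $ i = (\<Sum>k\<in>{0..<n}. (if k = pick S i then 1 else 0) * v $ k)"
    using v i by (simp add: select_def scalar_prod_def)
  then show ?thesis using pick_le[OF i] by (simp add: sum_delta_mult)
qed

lemma select_mult_select_transpose:
  "select n S * (select n T)\<^sup>T = mat (card {i. i < n \<and> i \<in> S}) (card {i. i < n \<and> i \<in> T})
     (\<lambda>(i, j). if pick S i = pick T j then 1 else (0 :: 'k::field))" (is "_ = ?M")
proof (rule eq_matI)
  fix i j assume "i < dim_row ?M" "j < dim_col ?M"
  then have ij: "i < card {i. i < n \<and> i \<in> S}" "j < card {i. i < n \<and> i \<in> T}" by auto
  have "(select n S * (select n T)\<^sup>T) $$ (i, j) =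
      (\<Sum>k\<in>{0..<n}. (if k = pick S i then 1 else 0) * (if k = pick T j then 1 else 0))"
    using ij by (simp add: select_def scalar_prod_def)
  then show "(select n S * (select n T)\<^sup>T) $$ (i, j) = ?M $$ (i, j)"
    using ij pick_le[OF ij(1)] by (simp add: sum_delta_mult)
qed (auto simp: select_def)

lemma pick_eq_iff:
  assumes "i < card {i. i < n \<and> i \<in> S}" "j < card {i. i < n \<and> i \<in> S}"
  shows "pick S i = pick S j \<longleftrightarrow> i = j"
  using pick_mono_le[of i "{i. i < n \<and> i \<in> S}" j] pick_mono_le[of j "{i. i < n \<and> i \<in> S}" i] assms
  by (cases i j rule: linorder_cases) (simp_all add: pick_reduce_set[OF assms(1)] pick_reduce_set[OF assms(2)])

lemma pick_mem:
  assumes "i < card {i. i < n \<and> i \<in> S}" shows "pick S i \<in> S"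
  using pick_in_set_le[OF assms] pick_reduce_set[OF assms] by simp

lemma select_transpose_mult_select:
  "(select n S)\<^sup>T * select n S =
     mat n n (\<lambda>(a, b). if a = b \<and> a \<in> S then 1 else (0 :: 'k::field))" (is "_ = ?M")
proof (rule eq_matI)
  fix a b assume "a < dim_row ?M" "b < dim_col ?M"
  then have ab: "a < n" "b < n" by auto
  let ?m = "card {i. i < n \<and> i \<in> S}"
  have "((select n S)\<^sup>T * select n S) $$ (a, b) =
      (\<Sum>k<?m. if a = pick S k \<and> b = pick S k then 1 else (0::'k))"
    using ab by (auto simp add: select_def scalar_prod_def lessThan_atLeast0 intro!: sum.cong)
  also have "\<dots> = (if a = b \<and> a \<in> S then 1 else 0)"
  proof (cases "a = b \<and> a \<in> S")
    case True
    let ?k = "card {i \<in> S. i < a}"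
    have k: "pick S ?k = a" using pick_card_in_set True by blast
    have "{i \<in> S. i < a} \<subset> {i. i < n \<and> i \<in> S}" using True ab by auto
    then have km: "?k < ?m" by (intro psubset_card_mono) auto
    have "(\<Sum>k<?m. if a = pick S k \<and> b = pick S k then 1 else (0::'k)) =
        (\<Sum>k<?m. if k = ?k then 1 else 0)"
      using True pick_eq_iff[OF km, of] k by (intro sum.cong) auto
    also have "\<dots> = 1" using km by simp
    finally show ?thesis using True by auto
  next
    case False
    then show ?thesis using pick_mem by (intro sum.neutral trans[OF sum.neutral]) auto
  qed
  finally show "((select n S)\<^sup>T * select n S) $$ (a, b) = ?M $$ (a, b)" using ab by simp
qed (auto simp: select_def)

lemma gr_index_card:
  assumes "I \<in> gr_index r n"
  shows "card {i. i < n \<and> i \<in> I} = r" "card {i. i < n \<and> i \<in> - I} = n - r" "r \<le> n"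
proof -
  have I: "I \<subseteq> {0..<n}" "card I = r" "finite I"
    using assms finite_subset unfolding gr_index_def by auto
  have "{i. i < n \<and> i \<in> I} = I" using I by auto
  then show "card {i. i < n \<and> i \<in> I} = r" using I by simp
  have "{i. i < n \<and> i \<in> - I} = {0..<n} - I" by auto
  then show "card {i. i < n \<and> i \<in> - I} = n - r" using I by (simp add: card_Diff_subset)
  show "r \<le> n" using I card_mono[of "{0..<n}" I] by simp
qed

lemma select_complementary:
  assumes I: "I \<in> gr_index r n"
  defines "R \<equiv> select n I :: 'k::field mat" and "Q \<equiv> select n (- I)"
  shows "R \<in> carrier_mat r n" "Q \<in> carrier_mat (n - r) n"
    "R * R\<^sup>T = 1\<^sub>m r" "Q * Q\<^sup>T = 1\<^sub>m (n - r)" "R * Q\<^sup>T = 0\<^sub>m r (n - r)" "Q * R\<^sup>T = 0\<^sub>m (n - r) r"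
    "R\<^sup>T * R + Q\<^sup>T * Q = 1\<^sub>m n"
proof -
  note card = gr_index_card[OF I]
  show "R \<in> carrier_mat r n" "Q \<in> carrier_mat (n - r) n"
    using card by (simp_all add: R_def Q_def select_def carrier_matI)
  note eqI = pick_eq_iff[of _ n I, unfolded card] pick_eq_iff[of _ n "- I", unfolded card]
  note memI = pick_mem[of _ n I, unfolded card] pick_mem[of _ n "- I", unfolded card]
  show "R * R\<^sup>T = 1\<^sub>m r" "Q * Q\<^sup>T = 1\<^sub>m (n - r)"
    unfolding R_def Q_def select_mult_select_transpose card
    by (rule eq_matI; simp add: eqI)+
  show "R * Q\<^sup>T = 0\<^sub>m r (n - r)" "Q * R\<^sup>T = 0\<^sub>m (n - r) r"
    unfolding R_def Q_def select_mult_select_transpose card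
    using memI by (auto intro!: eq_matI) (metis ComplD)+
  show "R\<^sup>T * R + Q\<^sup>T * Q = 1\<^sub>m n"
    unfolding R_def Q_def select_transpose_mult_select by (rule eq_matI) auto
qed

text \<open>A left inverse makes the columns linearly independent.\<close>

lemma image_in_grassmannian:
  fixes A :: "'k::field mat"
  assumes A: "A \<in> carrier_mat n m" and R: "R \<in> carrier_mat m n" and RA: "R * A = 1\<^sub>m m"
  shows "mat_image A m \<in> grassmannian m n"
proof -
  interpret vec_space "TYPE('k)" n .
  have inj: "v = 0\<^sub>v m" if "v \<in> carrier_vec m" "A *\<^sub>v v = 0\<^sub>v n" for v
  proof -
    have "v = R *\<^sub>v (A *\<^sub>v v)" using assoc_mult_mat_vec[OF R A that(1)] RA that(1) by simp
    then show ?thesis using that(2) by (simp add: mult_mat_zero_vec[OF R])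
  qed
  have dist: "distinct (cols A)"
    unfolding distinct_conv_nth
  proof (intro allI impI)
    fix i j assume "i < length (cols A)" "j < length (cols A)" "i \<noteq> j"
    then have ij: "i < m" "j < m" "i \<noteq> j" using A by auto
    have "R *\<^sub>v col A i = unit_vec m i" "R *\<^sub>v col A j = unit_vec m j"
      using col_mult2[OF R A] ij RA by (metis col_one)+
    then have "col A i \<noteq> col A j" using ij by (metis index_unit_vec(1,2) zero_neq_one)
    then show "cols A ! i \<noteq> cols A ! j" using ij A by simp
  qed
  have S: "set (cols A) \<subseteq> carrier_vec n" using cols_dim A by blast
  have "lin_indpt (set (cols A))"
  proof
    assume "lin_dep (set (cols A))"
    then obtain v where "v \<in> carrier_vec m" "v \<noteq> 0\<^sub>v m" "A *\<^sub>v v = 0\<^sub>v n"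
      using lin_depE[OF A _ dist] by blast
    then show False using inj by blast
  qed
  then have "rank A = card (set (cols A))"
    by (intro rank_card_indpt[OF A]) (auto simp: maximal_def)
  also have "\<dots> = m" using distinct_card[OF dist] A by simp
  finally have "rank A = m" .
  moreover have "span (set (cols A)) = mat_image A m"
    using col_space_eq[OF A] A unfolding col_space_def by auto
  moreover have "subspace class_ring (span (set (cols A))) V"
    using span_is_subspace S by simp
  ultimately show ?thesis unfolding grassmannian_def rank_def by simp
qed

lemma grassmannianD:
  fixes V :: "'k::field vec set"
  assumes "V \<in> grassmannian r n"
  shows "V \<subseteq> carrier_vec n"
    "A \<in> carrier_mat n m \<Longrightarrow> (\<And>j. j < m \<Longrightarrow> col A j \<in> V) \<Longrightarrow> c \<in> carrier_vec m \<Longrightarrow> A *\<^sub>v c \<in> V"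
    "u \<in> V \<Longrightarrow> v \<in> V \<Longrightarrow> u + v \<in> V" "v \<in> V \<Longrightarrow> a \<cdot>\<^sub>v v \<in> V"
proof -
  interpret vec_space "TYPE('k)" n .
  have sub: "submodule class_ring V (module_vec TYPE('k) n)"
    using assms unfolding grassmannian_def VectorSpace.subspace_def by blast
  show "V \<subseteq> carrier_vec n" using submodule.subset[OF sub] by simp
  show "u + v \<in> V" if "u \<in> V" "v \<in> V" using submodule.m_closed[OF sub that] by simp
  show "a \<cdot>\<^sub>v v \<in> V" if "v \<in> V" using submodule.smult_closed[OF sub _ that, of a] by simp
  assume A: "A \<in> carrier_mat n m" "\<And>j. j < m \<Longrightarrow> col A j \<in> V" "c \<in> carrier_vec m"
  have "set (cols A) \<subseteq> V" using A by (auto simp: cols_def)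
  then have "span (set (cols A)) \<subseteq> V" using sub by (rule span_is_subset)
  moreover have "A *\<^sub>v c \<in> col_space A" unfolding col_space_eq[OF A(1)] using A by auto
  ultimately show "A *\<^sub>v c \<in> V" unfolding col_space_def by blast
qed

lemma grassmannian_dim_unique:
  "V \<in> grassmannian r n \<Longrightarrow> V \<in> grassmannian s n \<Longrightarrow> r = s"
  unfolding grassmannian_def by auto

text \<open>Let \<open>I\<close> be a minimal set of coordinates on which no non-zero vector of \<open>V\<close> vanishes. By
  minimality \<open>V\<close> contains, for each \<open>i \<in> I\<close>, a vector whose coordinates in \<open>I\<close> are those of the
  \<open>i\<close>-th unit vector, and these vectors form a frame.\<close>

lemma gr_charts_cover:
  fixes V :: "'k::field vec set"
  assumes V: "V \<in> grassmannian r n"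
  shows "\<exists>I\<in>gr_index r n. V \<in> gr_chart r n I"
proof -
  note V' = grassmannianD[OF V]
  define P where "P I \<longleftrightarrow> I \<subseteq> {0..<n} \<and> (\<forall>v\<in>V. (\<forall>i\<in>I. v $ i = 0) \<longrightarrow> v = 0\<^sub>v n)" for I
  have "P {0..<n}" unfolding P_def using V'(1) by (auto intro!: eq_vecI)
  then obtain I where I: "P I" and min: "\<And>J. P J \<Longrightarrow> card I \<le> card J"
    using ex_has_least_nat[of P _ card] by blast
  have In: "I \<subseteq> {0..<n}" and Iv: "\<And>v. v \<in> V \<Longrightarrow> (\<And>i. i \<in> I \<Longrightarrow> v $ i = 0) \<Longrightarrow> v = 0\<^sub>v n"
    using I unfolding P_def by blast+
  have fin: "finite I" using In finite_subset by blast
  have "\<forall>i\<in>I. \<exists>v\<in>V. v $ i = 1 \<and> (\<forall>j\<in>I - {i}. v $ j = 0)"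
  proof
    fix i assume i: "i \<in> I"
    have "card (I - {i}) < card I" using i fin by (rule card_Diff1_less[rotated])
    then have "\<not> P (I - {i})" using min[of "I - {i}"] by linarith
    then obtain v where v: "v \<in> V" "\<And>j. j \<in> I - {i} \<Longrightarrow> v $ j = 0" "v \<noteq> 0\<^sub>v n"
      using In unfolding P_def by blast
    have vi: "v $ i \<noteq> 0" using Iv[OF v(1)] v(2,3) by blast
    have vn: "v \<in> carrier_vec n" using v V'(1) by blast
    let ?u = "(1 / v $ i) \<cdot>\<^sub>v v"
    have "?u \<in> V" using V'(4) v(1) by blast
    moreover have "?u $ i = 1" using vi i In vn by auto
    moreover have "?u $ j = 0" if "j \<in> I - {i}" for j using v(2)[OF that] that In vn by auto
    ultimately show "\<exists>v\<in>V. v $ i = 1 \<and> (\<forall>j\<in>I - {i}. v $ j = 0)" by blast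
  qed
  then obtain b where b: "\<And>i. i \<in> I \<Longrightarrow> b i \<in> V" "\<And>i. i \<in> I \<Longrightarrow> b i $ i = 1"
    "\<And>i j. i \<in> I \<Longrightarrow> j \<in> I \<Longrightarrow> i \<noteq> j \<Longrightarrow> b i $ j = 0"
    by (metis Diff_iff singletonD)
  define m where "m = card I"
  have Im: "I \<in> gr_index m n" unfolding gr_index_def m_def using In by simp
  note card = gr_index_card[OF Im] and sel = select_complementary[OF Im, where 'k = 'k]
  have mem: "pick I j \<in> I" if "j < m" for j using pick_mem[of j n I] that card by simp
  define A where "A = mat n m (\<lambda>(i, j). b (pick I j) $ i)"
  have A: "A \<in> carrier_mat n m" by (simp add: A_def)
  have colA: "col A j \<in> V" if j: "j < m" for j
  proof -
    have "b (pick I j) \<in> carrier_vec n" using b(1)[OF mem[OF j]] V'(1) by blast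
    then have "col A j = b (pick I j)" using j by (intro eq_vecI) (auto simp: A_def)
    then show ?thesis using b(1)[OF mem[OF j]] by simp
  qed
  have RA: "select n I * A = 1\<^sub>m m"
  proof -
    have "submatrix A I UNIV = 1\<^sub>m m"
    proof (rule eq_matI)
      fix i j assume "i < dim_row (1\<^sub>m m :: 'k mat)" "j < dim_col (1\<^sub>m m :: 'k mat)"
      then have ij: "i < m" "j < m" by auto
      have "pick I i < n" using pick_le[of i n I] ij card by simp
      then have "submatrix A I UNIV $$ (i, j) = b (pick I j) $ pick I i"
        using ij card A by (subst submatrix_index) (auto simp: A_def pick_UNIV)
      then show "submatrix A I UNIV $$ (i, j) = 1\<^sub>m m $$ (i, j)"
        using ij b(2)[OF mem] b(3)[OF mem mem] pick_eq_iff[of j n I i] card by (cases "i = j") auto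
    qed (use A card in \<open>auto simp: dim_submatrix\<close>)
    then show ?thesis using select_mult[OF A] by simp
  qed
  have VA: "V = mat_image A m"
  proof
    show "mat_image A m \<subseteq> V" using V'(2)[OF A colA] by blast
    show "V \<subseteq> mat_image A m"
    proof
      fix v assume v: "v \<in> V"
      then have vn: "v \<in> carrier_vec n" using V'(1) by blast
      let ?u = "select n I *\<^sub>v v"
      have u: "?u \<in> carrier_vec m" using sel(1) vn by simp
      let ?w = "A *\<^sub>v ?u + (- 1) \<cdot>\<^sub>v v"
      have wV: "?w \<in> V" using V'(2)[OF A colA u] V'(3,4) v by blast
      have RAu: "select n I *\<^sub>v (A *\<^sub>v ?u) = ?u"
        using assoc_mult_mat_vec[OF sel(1) A u] RA u by simp
      have "?w = 0\<^sub>v n"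
      proof (rule Iv[OF wV])
        fix i assume i: "i \<in> I"
        let ?k = "Finite_Set.card {a \<in> I. a < i}"
        have k: "pick I ?k = i" using pick_card_in_set i by blast
        have "{a \<in> I. a < i} \<subset> I" using i by auto
        then have km: "?k < m" unfolding m_def using fin by (rule psubset_card_mono[rotated])
        have "(A *\<^sub>v ?u) $ i = (select n I *\<^sub>v (A *\<^sub>v ?u)) $ ?k"
          using select_mult_vec[of "A *\<^sub>v ?u" n ?k I] km card k A u by simp
        also have "\<dots> = v $ i" unfolding RAu using select_mult_vec[OF vn, of ?k I] km card k by simp
        finally show "?w $ i = 0" using i In vn A by auto
      qed
      then have "A *\<^sub>v ?u = v"
        using A vn by (auto simp: vec_eq_iff add_eq_0_iff)
      then show "v \<in> mat_image A m" using u by (metis image_eqI)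
    qed
  qed
  have "V \<in> grassmannian m n" unfolding VA by (rule image_in_grassmannian[OF A sel(1) RA])
  then have mr: "m = r" using grassmannian_dim_unique V by blast
  then have "is_frame r n I V A"
    unfolding is_frame_def using A RA VA select_mult[OF A] by simp
  then have "V \<in> gr_chart r n I" unfolding gr_chart_def using V by blast
  then show ?thesis using Im mr by blast
qed


section \<open>Transition matrices of the universal bundles\<close>

lemma zero_mat_mult_vec: "u \<in> carrier_vec n \<Longrightarrow> 0\<^sub>m m n *\<^sub>v u = (0\<^sub>v m :: 'k::field vec)"
  by (intro eq_vecI) auto

lemma is_frame_iff:
  fixes A :: "'k::field mat"
  shows "is_frame r n I V A \<longleftrightarrow> A \<in> carrier_mat n r \<and> select n I * A = 1\<^sub>m r \<and>
     V = mat_image A r"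
  unfolding is_frame_def using select_mult by metis

lemma is_frame_unique:
  fixes A B :: "'k::field mat"
  assumes I: "I \<in> gr_index r n" and A: "is_frame r n I V A" and B: "is_frame r n I V B"
  shows "A = B"
proof -
  note A = A[unfolded is_frame_iff] and B = B[unfolded is_frame_iff]
  have "col B j \<in> mat_image A r" if j: "j < r" for j
  proof -
    have "col B j = B *\<^sub>v unit_vec r j" using B j by (intro eq_vecI) auto
    also have "\<dots> \<in> V" using B by auto
    finally show ?thesis using A by simp
  qed
  then have "A * (select n I * B) = B"
    using A B by (intro cols_in_image[OF _ select_complementary(1)[OF I]]) auto
  then show ?thesis using A B by (metis right_mult_one_mat)
qed

text \<open>Here \<open>R\<close> and \<open>Q\<close> are the projections to the coordinates inside and outside \<open>I\<close>. The identity
  \<open>F * R + Q\<^sup>T * C = 1\<close> decomposes a vector into its components in \<open>V\<close> and in the span of the unit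
  vectors outside \<open>I\<close>; it identifies \<open>C\<close>, and all computations with transition matrices rest on it.\<close>

lemma chart_frame:
  fixes V :: "'k::field vec set"
  assumes I: "I \<in> gr_index r n" and V: "V \<in> gr_chart r n I"
  defines "F \<equiv> frame r n I V" and "R \<equiv> select n I :: 'k mat"
    and "Q \<equiv> select n (- I) :: 'k mat" and "C \<equiv> coframe r n I V"
  shows "F \<in> carrier_mat n r" "R * F = 1\<^sub>m r" "V = mat_image F r"
    "C \<in> carrier_mat (n - r) n" "C = Q - Q * F * R" "C * Q\<^sup>T = 1\<^sub>m (n - r)"
    "C * F = 0\<^sub>m (n - r) r" "F * R + Q\<^sup>T * C = 1\<^sub>m n"
    "gr_coords r n I V = Q * F" "F = R\<^sup>T + Q\<^sup>T * (Q * F)"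
proof -
  note sel = select_complementary[OF I, where 'k = 'k, folded R_def Q_def]
  have Rt: "R\<^sup>T \<in> carrier_mat n r" "Q\<^sup>T \<in> carrier_mat n (n - r)" using sel by auto
  obtain A where A: "is_frame r n I V A" using V unfolding gr_chart_def by blast
  then have "is_frame r n I V F"
    unfolding F_def frame_def by (rule theI) (rule is_frame_unique[OF I _ A])
  then show F: "F \<in> carrier_mat n r" "R * F = 1\<^sub>m r" "V = mat_image F r"
    unfolding is_frame_iff R_def by auto
  have QF: "Q * F \<in> carrier_mat (n - r) r" using sel F by simp
  have QFR: "Q * F * R \<in> carrier_mat (n - r) n" using QF sel by simp
  show "gr_coords r n I V = Q * F"
    unfolding gr_coords_def Q_def F_def[symmetric] using select_mult[OF F(1)] by simp
  have "F = (R\<^sup>T * R + Q\<^sup>T * Q) * F" using sel(7) F by simp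
  also have "\<dots> = R\<^sup>T * R * F + Q\<^sup>T * Q * F"
    using sel(1,2) F by (intro add_mult_distrib_mat[of _ n n]) auto
  also have "R\<^sup>T * R * F = R\<^sup>T" using sel(1) F by (simp add: assoc_mult_mat[of _ n r _ n _ r])
  also have "Q\<^sup>T * Q * F = Q\<^sup>T * (Q * F)"
    using sel(2) F by (simp add: assoc_mult_mat[of _ n "n - r" _ n _ r])
  finally show FE: "F = R\<^sup>T + Q\<^sup>T * (Q * F)" .
  define D where "D = Q - Q * F * R"
  have D: "D \<in> carrier_mat (n - r) n" unfolding D_def using QFR by (rule minus_carrier_mat)
  have "D * Q\<^sup>T = Q * Q\<^sup>T - Q * F * R * Q\<^sup>T"
    unfolding D_def by (rule minus_mult_distrib_mat[OF sel(2) QFR Rt(2)])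
  also have "Q * F * R * Q\<^sup>T = Q * F * (R * Q\<^sup>T)" by (rule assoc_mult_mat[OF QF sel(1) Rt(2)])
  also have "\<dots> = 0\<^sub>m (n - r) (n - r)" unfolding sel(5) by (rule right_mult_zero_mat[OF QF])
  also have "Q * Q\<^sup>T - 0\<^sub>m (n - r) (n - r) = 1\<^sub>m (n - r)"
    unfolding sel(4) by (rule eq_matI) auto
  finally have DQ: "D * Q\<^sup>T = 1\<^sub>m (n - r)" .
  have "D * F = Q * F - Q * F * R * F"
    unfolding D_def by (rule minus_mult_distrib_mat[OF sel(2) QFR F(1)])
  also have "Q * F * R * F = Q * F * (R * F)" by (rule assoc_mult_mat[OF QF sel(1) F(1)])
  finally have DF: "D * F = 0\<^sub>m (n - r) r" using F QF by simp
  have sum: "F * R + Q\<^sup>T * D = 1\<^sub>m n"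
  proof -
    have "Q\<^sup>T * D = Q\<^sup>T * Q - Q\<^sup>T * (Q * F * R)"
      unfolding D_def by (rule mult_minus_distrib_mat[OF Rt(2) sel(2) QFR])
    moreover have "F * R = R\<^sup>T * R + Q\<^sup>T * (Q * F * R)"
    proof -
      have "F * R = (R\<^sup>T + Q\<^sup>T * (Q * F)) * R" using FE by simp
      also have "\<dots> = R\<^sup>T * R + Q\<^sup>T * (Q * F) * R"
        using Rt QF sel(1) by (intro add_mult_distrib_mat[of _ n r]) auto
      also have "Q\<^sup>T * (Q * F) * R = Q\<^sup>T * (Q * F * R)" by (rule assoc_mult_mat[OF Rt(2) QF sel(1)])
      finally show ?thesis .
    qed
    ultimately have "F * R + Q\<^sup>T * D =
        (R\<^sup>T * R + Q\<^sup>T * (Q * F * R)) + (Q\<^sup>T * Q - Q\<^sup>T * (Q * F * R))" by simp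
    also have "\<dots> = R\<^sup>T * R + Q\<^sup>T * Q"
      using Rt sel(1,2) QFR by (intro eq_matI) auto
    finally show ?thesis using sel(7) by simp
  qed
  have ker: "mat_kernel D = V"
  proof
    show "V \<subseteq> mat_kernel D"
    proof
      fix v assume "v \<in> V"
      then obtain u where u: "u \<in> carrier_vec r" "v = F *\<^sub>v u" using F(3) by blast
      have "D *\<^sub>v v = 0\<^sub>v (n - r)"
        unfolding u(2) using assoc_mult_mat_vec[OF D F(1) u(1)] DF zero_mat_mult_vec[OF u(1)] by simp
      then show "v \<in> mat_kernel D" using mat_kernelI[OF D] u F(1) by simp
    qed
    show "mat_kernel D \<subseteq> V"
    proof
      fix v assume "v \<in> mat_kernel D"
      then have v: "v \<in> carrier_vec n" "D *\<^sub>v v = 0\<^sub>v (n - r)" using mat_kernelD[OF D] by auto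
      have "v = (F * R + Q\<^sup>T * D) *\<^sub>v v" using sum v by simp
      also have "\<dots> = F * R *\<^sub>v v + Q\<^sup>T * D *\<^sub>v v"
        using F sel Rt D v by (intro add_mult_distrib_mat_vec[of _ n n]) auto
      also have "Q\<^sup>T * D *\<^sub>v v = 0\<^sub>v n"
        using assoc_mult_mat_vec[OF Rt(2) D v(1)] v(2) by (simp add: mult_mat_zero_vec[OF Rt(2)])
      also have "F * R *\<^sub>v v = F *\<^sub>v (R *\<^sub>v v)" by (rule assoc_mult_mat_vec[OF F(1) sel(1) v(1)])
      finally have "v = F *\<^sub>v (R *\<^sub>v v)" using F sel v by simp
      moreover have "R *\<^sub>v v \<in> carrier_vec r" using sel v by simp
      ultimately show "v \<in> V" unfolding F(3) by blast
    qed
  qed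
  have "C = D"
    unfolding C_def coframe_def Q_def[symmetric]
  proof (rule the_equality)
    show "D \<in> carrier_mat (n - r) n \<and> submatrix D UNIV (- I) = 1\<^sub>m (n - r) \<and> mat_kernel D = V"
      using D ker DQ mult_select_transpose[OF D, of "- I"] by (simp add: Q_def)
    fix B :: "'k mat"
    assume B: "B \<in> carrier_mat (n - r) n \<and> submatrix B UNIV (- I) = 1\<^sub>m (n - r) \<and> mat_kernel B = V"
    then have Bc: "B \<in> carrier_mat (n - r) n" by simp
    have BQ: "B * Q\<^sup>T = 1\<^sub>m (n - r)" using B mult_select_transpose[OF Bc, of "- I"] by (simp add: Q_def)
    have BF: "B * F = 0\<^sub>m (n - r) r"
    proof (rule mat_col_eqI)
      fix j assume "j < dim_col (0\<^sub>m (n - r) r :: 'k mat)"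
      then have j: "j < r" by simp
      have "col F j = F *\<^sub>v unit_vec r j" using F j by (intro eq_vecI) auto
      then have "col F j \<in> mat_kernel B" using B F(3) by auto
      then show "col (B * F) j = col (0\<^sub>m (n - r) r) j"
        using mat_kernelD(2)[OF Bc] col_mult2[OF Bc F(1) j] j by simp
    qed (use Bc F in auto)
    have "B = B * (F * R + Q\<^sup>T * D)" using sum Bc by simp
    also have "\<dots> = B * (F * R) + B * (Q\<^sup>T * D)"
      using Bc F sel D by (intro mult_add_distrib_mat[of _ "n - r" n _ n]) auto
    also have "B * (F * R) = B * F * R" by (rule assoc_mult_mat[OF Bc F(1) sel(1), symmetric])
    also have "B * (Q\<^sup>T * D) = B * Q\<^sup>T * D" by (rule assoc_mult_mat[OF Bc Rt(2) D, symmetric])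
    finally show "B = D" unfolding BF BQ using sel(1) D by simp
  qed
  then show "C = Q - Q * F * R" "C \<in> carrier_mat (n - r) n" "C * Q\<^sup>T = 1\<^sub>m (n - r)"
    "C * F = 0\<^sub>m (n - r) r" "F * R + Q\<^sup>T * C = 1\<^sub>m n"
    using D_def D DQ DF sum by simp_all
qed

lemma chart_change:
  fixes V :: "'k::field vec set"
  assumes I: "I \<in> gr_index r n" "V \<in> gr_chart r n I" and J: "J \<in> gr_index r n" "V \<in> gr_chart r n J"
  shows "frame r n I V * (select n I * frame r n J V) = frame r n J V"
    and "coframe r n I V * frame r n J V = 0\<^sub>m (n - r) r"
    and "coframe r n I V * (select n (- J))\<^sup>T * coframe r n J V = coframe r n I V"
proof -
  note FI = chart_frame[OF I] and FJ = chart_frame[OF J]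
  note selI = select_complementary[OF I(1), where 'k = 'k]
    and selJ = select_complementary[OF J(1), where 'k = 'k]
  have "col (frame r n J V) j \<in> mat_image (frame r n I V) r" if j: "j < r" for j
  proof -
    have "col (frame r n J V) j = frame r n J V *\<^sub>v unit_vec r j"
      using FJ(1) j by (intro eq_vecI) auto
    also have "\<dots> \<in> V" using FJ(3) by auto
    finally show ?thesis using FI(3) by simp
  qed
  then show 1: "frame r n I V * (select n I * frame r n J V) = frame r n J V"
    using FI FJ by (intro cols_in_image[OF FI(1) selI(1)]) auto
  have "coframe r n I V * frame r n J V =
      coframe r n I V * frame r n I V * (select n I * frame r n J V)"
    using assoc_mult_mat[OF FI(4) FI(1) mult_carrier_mat[OF selI(1) FJ(1)]] 1 by simp
  then show 2: "coframe r n I V * frame r n J V = 0\<^sub>m (n - r) r"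
    unfolding FI(7) by (simp add: left_mult_zero_mat[OF mult_carrier_mat[OF selI(1) FJ(1)]])
  have Qt: "(select n (- J) :: 'k mat)\<^sup>T \<in> carrier_mat n (n - r)" using selJ by simp
  have "coframe r n I V = coframe r n I V * (frame r n J V * select n J +
      (select n (- J))\<^sup>T * coframe r n J V)" using FJ(8) FI(4) by simp
  also have "\<dots> = coframe r n I V * (frame r n J V * select n J) +
      coframe r n I V * ((select n (- J))\<^sup>T * coframe r n J V)"
    using FI(4) FJ(1,4) selJ(1) Qt by (intro mult_add_distrib_mat[of _ "n - r" n _ n]) auto
  also have "coframe r n I V * (frame r n J V * select n J) =
      coframe r n I V * frame r n J V * select n J"
    by (rule assoc_mult_mat[OF FI(4) FJ(1) selJ(1), symmetric])
  also have "coframe r n I V * ((select n (- J))\<^sup>T * coframe r n J V) =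
      coframe r n I V * (select n (- J))\<^sup>T * coframe r n J V"
    by (rule assoc_mult_mat[OF FI(4) Qt FJ(4), symmetric])
  finally show "coframe r n I V * (select n (- J))\<^sup>T * coframe r n J V = coframe r n I V"
    unfolding 2 using selJ(1) FI(4) FJ(4) Qt by simp
qed

lemma transition_universal_sub:
  fixes V :: "'k::field vec set"
  assumes I: "I \<in> gr_index r n" "V \<in> gr_chart r n I" and J: "J \<in> gr_index r n" "V \<in> gr_chart r n J"
  shows "transition (universal_sub r n) I J V = select n I * frame r n J V"
proof -
  note FI = chart_frame[OF I] and FJ = chart_frame[OF J]
  note selI = select_complementary[OF I(1), where 'k = 'k]
  show ?thesis
    unfolding universal_sub_def vbundle.select_convs
  proof (rule the_equality)
    show "select n I * frame r n J V \<in> carrier_mat r r \<and>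
      frame r n J V = frame r n I V * (select n I * frame r n J V)"
      using chart_change(1)[OF I J] selI(1) FJ(1) by simp
    fix g assume g: "g \<in> carrier_mat r r \<and> frame r n J V = frame r n I V * g"
    then have "select n I * frame r n J V = select n I * frame r n I V * g"
      using assoc_mult_mat[OF selI(1) FI(1), of g r] by simp
    then show "g = select n I * frame r n J V" using FI(2) g by (metis left_mult_one_mat)
  qed
qed

lemma transition_universal_quot:
  fixes V :: "'k::field vec set"
  assumes I: "I \<in> gr_index r n" "V \<in> gr_chart r n I" and J: "J \<in> gr_index r n" "V \<in> gr_chart r n J"
  shows "transition (universal_quot r n) I J V = coframe r n I V * (select n (- J))\<^sup>T"
proof -
  note FI = chart_frame[OF I] and FJ = chart_frame[OF J]
  note selJ = select_complementary[OF J(1), where 'k = 'k]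
  have Qt: "(select n (- J) :: 'k mat)\<^sup>T \<in> carrier_mat n (n - r)" using selJ by simp
  show ?thesis
    unfolding universal_quot_def vbundle.select_convs
  proof (rule the_equality)
    show "coframe r n I V * (select n (- J))\<^sup>T \<in> carrier_mat (n - r) (n - r) \<and>
      coframe r n I V = coframe r n I V * (select n (- J))\<^sup>T * coframe r n J V"
      using chart_change(3)[OF I J] FI(4) Qt by simp
    fix h assume h: "h \<in> carrier_mat (n - r) (n - r) \<and> coframe r n I V = h * coframe r n J V"
    then have "coframe r n I V * (select n (- J))\<^sup>T =
        h * (coframe r n J V * (select n (- J))\<^sup>T)"
      using assoc_mult_mat[OF _ FJ(4) Qt, of h "n - r"] by simp
    then show "h = coframe r n I V * (select n (- J))\<^sup>T"
      using FJ(6) h by (metis right_mult_one_mat)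
  qed
qed

text \<open>The cocycle condition of the universal sub-bundle for \<open>J\<close>, \<open>I\<close>, \<open>J\<close>.\<close>

lemma frame_change_inverse:
  fixes V :: "'k::field vec set"
  assumes I: "I \<in> gr_index r n" "V \<in> gr_chart r n I" and J: "J \<in> gr_index r n" "V \<in> gr_chart r n J"
  shows "(select n J * frame r n I V) * (select n I * frame r n J V) = 1\<^sub>m r"
proof -
  note FI = chart_frame[OF I] and FJ = chart_frame[OF J]
  note selI = select_complementary[OF I(1), where 'k = 'k]
    and selJ = select_complementary[OF J(1), where 'k = 'k]
  show ?thesis
    using assoc_mult_mat[OF selJ(1) FI(1) mult_carrier_mat[OF selI(1) FJ(1)]]
      chart_change(1)[OF I J] FJ(2) by simp
qed

text \<open>The rows of \<open>R\<close> and \<open>C\<close> together form the basis of \<open>K\<^sup>n\<close> dual to the columns of \<open>F\<close> and \<open>Q\<^sup>T\<close>.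
  Passing from \<open>J\<close> to \<open>I\<close> gives a block triangular matrix whose diagonal blocks are transition
  matrices of the universal bundles, while varying the subspace inside one chart gives a unipotent
  matrix. Hence the two universal bundles have, up to constants, inverse determinants.\<close>

definition stack_rows :: "'k::field mat \<Rightarrow> 'k mat \<Rightarrow> 'k mat" where
  "stack_rows A B = four_block_mat A (0\<^sub>m (dim_row A) 0) B (0\<^sub>m (dim_row B) 0)"

definition join_cols :: "'k::field mat \<Rightarrow> 'k mat \<Rightarrow> 'k mat" where
  "join_cols A B = four_block_mat A B (0\<^sub>m 0 (dim_col A)) (0\<^sub>m 0 (dim_col B))"

lemma stack_rows_carrier:
  "A \<in> carrier_mat m n \<Longrightarrow> B \<in> carrier_mat l n \<Longrightarrow> stack_rows A B \<in> carrier_mat (m + l) n"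
  by (auto simp: stack_rows_def)

lemma join_cols_carrier:
  "A \<in> carrier_mat n m \<Longrightarrow> B \<in> carrier_mat n l \<Longrightarrow> join_cols A B \<in> carrier_mat n (m + l)"
  by (auto simp: join_cols_def)

lemma stack_rows_mult_join_cols:
  assumes "A \<in> carrier_mat m n" "B \<in> carrier_mat l n" "C \<in> carrier_mat n m'" "D \<in> carrier_mat n l'"
  shows "stack_rows A B * join_cols C D = four_block_mat (A * C) (A * D) (B * C) (B * D)"
proof -
  have "stack_rows A B * join_cols C D =
      four_block_mat (A * C + 0\<^sub>m m 0 * 0\<^sub>m 0 m') (A * D + 0\<^sub>m m 0 * 0\<^sub>m 0 l')
        (B * C + 0\<^sub>m l 0 * 0\<^sub>m 0 m') (B * D + 0\<^sub>m l 0 * 0\<^sub>m 0 l')"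
    unfolding stack_rows_def join_cols_def using assms
    by (subst mult_four_block_mat[of _ m n _ 0 _ l _ _ m' _ l']) auto
  then show ?thesis using assms by simp
qed

text \<open>The determinant of a permutation matrix, hence a sign.\<close>

definition chart_sign :: "nat \<Rightarrow> nat set \<Rightarrow> 'k::field" where
  "chart_sign n I = det (join_cols (select n I)\<^sup>T (select n (- I))\<^sup>T)"

lemma det_stack_rows_chart:
  fixes V :: "'k::field vec set"
  assumes I: "I \<in> gr_index r n" "V \<in> gr_chart r n I"
  shows "det (stack_rows (select n I) (coframe r n I V)) * chart_sign n I = 1"
proof -
  note FI = chart_frame[OF I] and sel = select_complementary[OF I(1), where 'k = 'k]
  note n = gr_index_card(3)[OF I(1)]
  have Rt: "(select n I :: 'k mat)\<^sup>T \<in> carrier_mat n r"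
    "(select n (- I) :: 'k mat)\<^sup>T \<in> carrier_mat n (n - r)" using sel by auto
  have "stack_rows (select n I) (coframe r n I V) * join_cols (select n I)\<^sup>T (select n (- I))\<^sup>T =
      four_block_mat (1\<^sub>m r) (0\<^sub>m r (n - r)) (coframe r n I V * (select n I)\<^sup>T) (1\<^sub>m (n - r))"
    using stack_rows_mult_join_cols[OF sel(1) FI(4) Rt] sel FI by simp
  moreover have "det (four_block_mat (1\<^sub>m r) (0\<^sub>m r (n - r)) (coframe r n I V * (select n I)\<^sup>T) (1\<^sub>m (n - r))) = 1"
    using FI(4) Rt by (subst det_four_block_mat_upper_right_zero[of _ r _ "n - r"]) auto
  ultimately show ?thesis
    using det_mult[of "stack_rows (select n I) (coframe r n I V)" n
        "join_cols (select n I)\<^sup>T (select n (- I))\<^sup>T"]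
      stack_rows_carrier[OF sel(1) FI(4)] join_cols_carrier[OF Rt] n
    by (simp add: chart_sign_def)
qed

lemma det_transitions:
  fixes V :: "'k::field vec set"
  assumes I: "I \<in> gr_index r n" "V \<in> gr_chart r n I" and J: "J \<in> gr_index r n" "V \<in> gr_chart r n J"
  shows "det (coframe r n I V * (select n (- J))\<^sup>T) =
    chart_sign n J / chart_sign n I * det (select n J * frame r n I V)"
proof -
  note FI = chart_frame[OF I] and FJ = chart_frame[OF J]
  note selI = select_complementary[OF I(1), where 'k = 'k]
    and selJ = select_complementary[OF J(1), where 'k = 'k]
  note n = gr_index_card(3)[OF I(1)]
  let ?S = "\<lambda>I. stack_rows (select n I) (coframe r n I V)"
  let ?G = "join_cols (frame r n J V) (select n (- J))\<^sup>T"
  have Qt: "(select n (- J) :: 'k mat)\<^sup>T \<in> carrier_mat n (n - r)" using selJ by auto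
  have S: "?S I \<in> carrier_mat n n" "?S J \<in> carrier_mat n n"
    using stack_rows_carrier[OF selI(1) FI(4)] stack_rows_carrier[OF selJ(1) FJ(4)] n by simp_all
  have G: "?G \<in> carrier_mat n n" using join_cols_carrier[OF FJ(1) Qt] n by simp
  have "?S J * ?G = four_block_mat (1\<^sub>m r) (0\<^sub>m r (n - r)) (0\<^sub>m (n - r) r) (1\<^sub>m (n - r))"
    using stack_rows_mult_join_cols[OF selJ(1) FJ(4) FJ(1) Qt] selJ FJ by simp
  also have "\<dots> = 1\<^sub>m n" using n by (intro eq_matI) auto
  finally have SG: "det (?S J) * det ?G = 1" using det_mult[OF S(2) G] by simp
  have "?S I * ?G = four_block_mat (select n I * frame r n J V) (select n I * (select n (- J))\<^sup>T)
      (0\<^sub>m (n - r) r) (coframe r n I V * (select n (- J))\<^sup>T)"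
    using stack_rows_mult_join_cols[OF selI(1) FI(4) FJ(1) Qt] chart_change(2)[OF I J] by simp
  also have "det \<dots> = det (select n I * frame r n J V) * det (coframe r n I V * (select n (- J))\<^sup>T)"
    using selI(1) FJ(1) FI(4) Qt
    by (intro det_four_block_mat_lower_left_zero[of _ r _ "n - r"]) auto
  finally have block: "det (?S I) * det ?G =
      det (select n I * frame r n J V) * det (coframe r n I V * (select n (- J))\<^sup>T)"
    using det_mult[OF S(1) G] by simp
  have "det (select n J * frame r n I V) * det (select n I * frame r n J V) = 1"
    using det_mult[of "select n J * frame r n I V" r "select n I * frame r n J V"]
      frame_change_inverse[OF I J] selI(1) selJ(1) FI(1) FJ(1) by simp
  moreover have "det (?S I) * chart_sign n I = 1" "det (?S J) * chart_sign n J = 1"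
    using det_stack_rows_chart[OF I] det_stack_rows_chart[OF J] by simp_all
  moreover have "x = 1 / y" "y \<noteq> 0" if "x * y = 1" for x y :: 'k
    using that by (auto simp: eq_divide_eq)
  ultimately have nz: "det (select n I * frame r n J V) \<noteq> 0" "chart_sign n I \<noteq> (0::'k)"
      "chart_sign n J \<noteq> (0::'k)"
    and inv: "det (select n J * frame r n I V) = 1 / det (select n I * frame r n J V)"
      "det (?S I) = 1 / chart_sign n I" "det (?S J) = 1 / chart_sign n J"
    by blast+
  have "det ?G = chart_sign n J" using SG nz unfolding inv by (simp add: field_simps)
  then have "chart_sign n J / chart_sign n I =
      det (select n I * frame r n J V) * det (coframe r n I V * (select n (- J))\<^sup>T)"
    using block unfolding inv by simp
  then show ?thesis using nz(1) unfolding inv by (simp add: field_simps)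
qed

lemma chart_sign_nonzero:
  fixes V :: "'k::field vec set"
  assumes "I \<in> gr_index r n" "V \<in> gr_chart r n I"
  shows "chart_sign n I \<noteq> (0 :: 'k)"
  using det_stack_rows_chart[OF assms] by auto


section \<open>The tangent bundle\<close>

text \<open>Any two presentations of \<open>f\<close> agree at infinitely many points, hence as rational functions, so the
  quotient rule assigns the same value to both.\<close>

lemma deriv_at_0_eqI:
  fixes f :: "'k::field_char_0 \<Rightarrow> 'k"
  assumes q: "poly q 0 \<noteq> 0" and f: "\<And>s. poly q s \<noteq> 0 \<Longrightarrow> f s = poly p s / poly q s"
    and D: "D = (poly (pderiv p) 0 * poly q 0 - poly p 0 * poly (pderiv q) 0) / (poly q 0)\<^sup>2"
  shows "deriv_at_0 f = D"
  unfolding deriv_at_0_def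
proof (rule the_equality)
  show "\<exists>p q. poly q 0 \<noteq> 0 \<and> (\<forall>s. poly q s \<noteq> 0 \<longrightarrow> f s = poly p s / poly q s) \<and>
     D = (poly (pderiv p) 0 * poly q 0 - poly p 0 * poly (pderiv q) 0) / (poly q 0)\<^sup>2"
    using assms by blast
  fix D' assume "\<exists>p q. poly q 0 \<noteq> 0 \<and> (\<forall>s. poly q s \<noteq> 0 \<longrightarrow> f s = poly p s / poly q s) \<and>
     D' = (poly (pderiv p) 0 * poly q 0 - poly p 0 * poly (pderiv q) 0) / (poly q 0)\<^sup>2"
  then obtain p' q' where q': "poly q' 0 \<noteq> 0" "\<And>s. poly q' s \<noteq> 0 \<Longrightarrow> f s = poly p' s / poly q' s"
    and D': "D' = (poly (pderiv p') 0 * poly q' 0 - poly p' 0 * poly (pderiv q') 0) / (poly q' 0)\<^sup>2"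
    by blast
  have "p * q' = p' * q"
  proof (rule ccontr)
    assume "p * q' \<noteq> p' * q"
    then have "finite {s. poly (p * q' - p' * q) s = 0}" by (intro poly_roots_finite) simp
    moreover have "finite {s. poly (q * q') s = 0}" using q q' by (intro poly_roots_finite) auto
    moreover have "UNIV = {s. poly (p * q' - p' * q) s = 0} \<union> {s. poly (q * q') s = 0}"
    proof (rule UNIV_eq_I)
      fix s
      show "s \<in> {s. poly (p * q' - p' * q) s = 0} \<union> {s. poly (q * q') s = 0}"
      proof (cases "poly q s = 0 \<or> poly q' s = 0")
        case False
        have "poly p s = f s * poly q s" using f[of s] False by simp
        moreover have "poly p' s = f s * poly q' s" using q'(2)[of s] False by simp
        ultimately show ?thesis by simp
      qed auto
    qed
    ultimately show False using infinite_UNIV_char_0[where 'a='k] by (metis finite_UnI)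
  qed
  then have "pderiv (p * q') = pderiv (p' * q)" "poly (p * q') 0 = poly (p' * q) 0" by simp_all
  then have eq: "poly p 0 * poly q' 0 = poly p' 0 * poly q 0"
    and "poly (pderiv (p * q')) 0 = poly (pderiv (p' * q)) 0" by simp_all
  then have eq': "poly p 0 * poly (pderiv q') 0 + poly q' 0 * poly (pderiv p) 0 =
      poly p' 0 * poly (pderiv q) 0 + poly q 0 * poly (pderiv p') 0"
    by (simp add: pderiv_mult)
  define a b c d a' b' c' d' where defs: "a = poly p 0" "b = poly q 0" "c = poly (pderiv p) 0"
    "d = poly (pderiv q) 0" "a' = poly p' 0" "b' = poly q' 0" "c' = poly (pderiv p') 0"
    "d' = poly (pderiv q') 0"
  have nz: "b \<noteq> 0" "b' \<noteq> 0" using q q'(1) by (simp_all add: defs)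
  have e: "a = a' * b / b'" using eq nz by (simp add: defs field_simps)
  have e': "c = (a' * d + b * c' - a * d') / b'" using eq' nz by (simp add: defs field_simps)
  have "(c * b - a * d) / b\<^sup>2 = (c' * b' - a' * d') / b'\<^sup>2"
    unfolding e' e using nz by (simp add: field_simps power2_eq_square)
  then show "D' = D" unfolding D D' by (simp add: defs)
qed

lemma gr_chart_point:
  fixes Z :: "'k::field mat"
  assumes J: "J \<in> gr_index r n" and Z: "Z \<in> carrier_mat (n - r) r"
  defines "A \<equiv> (select n J)\<^sup>T + (select n (- J))\<^sup>T * Z"
  defines "V \<equiv> mat_image A r"
  shows "V \<in> gr_chart r n J" "frame r n J V = A" "gr_coords r n J V = Z"
    "A \<in> carrier_mat n r" "select n J * A = 1\<^sub>m r"
proof -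
  note sel = select_complementary[OF J, where 'k = 'k]
  have Rt: "(select n J :: 'k mat)\<^sup>T \<in> carrier_mat n r"
    "(select n (- J) :: 'k mat)\<^sup>T \<in> carrier_mat n (n - r)" using sel by auto
  note QZ = mult_carrier_mat[OF Rt(2) Z]
  show A: "A \<in> carrier_mat n r" unfolding A_def using Rt QZ by simp
  have "select n J * A = select n J * (select n J)\<^sup>T + select n J * ((select n (- J))\<^sup>T * Z)"
    unfolding A_def by (rule mult_add_distrib_mat[OF sel(1) Rt(1) QZ])
  also have "select n J * ((select n (- J))\<^sup>T * Z) = select n J * (select n (- J))\<^sup>T * Z"
    by (rule assoc_mult_mat[OF sel(1) Rt(2) Z, symmetric])
  finally show RA: "select n J * A = 1\<^sub>m r" using sel(3,5) Z by simp
  have fr: "is_frame r n J V A" unfolding is_frame_iff V_def using A RA by simp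
  have "V \<in> grassmannian r n" unfolding V_def by (rule image_in_grassmannian[OF A sel(1) RA])
  then show V: "V \<in> gr_chart r n J" unfolding gr_chart_def using fr by blast
  have "is_frame r n J V (frame r n J V)"
    unfolding is_frame_iff using chart_frame(1-3)[OF J V] by simp
  then show F: "frame r n J V = A" using is_frame_unique[OF J _ fr] by blast
  have "gr_coords r n J V = select n (- J) * A" using chart_frame(9)[OF J V] F by simp
  also have "\<dots> = select n (- J) * (select n J)\<^sup>T + select n (- J) * ((select n (- J))\<^sup>T * Z)"
    unfolding A_def by (rule mult_add_distrib_mat[OF sel(2) Rt(1) QZ])
  also have "select n (- J) * ((select n (- J))\<^sup>T * Z) = select n (- J) * (select n (- J))\<^sup>T * Z"
    by (rule assoc_mult_mat[OF sel(2) Rt(2) Z, symmetric])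
  finally show "gr_coords r n J V = Z" using sel(4,6) Z by simp
qed

lemma inj_on_gr_coords:
  assumes J: "J \<in> gr_index r n"
  shows "inj_on (gr_coords r n J :: 'k::field vec set \<Rightarrow> 'k mat) (gr_chart r n J)"
proof (rule inj_onI)
  fix V W :: "'k vec set"
  assume V: "V \<in> gr_chart r n J" and W: "W \<in> gr_chart r n J"
    and eq: "gr_coords r n J V = gr_coords r n J W"
  have "frame r n J V = frame r n J W"
    using chart_frame(9,10)[OF J V] chart_frame(9,10)[OF J W] eq by simp
  then show "V = W" using chart_frame(3)[OF J V] chart_frame(3)[OF J W] by simp
qed


lemma mult_matrix_unit_mult:
  fixes A B :: "'k::field mat"
  assumes A: "A \<in> carrier_mat m (n - r)" and B: "B \<in> carrier_mat r m'"
    and l: "l < (n - r) * r" and ij: "i < m" "j < m'"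
  shows "(A * matrix_unit r n l * B) $$ (i, j) = A $$ (i, l div r) * B $$ (l mod r, j)"
proof -
  let ?U = "matrix_unit r n l :: 'k mat"
  have U: "?U \<in> carrier_mat (n - r) r" by (simp add: matrix_unit_def)
  note l' = div_mod_less[OF l]
  have AU: "(A * ?U) $$ (i, q) = (if q = l mod r then A $$ (i, l div r) else 0)" if "q < r" for q
  proof -
    have "(A * ?U) $$ (i, q) =
        (\<Sum>p\<in>{0..<n - r}. (if p = l div r then 1 else 0) * (if q = l mod r then A $$ (i, p) else 0))"
      using A ij that by (simp add: scalar_prod_def matrix_unit_def) (auto intro!: sum.cong)
    then show ?thesis using l' by (simp add: sum_delta_mult)
  qed
  define E where "E = A * ?U"
  have E: "E \<in> carrier_mat m r" unfolding E_def using A U by simp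
  have "(E * B) $$ (i, j) = (\<Sum>q\<in>{0..<r}. E $$ (i, q) * B $$ (q, j))"
    using E B ij by (simp add: scalar_prod_def)
  also have "\<dots> = (\<Sum>q\<in>{0..<r}. (if q = l mod r then 1 else 0) * (A $$ (i, l div r) * B $$ (q, j)))"
    by (intro sum.cong) (auto simp: E_def AU)
  finally have "(A * ?U * B) $$ (i, j) =
      (\<Sum>q\<in>{0..<r}. (if q = l mod r then 1 else 0) * (A $$ (i, l div r) * B $$ (q, j)))"
    unfolding E_def .
  then show ?thesis using l' by (simp add: sum_delta_mult)
qed

text \<open>A matrix unit is the product of a column and a row.\<close>

lemma matrix_unit_sandwich:
  fixes X :: "'k::field mat"
  assumes X: "X \<in> carrier_mat r (n - r)" and l: "l < (n - r) * r"
  shows "matrix_unit r n l * (X * matrix_unit r n l) = X $$ (l mod r, l div r) \<cdot>\<^sub>m matrix_unit r n l"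
proof (rule eq_matI)
  let ?U = "matrix_unit r n l :: 'k mat"
  have U: "?U \<in> carrier_mat (n - r) r" by (simp add: matrix_unit_def)
  note l' = div_mod_less[OF l]
  note XU = mult_carrier_mat[OF X U]
  fix a b assume "a < dim_row (X $$ (l mod r, l div r) \<cdot>\<^sub>m ?U)" "b < dim_col (X $$ (l mod r, l div r) \<cdot>\<^sub>m ?U)"
  then have ab: "a < n - r" "b < r" using U by auto
  have "(?U * (X * ?U)) $$ (a, b) = (1\<^sub>m (n - r) * ?U * (X * ?U)) $$ (a, b)" using U by simp
  also have "\<dots> = 1\<^sub>m (n - r) $$ (a, l div r) * (X * ?U) $$ (l mod r, b)"
    by (rule mult_matrix_unit_mult[OF one_carrier_mat XU l ab])
  also have "(X * ?U) $$ (l mod r, b) = (X * ?U * 1\<^sub>m r) $$ (l mod r, b)"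
    by (simp only: right_mult_one_mat[OF XU])
  also have "\<dots> = X $$ (l mod r, l div r) * 1\<^sub>m r $$ (l mod r, b)"
    by (rule mult_matrix_unit_mult[OF X one_carrier_mat l l'(2) ab(2)])
  finally show "(?U * (X * ?U)) $$ (a, b) = (X $$ (l mod r, l div r) \<cdot>\<^sub>m ?U) $$ (a, b)"
    using ab l' by (auto simp: matrix_unit_def)
qed (use X in \<open>auto simp: matrix_unit_def\<close>)

text \<open>Moving one affine coordinate in the chart of \<open>J\<close> changes the frame by a matrix of rank one, so
  the Sherman-Morrison formula for the inverse of a rank one perturbation gives the coordinates in
  the chart of \<open>I\<close> in closed form.\<close>

lemma change_coords_along_unit:
  fixes V :: "'k::field vec set"
  assumes I: "I \<in> gr_index r n" "V \<in> gr_chart r n I" and J: "J \<in> gr_index r n" "V \<in> gr_chart r n J"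
    and l: "l < (n - r) * r"
  defines "U \<equiv> matrix_unit r n l :: 'k mat"
    and "h \<equiv> coframe r n I V * (select n (- J))\<^sup>T" and "g' \<equiv> select n J * frame r n I V"
  defines "c \<equiv> (g' * select n I * (select n (- J))\<^sup>T) $$ (l mod r, l div r)"
  assumes s: "1 + s * c \<noteq> 0"
  shows "change_coords r n I J (gr_coords r n J V + s \<cdot>\<^sub>m U) =
    gr_coords r n I V + (s / (1 + s * c)) \<cdot>\<^sub>m (h * U * g')"
proof -
  note FI = chart_frame[OF I] and FJ = chart_frame[OF J]
  note selI = select_complementary[OF I(1), where 'k = 'k]
    and selJ = select_complementary[OF J(1), where 'k = 'k]
  define F R P C where "F = frame r n I V" and "R = (select n I :: 'k mat)"
    and "P = (select n (- I) :: 'k mat)\<^sup>T" and "C = coframe r n I V"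
  define FJ' PJ RJ where "FJ' = frame r n J V" and "PJ = (select n (- J) :: 'k mat)\<^sup>T"
    and "RJ = (select n J :: 'k mat)"
  have dims: "F \<in> carrier_mat n r" "R \<in> carrier_mat r n" "P \<in> carrier_mat n (n - r)"
    "C \<in> carrier_mat (n - r) n" "FJ' \<in> carrier_mat n r" "PJ \<in> carrier_mat n (n - r)"
    "RJ \<in> carrier_mat r n" "U \<in> carrier_mat (n - r) r"
    using FI FJ selI selJ by (auto simp: F_def R_def P_def C_def FJ'_def PJ_def RJ_def U_def matrix_unit_def)
  have RF: "R * F = 1\<^sub>m r" and RP: "R * P = 0\<^sub>m r (n - r)" and FRPC: "F * R + P * C = 1\<^sub>m n"
    and QP: "select n (- I) * P = 1\<^sub>m (n - r)"
    using FI selI by (simp_all add: F_def R_def P_def C_def)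
  define g W D N t where "g = R * FJ'" and "W = PJ * U" and "D = h * U * g'" and "N = R * W"
    and "t = s / (1 + s * c)"
  have gdims: "g \<in> carrier_mat r r" "g' \<in> carrier_mat r r" "h \<in> carrier_mat (n - r) (n - r)"
    "W \<in> carrier_mat n r" "D \<in> carrier_mat (n - r) r" "N \<in> carrier_mat r r"
    using dims by (auto simp: g_def g'_def h_def W_def D_def N_def F_def[symmetric] C_def[symmetric]
        RJ_def[symmetric] PJ_def[symmetric])
  have g'g: "g' * g = 1\<^sub>m r"
    using frame_change_inverse[OF I J] by (simp add: g'_def g_def R_def FJ'_def)
  have Fg: "F * g = FJ'" using chart_change(1)[OF I J] by (simp add: F_def g_def R_def FJ'_def)
  have hU: "h * U = C * W"
    unfolding h_def W_def PJ_def[symmetric] C_def[symmetric] by (rule assoc_mult_mat[OF dims(4,6,8)])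
  have CW: "C * W \<in> carrier_mat (n - r) r" using dims gdims by simp
  have Dg: "D * g = C * W"
    unfolding D_def hU using assoc_mult_mat[OF CW gdims(2,1)] g'g CW by (metis right_mult_one_mat)
  have WXW: "W * (g' * N) = c \<cdot>\<^sub>m W"
  proof -
    let ?X = "g' * R * PJ"
    have X: "?X \<in> carrier_mat r (n - r)" using dims gdims by simp
    have "g' * N = g' * R * W" unfolding N_def by (rule assoc_mult_mat[OF gdims(2) dims(2) gdims(4), symmetric])
    also have "\<dots> = ?X * U" unfolding W_def
      by (rule assoc_mult_mat[OF mult_carrier_mat[OF gdims(2) dims(2)] dims(6,8), symmetric])
    finally have "W * (g' * N) = PJ * (U * (?X * U))"
      unfolding W_def using assoc_mult_mat[OF dims(6,8) mult_carrier_mat[OF X dims(8)]] by simp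
    also have "U * (?X * U) = c \<cdot>\<^sub>m U"
      using matrix_unit_sandwich[OF X l] by (simp add: U_def c_def R_def PJ_def)
    also have "PJ * (c \<cdot>\<^sub>m U) = c \<cdot>\<^sub>m W" unfolding W_def by (rule mult_smult_distrib[OF dims(6,8)])
    finally show ?thesis .
  qed
  have DN: "D * N = c \<cdot>\<^sub>m (C * W)"
  proof -
    have "D * N = C * W * (g' * N)" unfolding D_def hU by (rule assoc_mult_mat[OF CW gdims(2,6)])
    also have "\<dots> = C * (W * (g' * N))"
      by (rule assoc_mult_mat[OF dims(4) gdims(4) mult_carrier_mat[OF gdims(2,6)]])
    also have "\<dots> = c \<cdot>\<^sub>m (C * W)" unfolding WXW by (rule mult_smult_distrib[OF dims(4) gdims(4)])
    finally show ?thesis .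
  qed
  (* The frames of the moved subspace in the charts of I and J are Fs and As; gs relates them. *)
  define Fs gs As where "Fs = F + t \<cdot>\<^sub>m (P * D)" and "gs = g + s \<cdot>\<^sub>m N" and "As = FJ' + s \<cdot>\<^sub>m W"
  have PD: "P * D \<in> carrier_mat n r" using dims gdims by simp
  have sdims: "Fs \<in> carrier_mat n r" "gs \<in> carrier_mat r r" "As \<in> carrier_mat n r"
    using dims gdims PD by (simp_all add: Fs_def gs_def As_def)
  have RFs: "R * Fs = 1\<^sub>m r"
  proof -
    have "R * Fs = R * F + R * (t \<cdot>\<^sub>m (P * D))"
      unfolding Fs_def using dims PD by (intro mult_add_distrib_mat[of _ r n _ r]) auto
    also have "R * (t \<cdot>\<^sub>m (P * D)) = t \<cdot>\<^sub>m (R * (P * D))" by (rule mult_smult_distrib[OF dims(2) PD])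
    also have "R * (P * D) = R * P * D" by (rule assoc_mult_mat[OF dims(2,3) gdims(5), symmetric])
    also have "\<dots> = 0\<^sub>m r r" unfolding RP by (rule left_mult_zero_mat[OF gdims(5)])
    finally show ?thesis unfolding RF by simp
  qed
  have Fsgs: "Fs * gs = As"
  proof -
    have 1: "F * gs = FJ' + s \<cdot>\<^sub>m (F * N)"
      unfolding gs_def using mult_add_distrib_mat[OF dims(1) gdims(1) smult_carrier_mat[OF gdims(6)]]
        mult_smult_distrib[OF dims(1) gdims(6)] Fg by simp
    have "D * gs = C * W + s \<cdot>\<^sub>m (c \<cdot>\<^sub>m (C * W))"
      unfolding gs_def using mult_add_distrib_mat[OF gdims(5,1) smult_carrier_mat[OF gdims(6)]]
        mult_smult_distrib[OF gdims(5,6)] Dg DN by simp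
    also have "\<dots> = (1 + s * c) \<cdot>\<^sub>m (C * W)" using CW by (intro eq_matI) (auto simp: algebra_simps)
    finally have Dgs: "D * gs = (1 + s * c) \<cdot>\<^sub>m (C * W)" .
    have "t \<cdot>\<^sub>m (P * D) * gs = t \<cdot>\<^sub>m (P * (D * gs))"
      using mult_smult_assoc_mat[OF PD sdims(2)] assoc_mult_mat[OF dims(3) gdims(5) sdims(2)] by simp
    also have "\<dots> = (t * (1 + s * c)) \<cdot>\<^sub>m (P * (C * W))"
      unfolding Dgs mult_smult_distrib[OF dims(3) CW] by (simp add: smult_smult_mat)
    also have "t * (1 + s * c) = s" using s by (simp add: t_def)
    finally have 2: "t \<cdot>\<^sub>m (P * D) * gs = s \<cdot>\<^sub>m (P * (C * W))" .
    have "Fs * gs = F * gs + t \<cdot>\<^sub>m (P * D) * gs"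
      unfolding Fs_def by (rule add_mult_distrib_mat[OF dims(1) smult_carrier_mat[OF PD] sdims(2)])
    also have "\<dots> = FJ' + s \<cdot>\<^sub>m (F * N + P * (C * W))"
      unfolding 1 2 using dims gdims CW by (intro eq_matI) (auto simp: algebra_simps)
    also have "F * N + P * (C * W) = (F * R + P * C) * W"
      unfolding N_def
      using add_mult_distrib_mat[OF mult_carrier_mat[OF dims(1,2)] mult_carrier_mat[OF dims(3,4)] gdims(4)]
        assoc_mult_mat[OF dims(1,2) gdims(4)] assoc_mult_mat[OF dims(3,4) gdims(4)] by simp
    finally show ?thesis unfolding FRPC As_def using gdims by simp
  qed
  define Z where "Z = gr_coords r n J V + s \<cdot>\<^sub>m U"
  have coordsJ: "gr_coords r n J V \<in> carrier_mat (n - r) r"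
    using FJ(9) selJ(2) FJ(1) by simp
  have Z: "Z \<in> carrier_mat (n - r) r" unfolding Z_def using coordsJ dims by simp
  have As: "As = RJ\<^sup>T + PJ * Z"
  proof -
    have "PJ * Z = PJ * gr_coords r n J V + s \<cdot>\<^sub>m W"
      unfolding Z_def W_def
      using mult_add_distrib_mat[OF dims(6) coordsJ smult_carrier_mat[OF dims(8)]]
        mult_smult_distrib[OF dims(6,8)] by simp
    then have "RJ\<^sup>T + PJ * Z = RJ\<^sup>T + PJ * gr_coords r n J V + s \<cdot>\<^sub>m W"
      using dims coordsJ gdims by (simp add: assoc_add_mat[of _ n r])
    moreover have "FJ' = RJ\<^sup>T + PJ * gr_coords r n J V"
      using FJ(9,10) by (simp add: FJ'_def RJ_def PJ_def)
    ultimately show ?thesis unfolding As_def by simp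
  qed
  define V' where "V' = mat_image As r"
  note pt = gr_chart_point[OF J(1) Z, folded RJ_def PJ_def, folded As, folded V'_def]
  have V'I: "V' \<in> gr_chart r n I" and "frame r n I V' = Fs"
  proof -
    have ginv: "gs * (RJ * Fs) = 1\<^sub>m r"
    proof (rule mat_mult_left_right_inverse)
      have "RJ * Fs * gs = RJ * (Fs * gs)" by (rule assoc_mult_mat[OF dims(7) sdims(1,2)])
      then show "RJ * Fs * gs = 1\<^sub>m r" using pt(5) Fsgs by simp
    qed (use dims sdims in auto)
    have RFsd: "RJ * Fs \<in> carrier_mat r r" using dims sdims by simp
    have "As * (RJ * Fs) = Fs * (gs * (RJ * Fs))"
      unfolding Fsgs[symmetric] by (rule assoc_mult_mat[OF sdims(1,2) RFsd])
    then have "As * (RJ * Fs) = Fs" using ginv sdims by simp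
    then have V': "V' = mat_image Fs r"
      using mat_image_mult_subset[OF sdims(3) RFsd] mat_image_mult_subset[OF sdims(1,2)] Fsgs
      unfolding V'_def by (metis subset_antisym)
    have fr: "is_frame r n I V' Fs"
      unfolding is_frame_iff using sdims RFs V' by (simp add: R_def)
    have "V' \<in> grassmannian r n" using pt(1) unfolding gr_chart_def by blast
    then show V'I: "V' \<in> gr_chart r n I" unfolding gr_chart_def using fr by blast
    have "is_frame r n I V' (frame r n I V')"
      unfolding is_frame_iff using chart_frame(1-3)[OF I(1) V'I] by simp
    then show "frame r n I V' = Fs" using is_frame_unique[OF I(1) _ fr] by blast
  qed
  have "change_coords r n I J Z = gr_coords r n I V'"
    unfolding change_coords_def using the_inv_into_f_f[OF inj_on_gr_coords[OF J(1)] pt(1)] pt(3) by simp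
  also have "\<dots> = select n (- I) * Fs" using chart_frame(9)[OF I(1) V'I] \<open>frame r n I V' = Fs\<close> by simp
  also have "\<dots> = select n (- I) * F + select n (- I) * (t \<cdot>\<^sub>m (P * D))"
    unfolding Fs_def by (rule mult_add_distrib_mat[OF selI(2) dims(1) smult_carrier_mat[OF PD]])
  also have "select n (- I) * (t \<cdot>\<^sub>m (P * D)) = t \<cdot>\<^sub>m (select n (- I) * (P * D))"
    by (rule mult_smult_distrib[OF selI(2) PD])
  also have "select n (- I) * (P * D) = select n (- I) * P * D"
    by (rule assoc_mult_mat[OF selI(2) dims(3) gdims(5), symmetric])
  also have "\<dots> = D" unfolding QP using gdims by simp
  also have "select n (- I) * F = gr_coords r n I V" using FI(9) by (simp add: F_def)
  finally show ?thesis unfolding Z_def t_def D_def .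
qed

text \<open>By the closed form, the directional derivative of the change of coordinates along a matrix unit
  \<open>U\<close> is \<open>h * U * g'\<close>, where \<open>h\<close> is the transition matrix of the universal quotient and the
  transpose of \<open>g'\<close> is that of the dual of the universal sub-bundle.\<close>

lemma transition_tangent_bundle:
  fixes V :: "'k::field_char_0 vec set"
  assumes I: "I \<in> gr_index r n" "V \<in> gr_chart r n I" and J: "J \<in> gr_index r n" "V \<in> gr_chart r n J"
  shows "transition (tangent_bundle r n) I J V =
    kronecker (transition (universal_quot r n) I J V) (transition (dual (universal_sub r n)) I J V)"
proof -
  note FI = chart_frame[OF I] and FJ = chart_frame[OF J]
  note selI = select_complementary[OF I(1), where 'k = 'k]
    and selJ = select_complementary[OF J(1), where 'k = 'k]
  define h g' where "h = coframe r n I V * (select n (- J))\<^sup>T" and "g' = select n J * frame r n I V"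
  have hg: "h \<in> carrier_mat (n - r) (n - r)" "g' \<in> carrier_mat r r"
    using FI selJ by (auto simp: h_def g'_def)
  have "mat (r * (n - r)) (r * (n - r)) (\<lambda>(k, l). deriv_at_0 (\<lambda>s.
          change_coords r n I J (gr_coords r n J V + s \<cdot>\<^sub>m matrix_unit r n l) $$ (k div r, k mod r))) =
      kronecker h g'\<^sup>T" (is "?M = _")
  proof (rule eq_matI)
    fix k l assume "k < dim_row (kronecker h g'\<^sup>T)" "l < dim_col (kronecker h g'\<^sup>T)"
    then have kl: "k < (n - r) * r" "l < (n - r) * r" using hg by (auto simp: kronecker_def)
    note k = div_mod_less[OF kl(1)] and l = div_mod_less[OF kl(2)]
    define c where "c = (g' * select n I * (select n (- J))\<^sup>T) $$ (l mod r, l div r)"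
    define D where "D = (h * matrix_unit r n l * g') $$ (k div r, k mod r)"
    define x where "x = gr_coords r n I V $$ (k div r, k mod r)"
    have hUg: "h * matrix_unit r n l * g' \<in> carrier_mat (n - r) r"
      using hg by (auto simp: matrix_unit_def)
    have f: "change_coords r n I J (gr_coords r n J V + s \<cdot>\<^sub>m matrix_unit r n l) $$ (k div r, k mod r) =
        x + s / (1 + s * c) * D" if "1 + s * c \<noteq> 0" for s
    proof -
      have "change_coords r n I J (gr_coords r n J V + s \<cdot>\<^sub>m matrix_unit r n l) =
          gr_coords r n I V + (s / (1 + s * c)) \<cdot>\<^sub>m (h * matrix_unit r n l * g')"
        unfolding c_def h_def g'_def
        by (rule change_coords_along_unit[OF I J kl(2)]) (use that in \<open>simp add: c_def g'_def\<close>)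
      moreover have "gr_coords r n I V \<in> carrier_mat (n - r) r" using FI(1,9) selI(2) by simp
      ultimately show ?thesis using k hUg hg by (simp add: x_def D_def del: index_mult_mat(1))
    qed
    have "deriv_at_0 (\<lambda>s. change_coords r n I J (gr_coords r n J V + s \<cdot>\<^sub>m matrix_unit r n l)
        $$ (k div r, k mod r)) = D"
    proof (rule deriv_at_0_eqI[where p = "[:x, x * c + D:]" and q = "[:1, c:]"])
      fix s assume "poly [:1, c:] s \<noteq> 0"
      then have nz: "1 + s * c \<noteq> 0" by simp
      show "change_coords r n I J (gr_coords r n J V + s \<cdot>\<^sub>m matrix_unit r n l) $$ (k div r, k mod r) =
          poly [:x, x * c + D:] s / poly [:1, c:] s"
        unfolding f[OF nz] using nz by (simp add: field_simps)
    qed (simp_all add: pderiv_pCons)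
    also have "D = h $$ (k div r, l div r) * g' $$ (l mod r, k mod r)"
      unfolding D_def by (rule mult_matrix_unit_mult[OF hg kl(2) k])
    also have "\<dots> = kronecker h g'\<^sup>T $$ (k, l)"
      using kronecker_index[of h "n - r" "n - r" "g'\<^sup>T" r r k l] hg kl k l by simp
    finally show "?M $$ (k, l) = kronecker h g'\<^sup>T $$ (k, l)"
      using kl by (simp add: mult.commute)
  qed (use hg in \<open>auto simp: kronecker_def\<close>)
  then show ?thesis
    using transition_universal_quot[OF I J] transition_universal_sub[OF J I]
    by (simp add: tangent_bundle_def dual_def h_def g'_def)
qed


section \<open>Bundles pulled back along a morphism\<close>

lemma atlas_pullback:
  fixes f :: "'k::field P1 \<Rightarrow> 'k vec set" and E :: "('k vec set, nat set, 'k) vbundle"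
  assumes f: "is_morphism r n f" and E: "chart_index E = gr_index r n" "chart E = gr_chart r n"
    and T: "\<And>I J V. I \<in> gr_index r n \<Longrightarrow> V \<in> gr_chart r n I \<Longrightarrow> J \<in> gr_index r n \<Longrightarrow>
      V \<in> gr_chart r n J \<Longrightarrow> transition E I J V \<in> carrier_mat (bundle_rank E) (bundle_rank E)"
  shows "open_atlas (pullback f E)"
proof -
  have "\<exists>I\<in>gr_index r n. x \<in> f -` gr_chart r n I" for x
    using gr_charts_cover[of "f x" r n] f unfolding is_morphism_def by auto
  then show ?thesis
    using f T unfolding open_atlas_def pullback_def is_morphism_def E vbundle.select_convs by auto
qed

lemma open_atlas_pullbacks:
  fixes f :: "'k::field_char_0 P1 \<Rightarrow> 'k vec set"
  assumes f: "is_morphism r n f"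
  shows "open_atlas (pullback f (dual (universal_sub r n)))"
    "open_atlas (pullback f (universal_quot r n))"
    "open_atlas (pullback f (tangent_bundle r n))"
proof -
  have S: "transition (dual (universal_sub r n)) I J V \<in> carrier_mat r r"
    and Q: "transition (universal_quot r n) I J V \<in> carrier_mat (n - r) (n - r)"
    and T: "transition (tangent_bundle r n) I J V \<in> carrier_mat (r * (n - r)) (r * (n - r))"
    if h: "I \<in> gr_index r n" "V \<in> gr_chart r n I" "J \<in> gr_index r n" "V \<in> gr_chart r n J"
    for I J and V :: "'k vec set"
  proof -
    note FI = chart_frame[OF h(1,2)]
    note selJ = select_complementary[OF h(3), where 'k = 'k]
    show S: "transition (dual (universal_sub r n)) I J V \<in> carrier_mat r r"
      using transition_universal_sub[OF h(3,4,1,2)] FI(1) selJ(1) by (simp add: dual_def)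
    show Q: "transition (universal_quot r n) I J V \<in> carrier_mat (n - r) (n - r)"
      using transition_universal_quot[OF h] FI(4) selJ(2) by simp
    show "transition (tangent_bundle r n) I J V \<in> carrier_mat (r * (n - r)) (r * (n - r))"
      unfolding transition_tangent_bundle[OF h] using kronecker_carrier[OF Q S]
      by (simp add: mult.commute)
  qed
  show "open_atlas (pullback f (dual (universal_sub r n)))"
    by (rule atlas_pullback[OF f]) (use S in \<open>simp_all add: dual_def universal_sub_def\<close>)
  show "open_atlas (pullback f (universal_quot r n))"
    by (rule atlas_pullback[OF f]) (use Q in \<open>simp_all add: universal_quot_def\<close>)
  show "open_atlas (pullback f (tangent_bundle r n))"
    by (rule atlas_pullback[OF f]) (use T in \<open>simp_all add: tangent_bundle_def\<close>)
qed

text \<open>Division of the row \<open>s\<close> by the power \<open>d s\<close> of a coordinate turns forms into regular functions,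
  and the quotient of two such powers is the transition function of \<open>O(d s)\<close>.\<close>

lemma splitting_from_forms:
  fixes E :: "('k::field P1, 'i, 'k) vbundle"
  assumes E: "open_atlas E" "bundle_rank E = m"
    and B: "\<And>i x. i \<in> chart_index E \<Longrightarrow> B i x \<in> carrier_mat m m"
    and B_det: "\<And>i x. i \<in> chart_index E \<Longrightarrow> x \<in> chart E i \<Longrightarrow> det (B i x) \<noteq> 0"
    and form: "\<And>i s t. i \<in> chart_index E \<Longrightarrow> s < m \<Longrightarrow> t < m \<Longrightarrow> binary_form (d s) (\<lambda>x. B i x $$ (s, t))"
    and trans: "\<And>i j x. i \<in> chart_index E \<Longrightarrow> j \<in> chart_index E \<Longrightarrow> x \<in> chart E i \<Longrightarrow> x \<in> chart E j \<Longrightarrow>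
      B i x * transition E i j x = B j x"
  shows "splitting E (map (\<lambda>s. int (d s)) [0..<m])
    (\<lambda>k i x. mat_diag m (\<lambda>s. 1 / hcoord k x ^ d s) * B i x)"
proof -
  define D :: "nat \<Rightarrow> 'k P1 \<Rightarrow> 'k mat" where "D k x = mat_diag m (\<lambda>s. 1 / hcoord k x ^ d s)" for k x
  have D: "D k x \<in> carrier_mat m m" for k x by (simp add: D_def)
  have DB: "(D k x * B i x) $$ (s, t) = B i x $$ (s, t) / hcoord k x ^ d s"
    if "i \<in> chart_index E" "s < m" "t < m" for k i x s t
    unfolding D_def mat_diag_mult_left[OF B[OF that(1)]] using that by simp
  have len: "length (map (\<lambda>s. int (d s)) [0..<m]) = m" by simp
  show ?thesis
    unfolding splitting_def len E(2) D_def[symmetric]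
  proof (intro conjI ballI impI allI)
    fix i k x assume h: "i \<in> chart_index E" "k \<in> {0, 1}" "x \<in> chart E i" "hcoord k x \<noteq> 0"
    show "D k x * B i x \<in> carrier_mat m m" by (rule mult_carrier_mat[OF D B[OF h(1)]])
    show "det (D k x * B i x) \<noteq> 0"
      using det_mult[OF D B[OF h(1)]] B_det[OF h(1,3)] h(4) by (simp add: D_def det_mat_diag)
    fix s t assume st: "s < m" "t < m"
    show "regular_at (\<lambda>y. (D k y * B i y) $$ (s, t)) x"
      unfolding DB[OF h(1) st] by (rule regular_at_form_quotient[OF form[OF h(1) st] h(4)])
  next
    fix i j k l x
    assume h: "i \<in> chart_index E" "j \<in> chart_index E" "k \<in> {0, 1}" "l \<in> {0, 1}"
      and "x \<in> chart E i \<inter> chart E j" and h': "hcoord k x \<noteq> 0" "hcoord l x \<noteq> 0"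
    then have x: "x \<in> chart E i" "x \<in> chart E j" by auto
    have T: "transition E i j x \<in> carrier_mat m m"
      using E h x unfolding open_atlas_def by blast
    let ?P = "mat_diag m (\<lambda>s. (hcoord l x / hcoord k x) powi map (\<lambda>s. int (d s)) [0..<m] ! s)"
    have Dk: "D k x = ?P * D l x"
      unfolding D_def mat_diag_mult_left[OF mat_diag_dim]
      using h' by (intro eq_matI) (auto simp: mat_diag_def power_divide)
    have "D k x * B i x * transition E i j x = D k x * B j x"
      using assoc_mult_mat[OF D B[OF h(1)] T] trans[OF h(1,2) x] by simp
    also have "\<dots> = ?P * D l x * B j x" by (simp only: Dk)
    also have "?P * D l x * B j x = ?P * (D l x * B j x)"
      by (rule assoc_mult_mat[OF mat_diag_dim D B[OF h(2)]])
    finally show "D k x * B i x * transition E i j x = ?P * (D l x * B j x)" .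
  qed simp
qed

lemma binary_form_const_mult_sections:
  fixes R :: "'k::field mat"
  assumes "form_sections n m W d M" and R: "R \<in> carrier_mat l n" and "i < l" "j < m"
  shows "binary_form (d j) (\<lambda>x. (R * M x) $$ (i, j))"
proof -
  note M = form_sectionsD[OF assms(1)]
  have "(R * M x) $$ (i, j) = (\<Sum>k<n. R $$ (i, k) * M x $$ (k, j))" for x
    using M(1)[of x] R assms(3,4) by (simp add: scalar_prod_def lessThan_atLeast0)
  then show ?thesis using M(2) assms(4) by (auto intro!: binary_form_sum binary_form_smult)
qed

text \<open>The coordinates of a minimal basis in the local frames, transposed, trivialise the dual bundle.
  The degrees of the basis are degrees of forms, hence non-negative.\<close>

lemma dual_of_subbundle_splits:
  fixes E :: "('k::field_char_0 P1, 'i, 'k) vbundle"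
  assumes E: "open_atlas E" "bundle_rank E = m" and W: "subbundle n m W"
    and R: "\<And>i. i \<in> chart_index E \<Longrightarrow> R i \<in> carrier_mat m n"
    and G: "\<And>i x. i \<in> chart_index E \<Longrightarrow> x \<in> chart E i \<Longrightarrow> G i x \<in> carrier_mat n m"
    and RG: "\<And>i x. i \<in> chart_index E \<Longrightarrow> x \<in> chart E i \<Longrightarrow> R i * G i x = 1\<^sub>m m"
    and image: "\<And>i x. i \<in> chart_index E \<Longrightarrow> x \<in> chart E i \<Longrightarrow> W x = mat_image (G i x) m"
    and trans: "\<And>i j x. i \<in> chart_index E \<Longrightarrow> j \<in> chart_index E \<Longrightarrow> x \<in> chart E i \<Longrightarrow> x \<in> chart E j \<Longrightarrow>
      transition E i j x = (R j * G i x)\<^sup>T"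
  obtains a L where "splitting E a L" "sorted a" "\<forall>x\<in>set a. 0 \<le> x"
proof -
  obtain d M where M: "form_sections n m W d M" "\<And>x. independent_cols n m (M x)"
    using subbundle_basis[OF W] by blast
  note Mc = form_sectionsD(1)[OF M(1)]
  have RM: "R i * M x \<in> carrier_mat m m" if "i \<in> chart_index E" for i x
    by (rule mult_carrier_mat[OF R[OF that] Mc])
  have basis: "G i x * (R i * M x) = M x" "det (R i * M x) \<noteq> 0"
    if h: "i \<in> chart_index E" "x \<in> chart E i" for i x
    using subbundle_basis_frame[where W = W, OF M G[OF h] R[OF h(1)] RG[OF h] image[OF h]] by auto
  have "splitting E (map (\<lambda>s. int (d s)) [0..<m])
    (\<lambda>k i x. mat_diag m (\<lambda>s. 1 / hcoord k x ^ d s) * (R i * M x)\<^sup>T)"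
  proof (rule splitting_from_forms[OF E])
    show "(R i * M x)\<^sup>T \<in> carrier_mat m m" if "i \<in> chart_index E" for i x using RM[OF that] by simp
    show "det (R i * M x)\<^sup>T \<noteq> 0" if "i \<in> chart_index E" "x \<in> chart E i" for i x
      using basis(2)[OF that] det_transpose[OF RM[OF that(1)]] by simp
    show "binary_form (d s) (\<lambda>x. (R i * M x)\<^sup>T $$ (s, t))"
      if "i \<in> chart_index E" "s < m" "t < m" for i s t
    proof -
      have "(R i * M x)\<^sup>T $$ (s, t) = (R i * M x) $$ (t, s)" for x
        using carrier_matD[OF RM[OF that(1), of x]] that by simp
      then show ?thesis
        using binary_form_const_mult_sections[OF M(1) R[OF that(1)] that(3,2)] by simp
    qed
    show "(R i * M x)\<^sup>T * transition E i j x = (R j * M x)\<^sup>T"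
      if h: "i \<in> chart_index E" "j \<in> chart_index E" "x \<in> chart E i" "x \<in> chart E j" for i j x
    proof -
      have "(R i * M x)\<^sup>T * transition E i j x = (R j * G i x * (R i * M x))\<^sup>T"
        unfolding trans[OF h]
        by (rule transpose_mult[OF mult_carrier_mat[OF R[OF h(2)] G[OF h(1,3)]] RM[OF h(1)], symmetric])
      also have "R j * G i x * (R i * M x) = R j * M x"
        using assoc_mult_mat[OF R[OF h(2)] G[OF h(1,3)] RM[OF h(1)]] basis(1)[OF h(1,3)] by simp
      finally show ?thesis .
    qed
  qed
  then obtain L where "splitting E (sort (map (\<lambda>s. int (d s)) [0..<m])) L"
    using splitting_sort[OF E(1)] by blast
  then show ?thesis by (rule that) auto
qed

lemma regular_at_frame:
  fixes f :: "'k::field P1 \<Rightarrow> 'k vec set"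
  assumes f: "is_morphism r n f" and I: "I \<in> gr_index r n" "f x \<in> gr_chart r n I"
  shows "i < n \<Longrightarrow> j < r \<Longrightarrow> regular_at (\<lambda>y. frame r n I (f y) $$ (i, j)) x"
    and "i < n - r \<Longrightarrow> j < n \<Longrightarrow> regular_at (\<lambda>y. coframe r n I (f y) $$ (i, j)) x"
proof -
  let ?U = "f -` gr_chart r n I" and ?R = "select n I :: 'k mat" and ?Q = "select n (- I) :: 'k mat"
  note sel = select_complementary[OF I(1), where 'k = 'k]
  have U: "zariski_open ?U" "x \<in> ?U" using f I unfolding is_morphism_def by auto
  have Z: "regular_at (\<lambda>y. gr_coords r n I (f y) $$ (i, j)) x" if "i < n - r" "j < r" for i j
  proof -
    have "regular_on ?U (\<lambda>y. gr_coords r n I (f y) $$ (i, j))"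
      using f I(1) that unfolding is_morphism_def by blast
    then show ?thesis using regular_on_iff[OF U(1)] U(2) by blast
  qed
  have fr: "frame r n I (f y) = ?R\<^sup>T + ?Q\<^sup>T * gr_coords r n I (f y)"
    "coframe r n I (f y) = ?Q - gr_coords r n I (f y) * ?R"
    "gr_coords r n I (f y) \<in> carrier_mat (n - r) r" if "y \<in> ?U" for y
  proof -
    have "f y \<in> gr_chart r n I" using that by simp
    note F = chart_frame[OF I(1) this]
    show "frame r n I (f y) = ?R\<^sup>T + ?Q\<^sup>T * gr_coords r n I (f y)"
      "coframe r n I (f y) = ?Q - gr_coords r n I (f y) * ?R" using F(5,9,10) by simp_all
    show "gr_coords r n I (f y) \<in> carrier_mat (n - r) r" using F(1,9) sel(2) by simp
  qed
  show "regular_at (\<lambda>y. frame r n I (f y) $$ (i, j)) x" if ij: "i < n" "j < r"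
  proof (rule regular_at_cong[OF _ U])
    show "regular_at (\<lambda>y. ?R\<^sup>T $$ (i, j) + (\<Sum>a<n - r. ?Q\<^sup>T $$ (i, a) * gr_coords r n I (f y) $$ (a, j))) x"
      using Z ij by (intro regular_at_add regular_at_sum regular_at_mult regular_at_const) auto
    show "?R\<^sup>T $$ (i, j) + (\<Sum>a<n - r. ?Q\<^sup>T $$ (i, a) * gr_coords r n I (f y) $$ (a, j)) =
        frame r n I (f y) $$ (i, j)" if "y \<in> ?U" for y
      unfolding fr(1)[OF that] using fr(3)[OF that] sel(1,2) ij
      by (simp add: scalar_prod_def lessThan_atLeast0)
  qed
  show "regular_at (\<lambda>y. coframe r n I (f y) $$ (i, j)) x" if ij: "i < n - r" "j < n"
  proof (rule regular_at_cong[OF _ U])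
    show "regular_at (\<lambda>y. ?Q $$ (i, j) + - (\<Sum>a<r. gr_coords r n I (f y) $$ (i, a) * ?R $$ (a, j))) x"
      using Z ij
      by (intro regular_at_add regular_at_uminus regular_at_sum regular_at_mult regular_at_const) auto
    show "?Q $$ (i, j) + - (\<Sum>a<r. gr_coords r n I (f y) $$ (i, a) * ?R $$ (a, j)) =
        coframe r n I (f y) $$ (i, j)" if "y \<in> ?U" for y
      unfolding fr(2)[OF that] using fr(3)[OF that] sel(1,2) ij
      by (simp add: scalar_prod_def lessThan_atLeast0)
  qed
qed

lemma morphism_chart:
  fixes f :: "'k::field P1 \<Rightarrow> 'k vec set"
  assumes f: "is_morphism r n f"
  obtains I where "I \<in> gr_index r n" "f x \<in> gr_chart r n I"
    "zariski_open (f -` gr_chart r n I)" "x \<in> f -` gr_chart r n I"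
  using gr_charts_cover[of "f x" r n] f unfolding is_morphism_def by auto

lemma subbundle_morphism:
  fixes f :: "'k::field P1 \<Rightarrow> 'k vec set"
  assumes f: "is_morphism r n f"
  shows "subbundle n r f"
  unfolding subbundle_def
proof
  fix x
  obtain I where I: "I \<in> gr_index r n" "f x \<in> gr_chart r n I"
    and U: "zariski_open (f -` gr_chart r n I)" "x \<in> f -` gr_chart r n I"
    using morphism_chart[OF f] by blast
  have "local_frame n r f x (f -` gr_chart r n I) (\<lambda>y. frame r n I (f y)) (select n I)"
    unfolding local_frame_def
  proof (intro conjI ballI allI impI)
    show "zariski_open (f -` gr_chart r n I)" "x \<in> f -` gr_chart r n I" by fact+
    show "select n I \<in> carrier_mat r n" by (rule select_complementary(1)[OF I(1)])
    show "regular_at (\<lambda>y. frame r n I (f y) $$ (i, j)) x" if "i < n" "j < r" for i j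
      by (rule regular_at_frame(1)[OF f I that])
    fix y assume "y \<in> f -` gr_chart r n I"
    then have "f y \<in> gr_chart r n I" by simp
    note F = chart_frame(1-3)[OF I(1) this]
    show "frame r n I (f y) \<in> carrier_mat n r" "select n I * frame r n I (f y) = 1\<^sub>m r"
      "f y = mat_image (frame r n I (f y)) r" by (rule F)+
  qed
  then show "\<exists>U F R. local_frame n r f x U F R" by blast
qed

text \<open>The dual of the fibre of the universal quotient, identified with row vectors by the dot product.\<close>

definition annihilator :: "nat \<Rightarrow> 'k::field vec set \<Rightarrow> 'k vec set" where
  "annihilator n V = {w \<in> carrier_vec n. \<forall>v\<in>V. w \<bullet> v = 0}"

lemma annihilator_eq_image:
  fixes V :: "'k::field vec set"
  assumes I: "I \<in> gr_index r n" "V \<in> gr_chart r n I"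
  shows "annihilator n V = mat_image ((coframe r n I V)\<^sup>T) (n - r)"
proof -
  note F = chart_frame[OF I] and sel = select_complementary[OF I(1), where 'k = 'k]
  let ?C = "coframe r n I V" and ?F = "frame r n I V" and ?P = "(select n (- I) :: 'k mat)\<^sup>T"
  have P: "?P \<in> carrier_mat n (n - r)" using sel by simp
  note VF = equalityD1[OF F(3)] equalityD2[OF F(3)]
  show ?thesis
  proof
    show "mat_image (?C\<^sup>T) (n - r) \<subseteq> annihilator n V"
    proof
      fix w assume "w \<in> mat_image (?C\<^sup>T) (n - r)"
      then obtain u where u: "u \<in> carrier_vec (n - r)" "w = ?C\<^sup>T *\<^sub>v u" by blast
      have "w \<bullet> v = 0" if v: "v \<in> V" for v
      proof -
        obtain z where z: "z \<in> carrier_vec r" "v = ?F *\<^sub>v z" using subsetD[OF VF(1) v] by blast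
        have "w \<bullet> v = u \<bullet> (?C *\<^sub>v v)"
          unfolding u(2) using transpose_vec_mult_scalar[OF F(4) _ u(1), of v] z F(1) by simp
        also have "?C *\<^sub>v v = 0\<^sub>v (n - r)"
          unfolding z(2) using assoc_mult_mat_vec[OF F(4,1) z(1)] F(7) zero_mat_mult_vec[OF z(1)] by simp
        finally show ?thesis using u by simp
      qed
      then show "w \<in> annihilator n V" unfolding annihilator_def using u F(4) by simp
    qed
    show "annihilator n V \<subseteq> mat_image (?C\<^sup>T) (n - r)"
    proof
      fix w assume w: "w \<in> annihilator n V"
      then have wn: "w \<in> carrier_vec n" unfolding annihilator_def by simp
      have Fw: "?F\<^sup>T *\<^sub>v w = 0\<^sub>v r"
      proof (rule eq_vecI)
        fix j assume "j < dim_vec (0\<^sub>v r :: 'k vec)"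
        then have j: "j < r" by simp
        have "col ?F j = ?F *\<^sub>v unit_vec r j" using F(1) j by (intro eq_vecI) auto
        then have "col ?F j \<in> V" using subsetD[OF VF(2)] by simp
        then have "w \<bullet> col ?F j = 0" using w unfolding annihilator_def by blast
        then show "(?F\<^sup>T *\<^sub>v w) $ j = 0\<^sub>v r $ j"
          using F(1) j wn comm_scalar_prod[OF wn, of "col ?F j"] by simp
      qed (use F(1) in simp)
      have "w = (?F * select n I + ?P * ?C)\<^sup>T *\<^sub>v w" using F(8) wn by simp
      also have "(?F * select n I + ?P * ?C)\<^sup>T = (select n I)\<^sup>T * ?F\<^sup>T + ?C\<^sup>T * ?P\<^sup>T"
        using transpose_add[OF mult_carrier_mat[OF F(1) sel(1)] mult_carrier_mat[OF P F(4)]]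
          transpose_mult[OF F(1) sel(1)] transpose_mult[OF P F(4)] by simp
      also have "\<dots> *\<^sub>v w = (select n I)\<^sup>T * ?F\<^sup>T *\<^sub>v w + ?C\<^sup>T * ?P\<^sup>T *\<^sub>v w"
        using F sel P wn by (intro add_mult_distrib_mat_vec[of _ n n]) auto
      also have "(select n I)\<^sup>T * ?F\<^sup>T *\<^sub>v w = (select n I)\<^sup>T *\<^sub>v (?F\<^sup>T *\<^sub>v w)"
        using F(1) sel(1) wn by (intro assoc_mult_mat_vec[of _ n r _ n]) auto
      also have "\<dots> = 0\<^sub>v n" unfolding Fw using sel(1) by (intro mult_mat_zero_vec) simp
      also have "?C\<^sup>T * ?P\<^sup>T *\<^sub>v w = ?C\<^sup>T *\<^sub>v (?P\<^sup>T *\<^sub>v w)"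
        using F(4) P wn by (intro assoc_mult_mat_vec[of _ n "n - r" _ n]) auto
      finally have "w = ?C\<^sup>T *\<^sub>v (?P\<^sup>T *\<^sub>v w)" using F(4) P wn by simp
      moreover have "?P\<^sup>T *\<^sub>v w \<in> carrier_vec (n - r)" using P wn by simp
      ultimately show "w \<in> mat_image (?C\<^sup>T) (n - r)" by blast
    qed
  qed
qed

lemma select_mult_coframe_transpose:
  fixes V :: "'k::field vec set"
  assumes I: "I \<in> gr_index r n" "V \<in> gr_chart r n I"
  shows "select n (- I) * (coframe r n I V)\<^sup>T = 1\<^sub>m (n - r)"
proof -
  note F = chart_frame[OF I] and sel = select_complementary[OF I(1), where 'k = 'k]
  have "(coframe r n I V * (select n (- I))\<^sup>T)\<^sup>T = select n (- I) * (coframe r n I V)\<^sup>T"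
    using transpose_mult[of "coframe r n I V" "n - r" n "(select n (- I))\<^sup>T" "n - r"] F(4) sel(2)
    by simp
  then show ?thesis unfolding F(6) by simp
qed

lemma subbundle_annihilator:
  fixes f :: "'k::field P1 \<Rightarrow> 'k vec set"
  assumes f: "is_morphism r n f"
  shows "subbundle n (n - r) (\<lambda>x. annihilator n (f x))"
  unfolding subbundle_def
proof
  fix x
  obtain I where I: "I \<in> gr_index r n" "f x \<in> gr_chart r n I"
    and U: "zariski_open (f -` gr_chart r n I)" "x \<in> f -` gr_chart r n I"
    using morphism_chart[OF f] by blast
  let ?U = "f -` gr_chart r n I"
  have C: "coframe r n I (f y) \<in> carrier_mat (n - r) n" if "y \<in> ?U" for y
    using chart_frame(4)[OF I(1), of "f y"] that by simp
  have "local_frame n (n - r) (\<lambda>x. annihilator n (f x)) x ?U (\<lambda>y. (coframe r n I (f y))\<^sup>T)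
      (select n (- I))"
    unfolding local_frame_def
  proof (intro conjI ballI allI impI)
    show "zariski_open ?U" "x \<in> ?U" by fact+
    show "select n (- I) \<in> carrier_mat (n - r) n" by (rule select_complementary(2)[OF I(1)])
    show "(coframe r n I (f y))\<^sup>T \<in> carrier_mat n (n - r)" if "y \<in> ?U" for y using C[OF that] by simp
    show "select n (- I) * (coframe r n I (f y))\<^sup>T = 1\<^sub>m (n - r)" if "y \<in> ?U" for y
      using that by (intro select_mult_coframe_transpose[OF I(1)]) simp
    show "annihilator n (f y) = mat_image ((coframe r n I (f y))\<^sup>T) (n - r)"
      if "y \<in> ?U" for y using that by (intro annihilator_eq_image[OF I(1)]) simp
    show "regular_at (\<lambda>y. (coframe r n I (f y))\<^sup>T $$ (i, j)) x" if ij: "i < n" "j < n - r" for i j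
    proof (rule regular_at_cong[OF _ U])
      show "regular_at (\<lambda>y. coframe r n I (f y) $$ (j, i)) x"
        using regular_at_frame(2)[OF f I] ij by blast
      show "coframe r n I (f y) $$ (j, i) = (coframe r n I (f y))\<^sup>T $$ (i, j)" if "y \<in> ?U" for y
        using C[OF that] ij by simp
    qed
  qed
  then show "\<exists>U F R. local_frame n (n - r) (\<lambda>x. annihilator n (f x)) x U F R" by blast
qed

lemma dual_universal_sub_splits:
  fixes f :: "'k::field_char_0 P1 \<Rightarrow> 'k vec set"
  assumes f: "is_morphism r n f"
  obtains a L where "splitting (pullback f (dual (universal_sub r n))) a L"
    "sorted a" "\<forall>x\<in>set a. 0 \<le> x"
proof (rule dual_of_subbundle_splits[OF open_atlas_pullbacks(1)[OF f] _ subbundle_morphism[OF f]])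
  let ?E = "pullback f (dual (universal_sub r n))"
  have E: "chart_index ?E = gr_index r n" "\<And>I. chart ?E I = f -` gr_chart r n I"
    by (simp_all add: pullback_def dual_def universal_sub_def)
  show "bundle_rank ?E = r" by (simp add: pullback_def dual_def universal_sub_def)
  show "select n I \<in> carrier_mat r n" if "I \<in> chart_index ?E" for I
    using that select_complementary(1) E by blast
  fix I x assume h: "I \<in> chart_index ?E" "x \<in> chart ?E I"
  then have h': "I \<in> gr_index r n" "f x \<in> gr_chart r n I" using E by auto
  show "frame r n I (f x) \<in> carrier_mat n r" "select n I * frame r n I (f x) = 1\<^sub>m r"
    "f x = mat_image (frame r n I (f x)) r" by (rule chart_frame[OF h'])+
  fix J assume "J \<in> chart_index ?E" "x \<in> chart ?E J"
  then have "J \<in> gr_index r n" "f x \<in> gr_chart r n J" using E by auto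
  from transition_universal_sub[OF this h']
  show "transition ?E I J x = (select n J * frame r n I (f x))\<^sup>T"
    by (simp add: pullback_def dual_def)
qed (rule that)

lemma universal_quot_splits:
  fixes f :: "'k::field_char_0 P1 \<Rightarrow> 'k vec set"
  assumes f: "is_morphism r n f"
  obtains b L where "splitting (pullback f (universal_quot r n)) b L"
    "sorted b" "\<forall>x\<in>set b. 0 \<le> x"
proof (rule dual_of_subbundle_splits[OF open_atlas_pullbacks(2)[OF f] _ subbundle_annihilator[OF f]])
  let ?E = "pullback f (universal_quot r n)"
  have E: "chart_index ?E = gr_index r n" "\<And>I. chart ?E I = f -` gr_chart r n I"
    by (simp_all add: pullback_def universal_quot_def)
  show "bundle_rank ?E = n - r" by (simp add: pullback_def universal_quot_def)
  show "select n (- I) \<in> carrier_mat (n - r) n" if "I \<in> chart_index ?E" for I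
    using that select_complementary(2) E by blast
  fix I x assume h: "I \<in> chart_index ?E" "x \<in> chart ?E I"
  then have h': "I \<in> gr_index r n" "f x \<in> gr_chart r n I" using E by auto
  note C = chart_frame(4)[OF h']
  show Ct: "(coframe r n I (f x))\<^sup>T \<in> carrier_mat n (n - r)" using C by simp
  show "select n (- I) * (coframe r n I (f x))\<^sup>T = 1\<^sub>m (n - r)"
    by (rule select_mult_coframe_transpose[OF h'])
  show "annihilator n (f x) = mat_image ((coframe r n I (f x))\<^sup>T) (n - r)"
    by (rule annihilator_eq_image[OF h'])
  fix J assume "J \<in> chart_index ?E" "x \<in> chart ?E J"
  then have J: "J \<in> gr_index r n" "f x \<in> gr_chart r n J" using E by auto
  show "transition ?E I J x = (select n (- J) * (coframe r n I (f x))\<^sup>T)\<^sup>T"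
    using transition_universal_quot[OF h' J] transpose_mult[OF select_complementary(2)[OF J(1)] Ct]
    by (simp add: pullback_def)
qed (rule that)

lemma open_atlas_det_bundle: "open_atlas E \<Longrightarrow> open_atlas (det_bundle E)"
  unfolding open_atlas_def det_bundle_def by auto

lemma splitting_tangent:
  fixes f :: "'k::field_char_0 P1 \<Rightarrow> 'k vec set"
  assumes f: "is_morphism r n f"
    and a: "splitting (pullback f (dual (universal_sub r n))) a L"
    and b: "splitting (pullback f (universal_quot r n)) b M"
  shows "\<exists>N. splitting (pullback f (tangent_bundle r n)) (sum_types b a) N"
proof -
  have "splitting (pullback f (tangent_bundle r n)) (sum_types b a) (\<lambda>k i x. kronecker (M k i x) (L k i x))"
  proof (rule splitting_tensor[OF open_atlas_pullbacks(2)[OF f] b open_atlas_pullbacks(1)[OF f] a])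
    fix I J x
    assume h: "I \<in> chart_index (pullback f (universal_quot r n))"
      "J \<in> chart_index (pullback f (universal_quot r n))"
      "x \<in> chart (pullback f (universal_quot r n)) I"
      "x \<in> chart (pullback f (universal_quot r n)) J"
    then show "transition (pullback f (tangent_bundle r n)) I J x =
      kronecker (transition (pullback f (universal_quot r n)) I J x)
        (transition (pullback f (dual (universal_sub r n))) I J x)"
      using transition_tangent_bundle[of I r n "f x" J]
      by (simp add: pullback_def universal_quot_def)
  qed (simp_all add: pullback_def universal_quot_def universal_sub_def dual_def tangent_bundle_def
      mult.commute)
  then show ?thesis by blast
qed

text \<open>The determinant of the dual of the universal sub-bundle has degree \<open>e\<close> by the definition of the
  degree of a morphism, and up to constants the universal quotient has the same determinant.\<close>

lemma splitting_degrees: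
  fixes f :: "'k::{alg_closed_field, field_char_0} P1 \<Rightarrow> 'k vec set"
  assumes f: "f \<in> Mor e r n"
    and a: "splitting (pullback f (dual (universal_sub r n))) a L"
    and b: "splitting (pullback f (universal_quot r n)) b M"
  shows "sum_list a = int e" "sum_list b = int e"
proof -
  have mor: "is_morphism r n f" using f unfolding Mor_def by blast
  let ?S = "pullback f (dual (universal_sub r n))" and ?Q = "pullback f (universal_quot r n)"
  note atlas = open_atlas_pullbacks(1,2)[OF mor]
  note det_atlas = atlas[THEN open_atlas_det_bundle]
  have "pullback f (det_bundle (dual (universal_sub r n))) = det_bundle ?S"
    by (simp add: pullback_def det_bundle_def)
  then have "bundle_iso (det_bundle ?S) (sum_O [int e])" using f unfolding Mor_def by simp
  then obtain N where N: "splitting (det_bundle ?S) [int e] N"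
    using bundle_iso_sum_O_iff[OF det_atlas(1)] by blast
  have "mset [sum_list a] = mset [int e]"
    by (rule splitting_type_unique[OF det_atlas(1) splitting_det_bundle[OF atlas(1) a] N])
  then show "sum_list a = int e" by simp
  define c :: "nat set \<Rightarrow> 'k" where "c I = 1 / chart_sign n I" for I
  have "splitting (det_bundle ?S) [sum_list b] (\<lambda>k I x. c I \<cdot>\<^sub>m mat 1 1 (\<lambda>_. det (M k I x)))"
  proof (rule splitting_rescale[OF det_atlas(2) splitting_det_bundle[OF atlas(2) b]])
    show "c I \<noteq> 0" if "I \<in> chart_index (det_bundle ?Q)" for I
    proof -
      have I: "I \<in> gr_index r n" using that by (simp add: det_bundle_def pullback_def universal_quot_def)
      show ?thesis using chart_sign_nonzero[OF I gr_chart_point(1)[OF I zero_carrier_mat]]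
        by (simp add: c_def)
    qed
    fix I J x
    assume "I \<in> chart_index (det_bundle ?Q)" "J \<in> chart_index (det_bundle ?Q)"
      "x \<in> chart (det_bundle ?Q) I" "x \<in> chart (det_bundle ?Q) J"
    then have h: "I \<in> gr_index r n" "f x \<in> gr_chart r n I" "J \<in> gr_index r n" "f x \<in> gr_chart r n J"
      by (simp_all add: det_bundle_def pullback_def universal_quot_def)
    note nzI = chart_sign_nonzero[OF h(1,2)] and nzJ = chart_sign_nonzero[OF h(3,4)]
    have g: "select n J * frame r n I (f x) \<in> carrier_mat r r"
      using chart_frame(1)[OF h(1,2)] select_complementary(1)[OF h(3), where 'k = 'k] by simp
    have "det (transition ?S I J x) = det (select n J * frame r n I (f x))"
      using transition_universal_sub[OF h(3,4,1,2)] det_transpose[OF g]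
      by (simp add: pullback_def dual_def)
    moreover have "det (transition ?Q I J x) =
        chart_sign n J / chart_sign n I * det (select n J * frame r n I (f x))"
      using transition_universal_quot[OF h] det_transitions[OF h] by (simp add: pullback_def)
    ultimately have "det (transition ?S I J x) = c J / c I * det (transition ?Q I J x)"
      using nzI nzJ by (simp add: c_def)
    then show "transition (det_bundle ?S) I J x = (c J / c I) \<cdot>\<^sub>m transition (det_bundle ?Q) I J x"
      by (auto simp: det_bundle_def intro!: eq_matI)
  qed (simp_all add: det_bundle_def pullback_def universal_quot_def universal_sub_def dual_def)
  then have "mset [sum_list b] = mset [int e]"
    by (rule splitting_type_unique[OF det_atlas(1) _ N])
  then show "sum_list b = int e" by simp
qed


section \<open>Fillings\<close>

definition sum_matrix :: "int list \<Rightarrow> int list \<Rightarrow> int mat" where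
  "sum_matrix a b = mat (length a) (length b) (\<lambda>(i, j). a ! i + b ! j)"

lemma mset_sum_types_eq_entries:
  assumes "length a = r" "length b = n - r"
    and A: "\<And>i j. i < r \<Longrightarrow> j < n - r \<Longrightarrow> a ! i + b ! j = A $$ (i, j)"
  shows "mset (sum_types b a) = image_mset (\<lambda>ij. A $$ ij) (mset_set ({..<r} \<times> {..<n - r}))"
proof -
  have swap: "mset_set ({..<n - r} \<times> {..<r}) = image_mset prod.swap (mset_set ({..<r} \<times> {..<n - r}))"
    by (subst image_mset_mset_set) (auto simp: product_swap)
  show ?thesis
    unfolding mset_sum_types assms swap multiset.map_comp o_def
    by (rule image_mset_cong) (auto simp: A add.commute)
qed

lemma sum_matrix_is_filling:
  assumes len: "length a = r" "length b = n - r" and sorted: "sorted a" "sorted b"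
  shows "is_filling r n (mset (sum_types b a)) (sum_matrix a b)"
proof -
  have "image_mset (\<lambda>ij. sum_matrix a b $$ ij) (mset_set ({..<r} \<times> {..<n - r})) = mset (sum_types b a)"
    by (rule mset_sum_types_eq_entries[symmetric]) (simp_all add: len sum_matrix_def)
  then show ?thesis
    unfolding is_filling_def using len sorted
    by (auto simp: sum_matrix_def sorted_iff_nth_Suc)
qed

theorem proposition26:
  fixes n r e :: nat and C :: "int multiset"
  assumes "n \<ge> 4" and "2 \<le> r" and "r \<le> n - 2" and "e \<ge> 1"
    and "size C = r * (n - r)"
    and "\<exists>f \<in> (Mor e r n :: ('k::{alg_closed_field, field_char_0} P1 \<Rightarrow> 'k vec set) set).
           has_splitting_type (pullback f (tangent_bundle r n)) C"
  shows "(tangent_locus e r n C :: ('k P1 \<Rightarrow> 'k vec set) set) =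
           (\<Union>(A, a, b) \<in> filling_types e r n C. M_quot e r n b \<inter> M_sub e r n a) \<and>
         disjoint_family_on
           (\<lambda>(A, a, b). M_quot e r n b \<inter> M_sub e r n a :: ('k P1 \<Rightarrow> 'k vec set) set)
           (filling_types e r n C)"
proof
  let ?S = "\<lambda>f :: 'k P1 \<Rightarrow> 'k vec set. pullback f (dual (universal_sub r n))"
    and ?Q = "\<lambda>f :: 'k P1 \<Rightarrow> 'k vec set. pullback f (universal_quot r n)"
    and ?T = "\<lambda>f :: 'k P1 \<Rightarrow> 'k vec set. pullback f (tangent_bundle r n)"
  have mor: "is_morphism r n f" if "f \<in> Mor e r n" for f :: "'k P1 \<Rightarrow> 'k vec set"
    using that unfolding Mor_def by blast
  have rank: "bundle_rank (?S f) = r" "bundle_rank (?Q f) = n - r" for f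
    by (simp_all add: pullback_def dual_def universal_sub_def universal_quot_def)
  note iso_iff = open_atlas_pullbacks[THEN bundle_iso_sum_O_iff]
  note unique = open_atlas_pullbacks[THEN splitting_type_unique]
  show "(tangent_locus e r n C :: ('k P1 \<Rightarrow> 'k vec set) set) =
      (\<Union>(A, a, b) \<in> filling_types e r n C. M_quot e r n b \<inter> M_sub e r n a)"
  proof (intro equalityI subsetI)
    fix f :: "'k P1 \<Rightarrow> 'k vec set"
    assume "f \<in> tangent_locus e r n C"
    then have f: "f \<in> Mor e r n" and "has_splitting_type (?T f) C"
      unfolding tangent_locus_def by auto
    then obtain ds N where ds: "mset ds = C" and N: "splitting (?T f) ds N"
      unfolding has_splitting_type_def iso_iff(3)[OF mor[OF f]] by blast
    obtain a L where a: "splitting (?S f) a L" "sorted a" "\<forall>x\<in>set a. 0 \<le> x"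
      using dual_universal_sub_splits[OF mor[OF f]] by blast
    obtain b M where b: "splitting (?Q f) b M" "sorted b" "\<forall>x\<in>set b. 0 \<le> x"
      using universal_quot_splits[OF mor[OF f]] by blast
    have len: "length a = r" "length b = n - r"
      using splittingD(1)[OF a(1)] splittingD(1)[OF b(1)] rank by simp_all
    obtain N' where N': "splitting (?T f) (sum_types b a) N'"
      using splitting_tangent[OF mor[OF f] a(1) b(1)] by blast
    have C: "mset (sum_types b a) = C"
      using unique(3)[OF mor[OF f] N' N] ds by simp
    have "is_filling r n C (sum_matrix a b)"
      using sum_matrix_is_filling[OF len a(2) b(2)] C by simp
    moreover have "arises_from e r n (sum_matrix a b) a b"
      unfolding arises_from_def using a b len splitting_degrees[OF f a(1) b(1)]
      by (simp add: sum_matrix_def)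
    ultimately have "(sum_matrix a b, a, b) \<in> filling_types e r n C"
      unfolding filling_types_def by simp
    moreover have "f \<in> M_quot e r n b \<inter> M_sub e r n a"
      unfolding M_quot_def M_sub_def iso_iff(1)[OF mor[OF f]] iso_iff(2)[OF mor[OF f]]
      using f a(1) b(1) iso_iff(1,2)[OF mor[OF f]] by blast
    ultimately show "f \<in> (\<Union>(A, a, b) \<in> filling_types e r n C. M_quot e r n b \<inter> M_sub e r n a)"
      by blast
  next
    fix f :: "'k P1 \<Rightarrow> 'k vec set"
    assume "f \<in> (\<Union>(A, a, b) \<in> filling_types e r n C. M_quot e r n b \<inter> M_sub e r n a)"
    then obtain A a b where fill: "is_filling r n C A" and arises: "arises_from e r n A a b"
      and f: "f \<in> Mor e r n" and iso: "bundle_iso (?Q f) (sum_O b)" "bundle_iso (?S f) (sum_O a)"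
      unfolding filling_types_def M_quot_def M_sub_def by auto
    obtain L where L: "splitting (?S f) a L" using iso(2) iso_iff(1)[OF mor[OF f]] by blast
    obtain M where M: "splitting (?Q f) b M" using iso(1) iso_iff(2)[OF mor[OF f]] by blast
    have "bundle_iso (?T f) (sum_O (sum_types b a))"
      using splitting_tangent[OF mor[OF f] L M] iso_iff(3)[OF mor[OF f]] by blast
    moreover have "mset (sum_types b a) = C"
      using mset_sum_types_eq_entries[of a r b n A] arises fill
      unfolding arises_from_def is_filling_def by simp
    ultimately have "has_splitting_type (?T f) C" unfolding has_splitting_type_def by blast
    then show "f \<in> tangent_locus e r n C" unfolding tangent_locus_def using f by blast
  qed
  let ?M = "\<lambda>(A, a, b). M_quot e r n b \<inter> M_sub e r n a :: ('k P1 \<Rightarrow> 'k vec set) set"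
  show "disjoint_family_on ?M (filling_types e r n C)"
    unfolding disjoint_family_on_def
  proof (intro ballI impI)
    fix s s' assume s: "s \<in> filling_types e r n C" and s': "s' \<in> filling_types e r n C" and "s \<noteq> s'"
    obtain A a b A' a' b' where s_eq: "s = (A, a, b)" "s' = (A', a', b')" by (cases s, cases s') auto
    have fill: "is_filling r n C A" "is_filling r n C A'" "arises_from e r n A a b"
      "arises_from e r n A' a' b'" using s s' unfolding s_eq filling_types_def by auto
    have "s = s'" if f: "f \<in> M_quot e r n b \<inter> M_sub e r n a" "f \<in> M_quot e r n b' \<inter> M_sub e r n a'"
      for f :: "'k P1 \<Rightarrow> 'k vec set"
    proof -
      have m: "is_morphism r n f" using f mor unfolding M_quot_def by blast
      have iso: "bundle_iso (?S f) (sum_O a)" "bundle_iso (?S f) (sum_O a')"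
        "bundle_iso (?Q f) (sum_O b)" "bundle_iso (?Q f) (sum_O b')"
        using f unfolding M_quot_def M_sub_def by blast+
      have "mset a = mset a'"
        using iso(1,2) unique(1)[OF m] unfolding iso_iff(1)[OF m] by blast
      moreover have "mset b = mset b'"
        using iso(3,4) unique(2)[OF m] unfolding iso_iff(2)[OF m] by blast
      ultimately have "a = a'" "b = b'"
        using fill(3,4) unfolding arises_from_def by (metis properties_for_sort)+
      moreover have "A = A'"
        using fill \<open>a = a'\<close> \<open>b = b'\<close> unfolding is_filling_def arises_from_def
        by (intro eq_matI) auto
      ultimately show ?thesis by (simp add: s_eq)
    qed
    then show "?M s \<inter> ?M s' = {}"
      using \<open>s \<noteq> s'\<close> unfolding s_eq by blast
  qed
qed

end
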